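(* Let $M$ be a closed oriented connected smooth manifold of dimension $n\ge 2$, let $\mathcal{C}$ be a conformal class of Riemannian metrics on $M$, and let $V$ be a natural scalar invariant that is naturally conformally variational within $\mathcal{C}$. Then for any $g\in\mathcal{C}$ and any conformal vector field $X$ on $(M,g)$, $$0=\int_M (\operatorname{div} X)\,V\,dv_g=-\int_M (\mathcal{L}_X V)\,dv_g ,$$ where $V=V(g)$.
   Context: Everything is smooth. $\mathcal{L}_X$ is the Lie derivative, $dv_g$ the Riemannian measure, $\operatorname{div}X=\nabla_aX^a$ for the Levi-Civita connection $\nabla$ of $g$. A conformal vector field is a vector field $X$ with $\mathcal{L}_Xg=\frac{2}{n}(\operatorname{div}X)g$. A natural scalar invariant is a scalar function $V(g)$ given by a universal expression, polynomial in the finite jets of the metric and its inverse, with $\phi^*V(g)=V(\phi^*g)$ for every diffeomorphism $\phi:M\to M$. Let $\mathcal{M}$ be the space of Riemannian metrics on $M$ (with the $C^\infty$ topology). A Riemannian functional is a real-valued functional $\mathcal{S}$ on $\mathcal{M}$ with $\mathcal{S}(\phi^*g)=\mathcal{S}(g)$ for all $g\in\mathcal{M}$ and all diffeomorphisms $\phi$ of $M$. A differentiable Riemannian functional has gradient $B(g)$ at $g$ if $B(g)$ is a smooth symmetric 2-tensor with $\mathcal{S}'(g)(h)=\int_M (h,B(g))\,dv_g$ for all smooth symmetric 2-tensors $h$, where $(\cdot,\cdot)$ is the pointwise pairing by metric contraction. For a conformal class $\mathcal{C}=\{e^{2\Upsilon}g\mid \Upsilon\in C^\infty(M)\}$, a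 functional $\mathcal{S}$ on $\mathcal{C}$ is a functional for $V$ in $\mathcal{C}$ if for all $g\in\mathcal{C}$ and all $\omega\in C^\infty(M)$, $$\mathcal{S}^\bullet(g)(\omega):=\frac{d}{ds}\Big|_{s=0}\mathcal{S}(e^{2s\omega}g)=2\int_M\omega V(g)\,dv_g .$$ $V$ is naturally conformally variational within $\mathcal{C}$ if there is such an $\mathcal{S}$ that is (the restriction to $\mathcal{C}$ of) a Riemannian functional admitting a gradient at every $g\in\mathcal{C}$. *)

theory Defs
  imports "HOL-Analysis.Analysis"
begin

section \<open>Smooth functions on open subsets of a normed space\<close>

text \<open>Both predicates are meant for open \<open>U\<close>, where they do not depend on values off \<open>U\<close>.\<close>

fun Ck_on :: "nat \<Rightarrow> 'b::real_normed_vector set \<Rightarrow> ('b \<Rightarrow> 'c::real_normed_vector) \<Rightarrow> bool" where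
  "Ck_on 0 U f \<longleftrightarrow> continuous_on U f"
| "Ck_on (Suc k) U f \<longleftrightarrow>
     (\<forall>x\<in>U. f differentiable (at x)) \<and> (\<forall>v. Ck_on k U (\<lambda>x. frechet_derivative f (at x) v))"

definition smooth_on :: "'b::real_normed_vector set \<Rightarrow> ('b \<Rightarrow> 'c::real_normed_vector) \<Rightarrow> bool" where
  "smooth_on U f \<longleftrightarrow> (\<forall>k. Ck_on k U f)"

definition pd :: "'n::finite \<Rightarrow> (real^'n \<Rightarrow> 'c::real_normed_vector) \<Rightarrow> real^'n \<Rightarrow> 'c" where
  "pd i f x = frechet_derivative f (at x) (axis i 1)"

text \<open>A multi-index is given as a list of coordinate directions.\<close>

definition pds :: "'n::finite list \<Rightarrow> (real^'n \<Rightarrow> 'c::real_normed_vector) \<Rightarrow> real^'n \<Rightarrow> 'c" where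
  "pds is f = foldr pd is f"


section \<open>Smooth manifolds\<close>

text \<open>The manifold is the whole type \<open>'a\<close>; its dimension is \<open>CARD('n)\<close>. A chart is a pair of
  its domain and its coordinate map, whose values off the domain are irrelevant.\<close>

type_synonym ('a, 'n) chart = "'a set \<times> ('a \<Rightarrow> real^'n)"

abbreviation cdom :: "('a, 'n) chart \<Rightarrow> 'a set" where "cdom \<kappa> \<equiv> fst \<kappa>"
abbreviation cmap :: "('a, 'n) chart \<Rightarrow> 'a \<Rightarrow> real^'n" where "cmap \<kappa> \<equiv> snd \<kappa>"
abbreviation cimg :: "('a, 'n) chart \<Rightarrow> (real^'n) set" where "cimg \<kappa> \<equiv> snd \<kappa> ` fst \<kappa>"
abbreviation cinv :: "('a, 'n) chart \<Rightarrow> real^'n \<Rightarrow> 'a" where "cinv \<kappa> \<equiv> inv_into (fst \<kappa>) (snd \<kappa>)"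

definition is_chart :: "('a::topological_space, 'n::finite) chart \<Rightarrow> bool" where
  "is_chart \<kappa> \<longleftrightarrow> open (cdom \<kappa>) \<and> open (cimg \<kappa>) \<and>
     homeomorphism (cdom \<kappa>) (cimg \<kappa>) (cmap \<kappa>) (cinv \<kappa>)"

definition transition :: "('a, 'n::finite) chart \<Rightarrow> ('a, 'n) chart \<Rightarrow> real^'n \<Rightarrow> real^'n" where
  "transition \<kappa> \<tau> = cmap \<tau> \<circ> cinv \<kappa>"

definition compatible :: "('a, 'n::finite) chart \<Rightarrow> ('a, 'n) chart \<Rightarrow> bool" where
  "compatible \<kappa> \<tau> \<longleftrightarrow>
     smooth_on (cmap \<kappa> ` (cdom \<kappa> \<inter> cdom \<tau>)) (transition \<kappa> \<tau>) \<and>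
     smooth_on (cmap \<tau> ` (cdom \<kappa> \<inter> cdom \<tau>)) (transition \<tau> \<kappa>)"

text \<open>A smooth structure is a maximal smooth atlas.\<close>

definition smooth_structure :: "('a::topological_space, 'n::finite) chart set \<Rightarrow> bool" where
  "smooth_structure A \<longleftrightarrow>
     (\<forall>\<kappa>\<in>A. is_chart \<kappa>) \<and> (\<Union>\<kappa>\<in>A. cdom \<kappa>) = UNIV \<and>
     (\<forall>\<kappa>\<in>A. \<forall>\<tau>\<in>A. compatible \<kappa> \<tau>) \<and>
     (\<forall>\<kappa>. is_chart \<kappa> \<and> (\<forall>\<tau>\<in>A. compatible \<kappa> \<tau>) \<longrightarrow> \<kappa> \<in> A)"

definition oriented_atlas ::
    "('a::topological_space, 'n::finite) chart set \<Rightarrow> ('a, 'n) chart set \<Rightarrow> bool" where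
  "oriented_atlas A Or \<longleftrightarrow>
     Or \<subseteq> A \<and> (\<Union>\<kappa>\<in>Or. cdom \<kappa>) = UNIV \<and>
     (\<forall>\<kappa>\<in>Or. \<forall>\<tau>\<in>Or. \<forall>p\<in>cdom \<kappa> \<inter> cdom \<tau>.
        det (jacobian (transition \<kappa> \<tau>) (at (cmap \<kappa> p))) > 0)"

definition smooth_fun :: "('a, 'n::finite) chart set \<Rightarrow> ('a \<Rightarrow> real) \<Rightarrow> bool" where
  "smooth_fun A f \<longleftrightarrow> (\<forall>\<kappa>\<in>A. smooth_on (cimg \<kappa>) (f \<circ> cinv \<kappa>))"

definition smooth_map ::
    "('a::topological_space, 'n::finite) chart set \<Rightarrow> ('a \<Rightarrow> 'a) \<Rightarrow> bool" where
  "smooth_map A \<phi> \<longleftrightarrow> continuous_on UNIV \<phi> \<and>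
     (\<forall>\<kappa>\<in>A. \<forall>\<tau>\<in>A.
        smooth_on (cmap \<kappa> ` (cdom \<kappa> \<inter> \<phi> -` cdom \<tau>)) (cmap \<tau> \<circ> \<phi> \<circ> cinv \<kappa>))"

definition diffeo ::
    "('a::topological_space, 'n::finite) chart set \<Rightarrow> ('a \<Rightarrow> 'a) \<Rightarrow> bool" where
  "diffeo A \<phi> \<longleftrightarrow> bij \<phi> \<and> smooth_map A \<phi> \<and> smooth_map A (inv \<phi>)"


section \<open>Tensor fields\<close>

text \<open>The tangent space at \<open>p\<close> is realised as \<open>real^'n\<close>, by means of the coordinate basis of one
  chart chosen once and for all around \<open>p\<close>. So a vector field is a function \<open>X\<close> with values in
  \<open>real^'n\<close>, a covariant 2-tensor field is a function \<open>h\<close> with values in \<open>real^'n^'n\<close>, and \<open>X p\<close>,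
  \<open>h p\<close> are the components at \<open>p\<close> with respect to \<open>chart_at A p\<close>. The choice depends on \<open>p\<close>
  discontinuously, hence smoothness is a condition on the components \<open>coords_vec\<close>,
  \<open>coords_ten\<close> in a fixed chart, which come from the usual transformation laws.\<close>

definition chart_at :: "('a, 'n::finite) chart set \<Rightarrow> 'a \<Rightarrow> ('a, 'n) chart" where
  "chart_at A p = (SOME \<kappa>. \<kappa> \<in> A \<and> p \<in> cdom \<kappa>)"

definition coords_vec ::
    "('a, 'n::finite) chart set \<Rightarrow> ('a, 'n) chart \<Rightarrow> ('a \<Rightarrow> real^'n) \<Rightarrow> real^'n \<Rightarrow> real^'n" where
  "coords_vec A \<kappa> X x =
     (let p = cinv \<kappa> x; \<tau> = chart_at A p
      in jacobian (transition \<tau> \<kappa>) (at (cmap \<tau> p)) *v X p)"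

definition coords_ten ::
    "('a, 'n::finite) chart set \<Rightarrow> ('a, 'n) chart \<Rightarrow> ('a \<Rightarrow> real^'n^'n) \<Rightarrow> real^'n \<Rightarrow> real^'n^'n" where
  "coords_ten A \<kappa> h x =
     (let p = cinv \<kappa> x; J = jacobian (transition \<kappa> (chart_at A p)) (at x)
      in transpose J ** h p ** J)"

definition vector_field :: "('a, 'n::finite) chart set \<Rightarrow> ('a \<Rightarrow> real^'n) \<Rightarrow> bool" where
  "vector_field A X \<longleftrightarrow> (\<forall>\<kappa>\<in>A. smooth_on (cimg \<kappa>) (coords_vec A \<kappa> X))"

definition sym_tensor :: "('a, 'n::finite) chart set \<Rightarrow> ('a \<Rightarrow> real^'n^'n) \<Rightarrow> bool" where
  "sym_tensor A h \<longleftrightarrow>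
     (\<forall>\<kappa>\<in>A. smooth_on (cimg \<kappa>) (coords_ten A \<kappa> h)) \<and> (\<forall>p. transpose (h p) = h p)"

definition riemannian_metric :: "('a, 'n::finite) chart set \<Rightarrow> ('a \<Rightarrow> real^'n^'n) \<Rightarrow> bool" where
  "riemannian_metric A g \<longleftrightarrow> sym_tensor A g \<and> (\<forall>p v. v \<noteq> 0 \<longrightarrow> v \<bullet> (g p *v v) > 0)"

text \<open>\<open>(\<phi>\<^sup>*h)\<^sub>p(v,w) = h\<^bsub>\<phi>(p)\<^esub>(d\<phi> v, d\<phi> w)\<close>\<close>

definition pullback ::
    "('a, 'n::finite) chart set \<Rightarrow> ('a \<Rightarrow> 'a) \<Rightarrow> ('a \<Rightarrow> real^'n^'n) \<Rightarrow> 'a \<Rightarrow> real^'n^'n" where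
  "pullback A \<phi> h p =
     (let J = jacobian (cmap (chart_at A (\<phi> p)) \<circ> \<phi> \<circ> cinv (chart_at A p))
                (at (cmap (chart_at A p) p))
      in transpose J ** h (\<phi> p) ** J)"


section \<open>Riemannian geometry\<close>

definition christoffel ::
    "(real^'n \<Rightarrow> real^'n^'n) \<Rightarrow> real^'n \<Rightarrow> 'n::finite \<Rightarrow> 'n \<Rightarrow> 'n \<Rightarrow> real" where
  "christoffel G x k i j =
     (1/2) * (\<Sum>l\<in>UNIV. matrix_inv (G x) $ k $ l *
        (pd i G x $ j $ l + pd j G x $ i $ l - pd l G x $ i $ j))"

text \<open>\<open>\<nabla>\<^sub>a Y\<^sup>b\<close> for the Levi-Civita connection of the metric with components \<open>G\<close>.\<close>

definition cov_deriv ::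
    "(real^'n \<Rightarrow> real^'n^'n) \<Rightarrow> (real^'n \<Rightarrow> real^'n) \<Rightarrow> real^'n \<Rightarrow> 'n::finite \<Rightarrow> 'n \<Rightarrow> real" where
  "cov_deriv G Y x a b = pd a Y x $ b + (\<Sum>c\<in>UNIV. christoffel G x b a c * Y x $ c)"

text \<open>The following are pointwise tensorial, so they are computed in the chart that represents
  the tangent space at the point.\<close>

definition divergence ::
    "('a, 'n::finite) chart set \<Rightarrow> ('a \<Rightarrow> real^'n^'n) \<Rightarrow> ('a \<Rightarrow> real^'n) \<Rightarrow> 'a \<Rightarrow> real" where
  "divergence A g X p =
     (let \<tau> = chart_at A p
      in \<Sum>a\<in>UNIV. cov_deriv (coords_ten A \<tau> g) (coords_vec A \<tau> X) (cmap \<tau> p) a a)"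

definition lie_fun ::
    "('a, 'n::finite) chart set \<Rightarrow> ('a \<Rightarrow> real^'n) \<Rightarrow> ('a \<Rightarrow> real) \<Rightarrow> 'a \<Rightarrow> real" where
  "lie_fun A X f p =
     (let \<tau> = chart_at A p; x = cmap \<tau> p
      in \<Sum>k\<in>UNIV. coords_vec A \<tau> X x $ k * pd k (f \<circ> cinv \<tau>) x)"

text \<open>\<open>(\<L>\<^sub>X h)\<^sub>i\<^sub>j = X\<^sup>k \<partial>\<^sub>k h\<^sub>i\<^sub>j + h\<^sub>k\<^sub>j \<partial>\<^sub>i X\<^sup>k + h\<^sub>i\<^sub>k \<partial>\<^sub>j X\<^sup>k\<close>\<close>

definition lie_ten ::
    "('a, 'n::finite) chart set \<Rightarrow> ('a \<Rightarrow> real^'n) \<Rightarrow> ('a \<Rightarrow> real^'n^'n) \<Rightarrow> 'a \<Rightarrow> real^'n^'n" where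
  "lie_ten A X h p =
     (let \<tau> = chart_at A p; x = cmap \<tau> p; H = coords_ten A \<tau> h; Y = coords_vec A \<tau> X
      in \<chi> i j. \<Sum>k\<in>UNIV. Y x $ k * pd k H x $ i $ j
                 + H x $ k $ j * pd i Y x $ k + H x $ i $ k * pd j Y x $ k)"

definition conformal_vector_field ::
    "('a, 'n::finite) chart set \<Rightarrow> ('a \<Rightarrow> real^'n^'n) \<Rightarrow> ('a \<Rightarrow> real^'n) \<Rightarrow> bool" where
  "conformal_vector_field A g X \<longleftrightarrow> vector_field A X \<and>
     (\<forall>p. lie_ten A X g p = (2 / real CARD('n) * divergence A g X p) *\<^sub>R g p)"

text \<open>The Riemannian measure is the unique Borel measure that has density \<open>sqrt (det g\<^sub>i\<^sub>j)\<close> with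
  respect to Lebesgue measure in every chart.\<close>

definition riemannian_measure ::
    "('a::topological_space, 'n::finite) chart set \<Rightarrow> ('a \<Rightarrow> real^'n^'n) \<Rightarrow> 'a measure" where
  "riemannian_measure A g = (THE \<mu>. sets \<mu> = sets borel \<and>
     (\<forall>\<kappa>\<in>A. \<forall>B\<in>sets borel. B \<subseteq> cdom \<kappa> \<longrightarrow>
        emeasure \<mu> B =
          (\<integral>\<^sup>+x\<in>cmap \<kappa> ` B. ennreal (sqrt (det (coords_ten A \<kappa> g x))) \<partial>lborel)))"

text \<open>\<open>(h,B) = g\<^sup>i\<^sup>k g\<^sup>j\<^sup>l h\<^sub>i\<^sub>j B\<^sub>k\<^sub>l\<close>\<close>

definition pairing ::
    "('a \<Rightarrow> real^'n^'n) \<Rightarrow> ('a \<Rightarrow> real^'n^'n) \<Rightarrow> ('a \<Rightarrow> real^'n^'n) \<Rightarrow> 'a \<Rightarrow> real" where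
  "pairing g h B p =
     (\<Sum>i\<in>UNIV. \<Sum>j\<in>UNIV. \<Sum>k\<in>UNIV. \<Sum>l\<in>UNIV.
        matrix_inv (g p) $ i $ k * matrix_inv (g p) $ j $ l * h p $ i $ j * B p $ k $ l)"


section \<open>Natural scalar invariants\<close>

datatype 'n jet_var =
    Metric_Jet "'n list" 'n 'n
  | Inverse_Jet "'n list" 'n 'n

datatype 'n jet_poly =
    Const real
  | Var "'n jet_var"
  | Plus "'n jet_poly" "'n jet_poly"
  | Times "'n jet_poly" "'n jet_poly"

text \<open>Here \<open>G\<close> are the components \<open>g\<^sub>i\<^sub>j\<close> of a metric in some chart: \<open>Metric_Jet \<alpha> i j\<close> stands for
  \<open>\<partial>\<^sup>\<alpha> g\<^sub>i\<^sub>j\<close> and \<open>Inverse_Jet \<alpha> i j\<close> for \<open>\<partial>\<^sup>\<alpha> g\<^sup>i\<^sup>j\<close>. An expression has finitely many variables,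
  hence involves a jet of finite order only.\<close>

fun jet_value :: "(real^'n \<Rightarrow> real^'n^'n) \<Rightarrow> real^'n \<Rightarrow> 'n::finite jet_var \<Rightarrow> real" where
  "jet_value G x (Metric_Jet \<alpha> i j) = pds \<alpha> G x $ i $ j"
| "jet_value G x (Inverse_Jet \<alpha> i j) = pds \<alpha> (\<lambda>y. matrix_inv (G y)) x $ i $ j"

fun jet_eval :: "('n jet_var \<Rightarrow> real) \<Rightarrow> 'n jet_poly \<Rightarrow> real" where
  "jet_eval \<rho> (Const c) = c"
| "jet_eval \<rho> (Var v) = \<rho> v"
| "jet_eval \<rho> (Plus e f) = jet_eval \<rho> e + jet_eval \<rho> f"
| "jet_eval \<rho> (Times e f) = jet_eval \<rho> e * jet_eval \<rho> f"

definition natural_scalar_invariant ::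
    "('a::topological_space, 'n::finite) chart set \<Rightarrow>
     (('a \<Rightarrow> real^'n^'n) \<Rightarrow> 'a \<Rightarrow> real) \<Rightarrow> bool" where
  "natural_scalar_invariant A V \<longleftrightarrow>
     (\<exists>e. \<forall>g. riemannian_metric A g \<longrightarrow> (\<forall>\<kappa>\<in>A. \<forall>p\<in>cdom \<kappa>.
        V g p = jet_eval (jet_value (coords_ten A \<kappa> g) (cmap \<kappa> p)) e)) \<and>
     (\<forall>g \<phi>. riemannian_metric A g \<and> diffeo A \<phi> \<longrightarrow> V g \<circ> \<phi> = V (pullback A \<phi> g))"


section \<open>Riemannian functionals\<close>

text \<open>Functionals are functions of arbitrary 2-tensor fields; only their values at Riemannian
  metrics matter.\<close>

definition riemannian_functional ::
    "('a::topological_space, 'n::finite) chart set \<Rightarrow> (('a \<Rightarrow> real^'n^'n) \<Rightarrow> real) \<Rightarrow> bool" where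
  "riemannian_functional A S \<longleftrightarrow>
     (\<forall>g \<phi>. riemannian_metric A g \<and> diffeo A \<phi> \<longrightarrow> S (pullback A \<phi> g) = S g)"

text \<open>Convergence of sequences in the \<open>C\<^sup>\<infinity>\<close> topology: locally uniform convergence of all partial
  derivatives of the components. On a compact manifold that topology is metrizable.\<close>

definition Cinf_tendsto ::
    "('a, 'n::finite) chart set \<Rightarrow> (nat \<Rightarrow> 'a \<Rightarrow> real^'n^'n) \<Rightarrow> ('a \<Rightarrow> real^'n^'n) \<Rightarrow> bool" where
  "Cinf_tendsto A H h \<longleftrightarrow>
     (\<forall>\<kappa>\<in>A. \<forall>K \<alpha>. compact K \<and> K \<subseteq> cimg \<kappa> \<longrightarrow>
        uniform_limit K (\<lambda>m. pds \<alpha> (coords_ten A \<kappa> (H m))) (pds \<alpha> (coords_ten A \<kappa> h)) sequentially)"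

text \<open>\<open>D\<close> is the derivative \<open>S'(g)\<close> on the space of metrics, an open subset of the Frechet space of
  symmetric 2-tensor fields. Differentiability is meant with respect to the \<open>C\<^sup>\<infinity>\<close> topology and in
  the Hadamard sense: the difference quotients converge also when the direction converges
  along with the step. In a Frechet space this is what the chain rule along curves requires, and
  continuously differentiable functions (in the sense of Michal, Bastiani and Hamilton) satisfy it.
  For large \<open>m\<close> the argument of \<open>S\<close> below is a metric, as the manifold is compact.\<close>

definition has_functional_derivative ::
    "('a, 'n::finite) chart set \<Rightarrow> (('a \<Rightarrow> real^'n^'n) \<Rightarrow> real) \<Rightarrow> ('a \<Rightarrow> real^'n^'n) \<Rightarrow>
     (('a \<Rightarrow> real^'n^'n) \<Rightarrow> real) \<Rightarrow> bool" where
  "has_functional_derivative A S g D \<longleftrightarrow>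
     (\<forall>h k a b. sym_tensor A h \<and> sym_tensor A k \<longrightarrow>
        D (\<lambda>p. a *\<^sub>R h p + b *\<^sub>R k p) = a * D h + b * D k) \<and>
     (\<forall>H h. (\<forall>m. sym_tensor A (H m)) \<and> sym_tensor A h \<and> Cinf_tendsto A H h \<longrightarrow>
        (\<lambda>m. D (H m)) \<longlonglongrightarrow> D h) \<and>
     (\<forall>H h t. (\<forall>m. sym_tensor A (H m)) \<and> sym_tensor A h \<and> Cinf_tendsto A H h \<and>
        t \<longlonglongrightarrow> 0 \<and> (\<forall>m. t m \<noteq> 0) \<longrightarrow>
        (\<lambda>m. (S (\<lambda>p. g p + t m *\<^sub>R H m p) - S g) / t m) \<longlonglongrightarrow> D h)"

definition differentiable_functional ::
    "('a, 'n::finite) chart set \<Rightarrow> (('a \<Rightarrow> real^'n^'n) \<Rightarrow> real) \<Rightarrow> bool" where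
  "differentiable_functional A S \<longleftrightarrow>
     (\<forall>g. riemannian_metric A g \<longrightarrow> (\<exists>D. has_functional_derivative A S g D))"

definition has_gradient ::
    "('a::topological_space, 'n::finite) chart set \<Rightarrow> (('a \<Rightarrow> real^'n^'n) \<Rightarrow> real) \<Rightarrow>
     ('a \<Rightarrow> real^'n^'n) \<Rightarrow> ('a \<Rightarrow> real^'n^'n) \<Rightarrow> bool" where
  "has_gradient A S g B \<longleftrightarrow> sym_tensor A B \<and>
     has_functional_derivative A S g (\<lambda>h. \<integral>p. pairing g h B p \<partial>riemannian_measure A g)"


section \<open>Conformally variational invariants\<close>

definition conformal_class ::
    "('a, 'n::finite) chart set \<Rightarrow> ('a \<Rightarrow> real^'n^'n) set \<Rightarrow> bool" where
  "conformal_class A C \<longleftrightarrow> (\<exists>g. riemannian_metric A g \<and>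
     C = {\<lambda>p. exp (2 * \<Upsilon> p) *\<^sub>R g p | \<Upsilon>. smooth_fun A \<Upsilon>})"

definition functional_for ::
    "('a::topological_space, 'n::finite) chart set \<Rightarrow> ('a \<Rightarrow> real^'n^'n) set \<Rightarrow>
     (('a \<Rightarrow> real^'n^'n) \<Rightarrow> 'a \<Rightarrow> real) \<Rightarrow> (('a \<Rightarrow> real^'n^'n) \<Rightarrow> real) \<Rightarrow> bool" where
  "functional_for A C V S \<longleftrightarrow>
     (\<forall>g\<in>C. \<forall>\<omega>. smooth_fun A \<omega> \<longrightarrow>
        ((\<lambda>s. S (\<lambda>p. exp (2 * s * \<omega> p) *\<^sub>R g p)) has_real_derivative
           2 * (\<integral>p. \<omega> p * V g p \<partial>riemannian_measure A g)) (at 0))"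

definition naturally_conformally_variational ::
    "('a::topological_space, 'n::finite) chart set \<Rightarrow> ('a \<Rightarrow> real^'n^'n) set \<Rightarrow>
     (('a \<Rightarrow> real^'n^'n) \<Rightarrow> 'a \<Rightarrow> real) \<Rightarrow> bool" where
  "naturally_conformally_variational A C V \<longleftrightarrow>
     (\<exists>S. riemannian_functional A S \<and> differentiable_functional A S \<and>
          (\<forall>g\<in>C. \<exists>B. has_gradient A S g B) \<and> functional_for A C V S)"

end

theory Submission
  imports Defs
begin

text \<open>
  The first equation is the infinitesimal form of the invariance of \<open>S\<close> under diffeomorphisms. Let \<open>D\<close>
  be the derivative of \<open>S\<close> at \<open>g\<close>. Moving \<open>g\<close> by diffeomorphisms with velocity \<open>X\<close> does not change
  the value of \<open>S\<close>, so \<open>D (\<L>\<^sub>X g) = 0\<close> for every vector field \<open>X\<close> (\<open>lie_derivative_in_kernel\<close>). If \<open>X\<close> is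
  conformal, then \<open>\<L>\<^sub>X g = 2 \<omega> g\<close> with \<open>\<omega> = div X / n\<close>, and \<open>2 \<omega> g\<close> is also the velocity at \<open>s = 0\<close> of the
  curve \<open>exp (2 s \<omega>) g\<close> in the conformal class. Along that curve the derivative of \<open>S\<close> is
  \<open>2 \<integral> \<omega> V\<close> because \<open>S\<close> is a functional for \<open>V\<close>. Hence \<open>\<integral> (div X) V = 0\<close>
  (\<open>integral_divergence_times_invariant\<close>).

  Flows of vector fields are avoided. As \<open>D\<close> is linear, a partition of unity reduces \<open>D (\<L>\<^sub>X g) = 0\<close>
  to a field supported in one chart, with components \<open>Y\<close> there. The maps \<open>x \<mapsto> x + t Y(x)\<close> are
  diffeomorphisms for small \<open>t\<close> (\<open>near_identity_diffeomorphism\<close>) and have velocity \<open>X\<close> at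
  \<open>t = 0\<close>. This is all that is used, since a Hadamard derivative obeys the chain rule
  along every curve of metrics that is jointly smooth in the parameter and the point
  (\<open>functional_derivative_along_curve\<close>). That lemma rests on the fact that the difference quotients
  of such a curve converge with all derivatives (\<open>uniform_limit_difference_quotient\<close>).

  The second equation is the divergence theorem for the field \<open>V X\<close>, as
  \<open>div (V X) = (div X) V + \<L>\<^sub>X V\<close> (\<open>divergence_scaled\<close>, \<open>divergence_theorem\<close>). A partition of unity
  again reduces it to one chart, where \<open>sqrt (det g) (div X) = \<Sum>\<^sub>a \<partial>\<^sub>a (sqrt (det g) X\<^sup>a)\<close> by Jacobi's
  formula (\<open>sqrt_det_divergence\<close>), and integrals of partial derivatives with compact support vanish
  (\<open>integral_pd_compact_support\<close>). The Riemannian measure is a definite description; it denotes the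
  expected measure because the chart densities agree on overlaps by the change of variables
  formula (\<open>riemannian_measure_unique_existence\<close>).

  Divergence and Lie derivative at \<open>p\<close> are computed in a chart that depends discontinuously
  on \<open>p\<close>. Their smoothness therefore requires the proof that they do not depend on the chart: for the
  Lie derivative this is \<open>lie_mat_change\<close>, and the divergence is half the trace of \<open>\<L>\<^sub>X g\<close> with respect to
  \<open>g\<close> (\<open>sum_cov_deriv\<close>).
\<close>

section \<open>Calculus of smooth functions\<close>

lemma Ck_on_cong:
  assumes "open U" "Ck_on k U f" "\<And>x. x \<in> U \<Longrightarrow> f x = g x"
  shows "Ck_on k U g"
  using assms(2,3)
proof (induction k arbitrary: f g)
  case 0
  then show ?case by (simp cong: continuous_on_cong)
next
  case (Suc k)
  have d: "(g has_derivative frechet_derivative f (at x)) (at x)" if "x \<in> U" for x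
    using has_derivative_transform_within_open[where f = f and g = g and t = UNIV, OF _ \<open>open U\<close> that Suc.prems(2)]
      Suc.prems(1) that frechet_derivative_works by auto
  have g: "g differentiable (at x)" "frechet_derivative f (at x) = frechet_derivative g (at x)" if "x \<in> U" for x
    using d[OF that] frechet_derivative_at differentiableI by blast+
  have "Ck_on k U (\<lambda>x. frechet_derivative g (at x) v)" for v
    by (rule Suc.IH[of "\<lambda>x. frechet_derivative f (at x) v"]) (use Suc.prems(1) g(2) in simp_all)
  with g(1) show ?case by simp
qed

lemma Ck_on_subset: "Ck_on k U f \<Longrightarrow> V \<subseteq> U \<Longrightarrow> Ck_on k V f"
  by (induction k arbitrary: f) (auto intro: continuous_on_subset)

lemma Ck_on_Suc_D: "Ck_on (Suc k) U f \<Longrightarrow> Ck_on k U f"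
proof (induction k arbitrary: f)
  case 0
  then show ?case
    by (auto intro!: continuous_at_imp_continuous_on differentiable_imp_continuous_within)
qed auto

lemma Ck_on_has_derivative:
  "Ck_on (Suc k) U f \<Longrightarrow> x \<in> U \<Longrightarrow> (f has_derivative frechet_derivative f (at x)) (at x)"
  by (simp add: frechet_derivative_works)

lemma Ck_on_SucI:
  assumes "\<And>x. x \<in> U \<Longrightarrow> (f has_derivative f' x) (at x)"
    and "\<And>v. Ck_on k U (\<lambda>x. f' x v)" "open U"
  shows "Ck_on (Suc k) U f"
  using assms(1) Ck_on_cong[OF assms(3,2)] frechet_derivative_at[OF assms(1)]
  by (auto simp: differentiable_def)

lemma Ck_on_local:
  assumes "\<And>x. x \<in> U \<Longrightarrow> \<exists>V. open V \<and> x \<in> V \<and> Ck_on k V f"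
  shows "Ck_on k U f"
  using assms
proof (induction k arbitrary: f)
  case 0
  then show ?case
    by (auto intro!: continuous_at_imp_continuous_on simp: continuous_on_eq_continuous_at) 
       (metis continuous_on_eq_continuous_at)
next
  case (Suc k)
  have "f differentiable (at x)" if "x \<in> U" for x using Suc.prems[OF that] by auto
  moreover have "Ck_on k U (\<lambda>x. frechet_derivative f (at x) v)" for v
    by (rule Suc.IH) (use Suc.prems in fastforce)
  ultimately show ?case by simp
qed

lemma Ck_on_const [simp]: "Ck_on k U (\<lambda>x. c)"
  by (induction k arbitrary: c) auto

lemma Ck_on_bounded_linear_compose:
  assumes "bounded_linear L" "open U" "Ck_on k U f"
  shows "Ck_on k U (\<lambda>x. L (f x))"
  using assms(3)
proof (induction k arbitrary: f)
  case 0
  then show ?case using bounded_linear.continuous_on[OF assms(1)] by simp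
next
  case (Suc k)
  show ?case
    by (rule Ck_on_SucI[OF bounded_linear.has_derivative[OF assms(1) Ck_on_has_derivative[OF Suc.prems]]])
       (use Suc.prems assms(2) in \<open>auto intro: Suc.IH\<close>)
qed

lemma Ck_on_linear:
  assumes "bounded_linear L" "open U"
  shows "Ck_on k U L"
proof (cases k)
  case 0
  then show ?thesis using bounded_linear.continuous_on[OF assms(1) continuous_on_id] by simp
next
  case (Suc m)
  show ?thesis unfolding Suc
    by (rule Ck_on_SucI[OF bounded_linear_imp_has_derivative[OF assms(1)]]) (use assms in auto)
qed

lemma Ck_on_add:
  assumes "open U" "Ck_on k U f" "Ck_on k U g"
  shows "Ck_on k U (\<lambda>x. f x + g x)"
  using assms(2,3)
proof (induction k arbitrary: f g)
  case 0
  then show ?case by (simp add: continuous_on_add)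
next
  case (Suc k)
  show ?case
    by (rule Ck_on_SucI[OF has_derivative_add[OF Ck_on_has_derivative[OF Suc.prems(1)]
          Ck_on_has_derivative[OF Suc.prems(2)]]])
       (use Suc.prems assms(1) in \<open>auto intro: Suc.IH\<close>)
qed

lemma Ck_on_bounded_bilinear:
  assumes "bounded_bilinear B" "open U" "Ck_on k U f" "Ck_on k U g"
  shows "Ck_on k U (\<lambda>x. B (f x) (g x))"
  using assms(3,4)
proof (induction k arbitrary: f g)
  case 0
  then show ?case using bounded_bilinear.continuous_on[OF assms(1)] by simp
next
  case (Suc k)
  show ?case
    by (rule Ck_on_SucI[OF bounded_bilinear.FDERIV[OF assms(1) Ck_on_has_derivative[OF Suc.prems(1)]
          Ck_on_has_derivative[OF Suc.prems(2)]]])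
       (use Suc.prems assms(2) Ck_on_Suc_D[OF Suc.prems(1)] Ck_on_Suc_D[OF Suc.prems(2)]
         in \<open>auto intro!: Ck_on_add Suc.IH\<close>)
qed

lemma Ck_on_sum:
  assumes "open U" "\<And>i. i \<in> I \<Longrightarrow> Ck_on k U (f i)"
  shows "Ck_on k U (\<lambda>x. \<Sum>i\<in>I. f i x)"
  using assms(2) by (induction I rule: infinite_finite_induct) (auto intro!: Ck_on_add assms(1))

text \<open>In the derivative of the composition the direction \<open>D g x v\<close> moves with \<open>x\<close>, whereas
  \<open>Ck_on\<close> speaks of derivatives in fixed directions. Expanding the moving direction in a basis turns
  the chain rule into a finite sum to which the induction hypothesis applies.\<close>

lemma Ck_on_compose:
  fixes f :: "'c::euclidean_space \<Rightarrow> 'd::real_normed_vector"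
  assumes "open U" "open V" "Ck_on k V f" "Ck_on k U g" "\<And>x. x \<in> U \<Longrightarrow> g x \<in> V"
  shows "Ck_on k U (\<lambda>x. f (g x))"
  using assms(3,4)
proof (induction k arbitrary: f)
  case 0
  then show ?case using assms(5) by (auto intro: continuous_on_compose2)
next
  case (Suc k)
  \<comment> \<open>Only the coefficients depend on the direction \<open>w\<close>.\<close>
  have lin: "frechet_derivative f (at y) w =
      (\<Sum>b\<in>Basis. (w \<bullet> b) *\<^sub>R frechet_derivative f (at y) b)" if "y \<in> V" for y w
  proof -
    have l: "linear (frechet_derivative f (at y))"
      using Suc.prems(1) that by (simp add: linear_frechet_derivative)
    show ?thesis
      by (subst euclidean_representation[of w, symmetric])
        (simp only: linear_sum[OF l] linear_cmul[OF l])
  qed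
  show ?case
  proof (rule Ck_on_SucI)
    show "((\<lambda>x. f (g x)) has_derivative
       (\<lambda>v. \<Sum>b\<in>Basis. (frechet_derivative g (at x) v \<bullet> b) *\<^sub>R frechet_derivative f (at (g x)) b)) (at x)"
      if "x \<in> U" for x
      unfolding lin[OF assms(5)[OF that], symmetric]
      by (rule has_derivative_compose[OF Ck_on_has_derivative[OF Suc.prems(2) that]
          Ck_on_has_derivative[OF Suc.prems(1) assms(5)[OF that]]])
    show "Ck_on k U (\<lambda>x. \<Sum>b\<in>Basis. (frechet_derivative g (at x) v \<bullet> b) *\<^sub>R frechet_derivative f (at (g x)) b)" for v
      using Suc.prems Suc.IH Ck_on_Suc_D[OF Suc.prems(2)]
      by (intro Ck_on_sum Ck_on_bounded_bilinear[OF bounded_bilinear_scaleR] Ck_on_bounded_linear_compose[OF bounded_linear_inner_left] assms) auto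
  qed (fact assms)
qed

subsection \<open>Closure properties of smooth functions\<close>

lemma smooth_on_cong:
  "open U \<Longrightarrow> smooth_on U f \<Longrightarrow> (\<And>x. x \<in> U \<Longrightarrow> f x = g x) \<Longrightarrow> smooth_on U g"
  unfolding smooth_on_def using Ck_on_cong by blast

lemma smooth_on_subset: "smooth_on U f \<Longrightarrow> V \<subseteq> U \<Longrightarrow> smooth_on V f"
  unfolding smooth_on_def using Ck_on_subset by blast

lemma smooth_on_local:
  assumes "\<And>x. x \<in> U \<Longrightarrow> \<exists>V. open V \<and> x \<in> V \<and> smooth_on V f"
  shows "smooth_on U f"
  unfolding smooth_on_def by (intro allI Ck_on_local) (use assms smooth_on_def in metis)

lemma smooth_on_Un:
  "open U \<Longrightarrow> open V \<Longrightarrow> smooth_on U f \<Longrightarrow> smooth_on V f \<Longrightarrow> smooth_on (U \<union> V) f"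
  by (rule smooth_on_local) blast

lemma smooth_on_const [simp]: "smooth_on U (\<lambda>x. c)"
  by (simp add: smooth_on_def)

lemma smooth_on_extend_by_zero:
  assumes U: "open U" and f: "smooth_on U f" and K: "compact K" "K \<subseteq> U"
    and zero: "\<And>x. x \<in> U \<Longrightarrow> x \<notin> K \<Longrightarrow> f x = 0"
  shows "smooth_on UNIV (\<lambda>x. if x \<in> U then f x else 0)"
proof -
  have cK: "open (- K)" using K(1) by (simp add: compact_imp_closed open_Compl)
  have 1: "smooth_on U (\<lambda>x. if x \<in> U then f x else 0)"
    by (rule smooth_on_cong[OF U f]) simp
  have 2: "smooth_on (- K) (\<lambda>x. if x \<in> U then f x else 0)"
    by (rule smooth_on_cong[OF cK smooth_on_const[of _ 0]]) (simp add: zero)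
  have "U \<union> - K = UNIV" using K(2) by blast
  then show ?thesis using smooth_on_Un[OF U cK 1 2] by simp
qed

lemma smooth_on_imp_continuous_on: "smooth_on U f \<Longrightarrow> continuous_on U f"
  unfolding smooth_on_def by (metis Ck_on.simps(1))

lemma smooth_on_has_derivative:
  "smooth_on U f \<Longrightarrow> x \<in> U \<Longrightarrow> (f has_derivative frechet_derivative f (at x)) (at x)"
  unfolding smooth_on_def using Ck_on_has_derivative by blast

lemma smooth_on_differentiable: "smooth_on U f \<Longrightarrow> x \<in> U \<Longrightarrow> f differentiable at x"
  using smooth_on_has_derivative differentiableI by blast

lemma smooth_on_frechet_derivative:
  "smooth_on U f \<Longrightarrow> smooth_on U (\<lambda>x. frechet_derivative f (at x) v)"
  unfolding smooth_on_def by (metis Ck_on.simps(2))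

lemma smooth_on_linear: "bounded_linear L \<Longrightarrow> open U \<Longrightarrow> smooth_on U L"
  by (simp add: smooth_on_def Ck_on_linear)

lemma smooth_on_ident: "open U \<Longrightarrow> smooth_on U (\<lambda>x. x)"
  by (simp add: smooth_on_linear)

lemma smooth_on_bounded_linear_compose:
  "bounded_linear L \<Longrightarrow> open U \<Longrightarrow> smooth_on U f \<Longrightarrow> smooth_on U (\<lambda>x. L (f x))"
  by (simp add: smooth_on_def Ck_on_bounded_linear_compose)

lemma smooth_on_add:
  "open U \<Longrightarrow> smooth_on U f \<Longrightarrow> smooth_on U g \<Longrightarrow> smooth_on U (\<lambda>x. f x + g x)"
  by (simp add: smooth_on_def Ck_on_add)

lemma smooth_on_bounded_bilinear:
  "bounded_bilinear B \<Longrightarrow> open U \<Longrightarrow> smooth_on U f \<Longrightarrow> smooth_on U g \<Longrightarrow> smooth_on U (\<lambda>x. B (f x) (g x))"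
  by (simp add: smooth_on_def Ck_on_bounded_bilinear)

lemmas smooth_on_scaleR = smooth_on_bounded_bilinear[OF bounded_bilinear_scaleR]
lemmas smooth_on_mult = smooth_on_bounded_bilinear[OF bounded_bilinear_mult]
lemmas smooth_on_nth = smooth_on_bounded_linear_compose[OF bounded_linear_vec_nth]
lemmas smooth_on_minus = smooth_on_bounded_linear_compose[OF bounded_linear_minus[OF bounded_linear_ident]]
lemmas smooth_on_inner = smooth_on_bounded_bilinear[OF bounded_bilinear_inner]

lemma smooth_on_diff:
  "open U \<Longrightarrow> smooth_on U f \<Longrightarrow> smooth_on U g \<Longrightarrow> smooth_on U (\<lambda>x. f x - g x)"
  using smooth_on_add[of U f "\<lambda>x. - g x"] smooth_on_minus[of U g] by simp

lemma smooth_on_sum: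
  "open U \<Longrightarrow> (\<And>i. i \<in> I \<Longrightarrow> smooth_on U (f i)) \<Longrightarrow> smooth_on U (\<lambda>x. \<Sum>i\<in>I. f i x)"
  by (simp add: smooth_on_def Ck_on_sum)

lemma smooth_on_prod:
  fixes f :: "_ \<Rightarrow> _ \<Rightarrow> real"
  assumes "open U" "\<And>i. i \<in> I \<Longrightarrow> smooth_on U (f i)"
  shows "smooth_on U (\<lambda>x. \<Prod>i\<in>I. f i x)"
  using assms(2) by (induction I rule: infinite_finite_induct) (auto intro!: smooth_on_mult assms(1))

lemma smooth_on_compose:
  fixes f :: "'c::euclidean_space \<Rightarrow> 'd::real_normed_vector"
  assumes "open U" "open V" "smooth_on V f" "smooth_on U g" "\<And>x. x \<in> U \<Longrightarrow> g x \<in> V"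
  shows "smooth_on U (\<lambda>x. f (g x))"
  using assms unfolding smooth_on_def by (metis Ck_on_compose)

lemma smooth_on_Pair:
  "open U \<Longrightarrow> smooth_on U f \<Longrightarrow> smooth_on U g \<Longrightarrow> smooth_on U (\<lambda>x. (f x, g x))"
  using smooth_on_add[of U "\<lambda>x. (f x, 0)" "\<lambda>x. (0, g x)"]
    smooth_on_bounded_linear_compose[OF bounded_linear_Pair[OF bounded_linear_ident bounded_linear_zero], of U f]
    smooth_on_bounded_linear_compose[OF bounded_linear_Pair[OF bounded_linear_zero bounded_linear_ident], of U g]
  by simp

lemma Ck_on_vec_lambda:
  fixes f :: "'a::real_normed_vector \<Rightarrow> 'b::euclidean_space ^ 'n::finite"
  assumes "open U" "\<And>i. Ck_on k U (\<lambda>x. f x $ i)"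
  shows "Ck_on k U f"
proof -
  have "bounded_linear (axis i :: 'b \<Rightarrow> 'b ^ 'n)" for i :: 'n
    by (intro linear_conv_bounded_linear[THEN iffD1] linearI) (auto simp: vec_eq_iff axis_def)
  then have "Ck_on k U (\<lambda>x. axis i (f x $ i))" for i
    using Ck_on_bounded_linear_compose[where L = "axis i" and f = "\<lambda>x. f x $ i", OF _ assms] by simp
  then have "Ck_on k U (\<lambda>x. \<Sum>i\<in>UNIV. axis i (f x $ i))"
    by (rule Ck_on_sum[OF assms(1)])
  moreover have "(\<Sum>i\<in>UNIV. axis i (f x $ i)) = f x" for x
    by (simp add: vec_eq_iff axis_def sum_component)
  ultimately show ?thesis by simp
qed

lemma smooth_on_vec:
  fixes f :: "'a::real_normed_vector \<Rightarrow> 'b::euclidean_space ^ 'n::finite"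
  shows "open U \<Longrightarrow> (\<And>i. smooth_on U (\<lambda>x. f x $ i)) \<Longrightarrow> smooth_on U f"
  unfolding smooth_on_def using Ck_on_vec_lambda by metis

lemma smooth_on_mat:
  fixes f :: "'a::real_normed_vector \<Rightarrow> real ^ 'm::finite ^ 'n::finite"
  shows "open U \<Longrightarrow> (\<And>i j. smooth_on U (\<lambda>x. f x $ i $ j)) \<Longrightarrow> smooth_on U f"
  by (intro smooth_on_vec) auto

lemma smooth_on_entry:
  fixes f :: "'a::real_normed_vector \<Rightarrow> real ^ 'm::finite ^ 'n::finite"
  shows "open U \<Longrightarrow> smooth_on U f \<Longrightarrow> smooth_on U (\<lambda>x. f x $ i $ j)"
  by (intro smooth_on_nth)

subsection \<open>Elementary functions and matrices\<close>

lemma smooth_on_exp: "smooth_on UNIV (exp :: real \<Rightarrow> real)"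
proof -
  have "Ck_on k UNIV (exp :: real \<Rightarrow> real)" for k
  proof (induction k)
    case (Suc k)
    show ?case
      by (rule Ck_on_SucI[where f' = "\<lambda>x v. exp x * v"])
        (auto intro!: derivative_eq_intros Ck_on_bounded_bilinear[OF bounded_bilinear_mult] Suc)
  qed (auto intro: continuous_intros)
  then show ?thesis by (simp add: smooth_on_def)
qed

lemma smooth_on_inverse: "smooth_on (- {0}) (inverse :: real \<Rightarrow> real)"
proof -
  have "Ck_on k (-{0}) (inverse :: real \<Rightarrow> real)" for k
  proof (induction k)
    case (Suc k)
    show ?case
      by (rule Ck_on_SucI[where f' = "\<lambda>x v. (inverse x * v) * (- inverse x)"])
        (auto intro!: derivative_eq_intros Ck_on_bounded_bilinear[OF bounded_bilinear_mult]
           Ck_on_bounded_linear_compose[OF bounded_linear_minus[OF bounded_linear_ident]] Suc)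
  qed (auto intro: continuous_intros)
  then show ?thesis by (simp add: smooth_on_def)
qed

lemma smooth_on_sqrt: "smooth_on {0<..} sqrt"
proof -
  have "Ck_on k {0<..} sqrt" for k
  proof (induction k)
    case (Suc k)
    have "Ck_on k {0<..} (\<lambda>x. inverse (sqrt x))"
      using smooth_on_inverse by (intro Ck_on_compose[OF _ _ _ Suc, of "-{0}"]) (auto simp: smooth_on_def)
    then have "Ck_on k {0<..} (\<lambda>x. inverse (sqrt x) * (v / 2))" for v :: real
      by (rule Ck_on_bounded_bilinear[OF bounded_bilinear_mult open_greaterThan _ Ck_on_const])
    moreover have "(sqrt has_derivative (\<lambda>v. inverse (sqrt x) * (v / 2))) (at x)" if "x \<in> {0<..}" for x
    proof -
      have "(*) (inverse (sqrt x) / 2) = (\<lambda>v. inverse (sqrt x) * (v / 2))" by auto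
      then show ?thesis
        using DERIV_real_sqrt[of x] that by (simp add: has_field_derivative_def)
    qed
    ultimately show ?case
      by (intro Ck_on_SucI[OF _ _ open_greaterThan]) assumption+
  qed (auto intro: continuous_intros)
  then show ?thesis by (simp add: smooth_on_def)
qed

lemma smooth_on_divide:
  fixes f g :: "'a::real_normed_vector \<Rightarrow> real"
  assumes "open U" "smooth_on U f" "smooth_on U g" "\<And>x. x \<in> U \<Longrightarrow> g x \<noteq> 0"
  shows "smooth_on U (\<lambda>x. f x / g x)"
  unfolding divide_inverse
  by (rule smooth_on_mult[OF assms(1,2) smooth_on_compose[OF assms(1) _ smooth_on_inverse assms(3)]])
    (use assms(4) in auto)

lemma smooth_on_jet_eval:
  assumes "open U" "\<And>v. smooth_on U (\<lambda>x. \<rho> x v)"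
  shows "smooth_on U (\<lambda>x. jet_eval (\<rho> x) e)"
  by (induction e) (use assms in \<open>auto intro!: smooth_on_add smooth_on_mult\<close>)

lemma smooth_on_matrix_mult:
  fixes P :: "'a::real_normed_vector \<Rightarrow> real ^ 'm::finite ^ 'k::finite" and Q :: "'a \<Rightarrow> real ^ 'n::finite ^ 'm"
  assumes "open U" "smooth_on U P" "smooth_on U Q"
  shows "smooth_on U (\<lambda>x. P x ** Q x)"
  unfolding matrix_matrix_mult_def
  by (rule smooth_on_mat[OF assms(1)], simp)
    (intro smooth_on_sum smooth_on_mult smooth_on_entry assms)

lemma smooth_on_matrix_vector_mult:
  fixes P :: "'a::real_normed_vector \<Rightarrow> real ^ 'm::finite ^ 'k::finite"
  assumes "open U" "smooth_on U P" "smooth_on U Q"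
  shows "smooth_on U (\<lambda>x. P x *v Q x)"
  unfolding matrix_vector_mult_def
  by (rule smooth_on_vec[OF assms(1)], simp)
    (intro smooth_on_sum smooth_on_mult smooth_on_entry smooth_on_nth[OF assms(1,3)] assms)

lemma smooth_on_transpose:
  fixes P :: "'a::real_normed_vector \<Rightarrow> real ^ 'm::finite ^ 'k::finite"
  assumes "open U" "smooth_on U P"
  shows "smooth_on U (\<lambda>x. transpose (P x))"
  unfolding transpose_def
  by (rule smooth_on_mat[OF assms(1)], simp) (rule smooth_on_entry[OF assms])

lemma smooth_on_det:
  fixes P :: "'a::real_normed_vector \<Rightarrow> real ^ 'n::finite ^ 'n"
  assumes "open U" "smooth_on U P"
  shows "smooth_on U (\<lambda>x. det (P x))"
  unfolding det_def
  by (intro smooth_on_sum smooth_on_mult smooth_on_prod smooth_on_entry smooth_on_const assms)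

lemma matrix_inv_mult:
  fixes P :: "real ^ 'n::finite ^ 'n"
  assumes "det P \<noteq> 0"
  shows "P ** matrix_inv P = mat 1" "matrix_inv P ** P = mat 1"
proof -
  have "\<exists>Q. P ** Q = mat 1 \<and> Q ** P = mat 1"
    using assms by (simp add: invertible_det_nz[symmetric] invertible_def)
  then have "P ** matrix_inv P = mat 1 \<and> matrix_inv P ** P = mat 1"
    unfolding matrix_inv_def by (rule someI_ex)
  then show "P ** matrix_inv P = mat 1" "matrix_inv P ** P = mat 1" by simp_all
qed

text \<open>By Cramer's rule the entries of the inverse are quotients of determinants.\<close>

lemma smooth_on_matrix_inv:
  fixes P :: "'a::real_normed_vector \<Rightarrow> real ^ 'n::finite ^ 'n"
  assumes "open U" "smooth_on U P" "\<And>x. x \<in> U \<Longrightarrow> det (P x) \<noteq> 0"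
  shows "smooth_on U (\<lambda>x. matrix_inv (P x))"
proof -
  have eq: "matrix_inv (P x) $ k $ l = det (\<chi> i j. if j = k then axis l 1 $ i else P x $ i $ j) / det (P x)"
    if "x \<in> U" for x k l
  proof -
    have "P x *v (matrix_inv (P x) *v axis l 1) = axis l 1"
      using assms(3)[OF that] by (simp add: matrix_vector_mul_assoc matrix_inv_mult)
    from this[unfolded cramer[OF assms(3)[OF that]]]
    have "(matrix_inv (P x) *v axis l 1) $ k
      = det (\<chi> i j. if j = k then axis l 1 $ i else P x $ i $ j) / det (P x)"
      by (metis (no_types, lifting) vec_lambda_beta)
    then show ?thesis by (simp add: matrix_vector_mult_basis column_def)
  qed
  have "smooth_on U (\<lambda>x. det (\<chi> i j. if j = k then axis l 1 $ i else P x $ i $ j) / det (P x))" for k l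
  proof (rule smooth_on_divide[OF assms(1) smooth_on_det[OF assms(1)] smooth_on_det[OF assms(1,2)] assms(3)])
    show "smooth_on U (\<lambda>x. \<chi> i j. if j = k then axis l 1 $ i else P x $ i $ j)"
    proof (rule smooth_on_mat[OF assms(1)])
      show "smooth_on U (\<lambda>x. (\<chi> i j. if j = k then axis l 1 $ i else P x $ i $ j) $ i $ j)" for i j
        by (cases "j = k") (simp_all add: smooth_on_entry[OF assms(1,2)])
    qed
  qed
  then show ?thesis
    by (intro smooth_on_mat assms(1)) (rule smooth_on_cong[OF assms(1)], auto simp: eq)
qed

lemma smooth_on_pd: "smooth_on U f \<Longrightarrow> smooth_on U (pd i f)"
  unfolding pd_def[abs_def] by (rule smooth_on_frechet_derivative)

lemma smooth_on_pds: "smooth_on U f \<Longrightarrow> smooth_on U (pds is f)"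
  unfolding pds_def by (induction "is") (auto intro: smooth_on_pd)

lemma smooth_on_jacobian:
  fixes f :: "real^'n::finite \<Rightarrow> real^'m::finite"
  assumes "open U" "smooth_on U f"
  shows "smooth_on U (\<lambda>x. jacobian f (at x))"
  unfolding jacobian_def matrix_def
  by (rule smooth_on_mat[OF assms(1)], simp)
    (intro smooth_on_nth smooth_on_frechet_derivative assms)

subsection \<open>Symmetry of second derivatives\<close>

lemma frechet_derivative_eq: "(f has_derivative f') (at x) \<Longrightarrow> frechet_derivative f (at x) v = f' v"
  using frechet_derivative_at[of f f' x] by simp

text \<open>The mean value theorem is applied twice, first in direction \<open>v\<close> to the difference of \<open>f\<close> in
  direction \<open>w\<close>, then in direction \<open>w\<close> to the derivative of \<open>f\<close> along \<open>v\<close>.\<close>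

lemma second_difference:
  fixes f :: "'a::real_normed_vector \<Rightarrow> real"
  assumes f: "Ck_on 2 U f" and h: "0 < h"
    and U: "\<And>a b. 0 \<le> a \<Longrightarrow> a \<le> h \<Longrightarrow> 0 \<le> b \<Longrightarrow> b \<le> h \<Longrightarrow> x + a *\<^sub>R v + b *\<^sub>R w \<in> U"
  shows "\<exists>a b. 0 < a \<and> a < h \<and> 0 < b \<and> b < h \<and>
    f (x + h *\<^sub>R v + h *\<^sub>R w) - f (x + h *\<^sub>R v) - f (x + h *\<^sub>R w) + f x
     = h * h * frechet_derivative (\<lambda>y. frechet_derivative f (at y) v) (at (x + a *\<^sub>R v + b *\<^sub>R w)) w"
proof -
  have line: "((\<lambda>s. F (p + s *\<^sub>R u)) has_real_derivative frechet_derivative F (at (p + s *\<^sub>R u)) u) (at s)"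
    if "F differentiable (at (p + s *\<^sub>R u))" for F :: "'a \<Rightarrow> real" and p u s
  proof -
    have l: "linear (frechet_derivative F (at (p + s *\<^sub>R u)))"
      using that by (rule linear_frechet_derivative)
    have "((\<lambda>s. F (p + s *\<^sub>R u)) has_derivative
        (\<lambda>r. frechet_derivative F (at (p + s *\<^sub>R u)) (r *\<^sub>R u))) (at s)"
    proof (rule has_derivative_compose[of "\<lambda>s. p + s *\<^sub>R u" "\<lambda>r. r *\<^sub>R u" s UNIV])
      show "((\<lambda>s. p + s *\<^sub>R u) has_derivative (\<lambda>r. r *\<^sub>R u)) (at s)"
        by (auto intro!: derivative_eq_intros)
      show "(F has_derivative frechet_derivative F (at (p + s *\<^sub>R u))) (at (p + s *\<^sub>R u))"
        using that by (simp only: frechet_derivative_works)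
    qed
    then show ?thesis
      by (simp add: has_field_derivative_def linear_cmul[OF l] mult_commute_abs)
  qed
  have d1: "f differentiable (at y)" and d2: "(\<lambda>y. frechet_derivative f (at y) v) differentiable (at y)"
    if "y \<in> U" for y
    using f that by (auto simp: numeral_2_eq_2)
  have "\<exists>a. 0 < a \<and> a < h \<and>
     (f ((x + h *\<^sub>R w) + h *\<^sub>R v) - f (x + h *\<^sub>R v)) - (f ((x + h *\<^sub>R w) + 0 *\<^sub>R v) - f (x + 0 *\<^sub>R v))
     = (h - 0) * (frechet_derivative f (at ((x + h *\<^sub>R w) + a *\<^sub>R v)) v - frechet_derivative f (at (x + a *\<^sub>R v)) v)"
  proof (rule MVT2[OF h])
    fix s assume s: "0 \<le> s" "s \<le> h"
    have "(x + h *\<^sub>R w) + s *\<^sub>R v \<in> U" "x + s *\<^sub>R v \<in> U"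
      using U[OF s, of h] U[OF s, of 0] h by (simp_all add: algebra_simps)
    then show "((\<lambda>s. f ((x + h *\<^sub>R w) + s *\<^sub>R v) - f (x + s *\<^sub>R v)) has_real_derivative
       frechet_derivative f (at ((x + h *\<^sub>R w) + s *\<^sub>R v)) v - frechet_derivative f (at (x + s *\<^sub>R v)) v) (at s)"
      by (intro DERIV_diff line d1)
  qed
  then obtain a where a: "0 < a" "a < h" and
    eq1: "f (x + h *\<^sub>R v + h *\<^sub>R w) - f (x + h *\<^sub>R v) - f (x + h *\<^sub>R w) + f x
     = h * (frechet_derivative f (at (x + a *\<^sub>R v + h *\<^sub>R w)) v - frechet_derivative f (at (x + a *\<^sub>R v)) v)"
    by (auto simp: algebra_simps)
  have "\<exists>b. 0 < b \<and> b < h \<and>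
     frechet_derivative f (at (x + a *\<^sub>R v + h *\<^sub>R w)) v - frechet_derivative f (at (x + a *\<^sub>R v + 0 *\<^sub>R w)) v
     = (h - 0) * frechet_derivative (\<lambda>y. frechet_derivative f (at y) v) (at (x + a *\<^sub>R v + b *\<^sub>R w)) w"
    by (rule MVT2[OF h]) (use a U in \<open>auto intro!: line d2\<close>)
  then show ?thesis using a eq1 by auto
qed

text \<open>The second difference is symmetric in \<open>v\<close> and \<open>w\<close>, and divided by the square of the step it
  approximates both mixed derivatives, which are continuous.\<close>

lemma symmetric_second_derivative_real:
  fixes f :: "'a::real_normed_vector \<Rightarrow> real"
  assumes f: "Ck_on 2 U f" and "open U" "x \<in> U"
  shows "frechet_derivative (\<lambda>y. frechet_derivative f (at y) v) (at x) w =
    frechet_derivative (\<lambda>y. frechet_derivative f (at y) w) (at x) v"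
proof -
  define A where "A v w y = frechet_derivative (\<lambda>y. frechet_derivative f (at y) v) (at y) w" for v w y
  have cont: "continuous (at x) (A v w)" for v w
    using f assms(2,3) unfolding A_def by (simp add: numeral_2_eq_2 continuous_on_eq_continuous_at)
  have "\<bar>A v w x - A w v x\<bar> \<le> e" if "e > 0" for e
  proof -
    have half: "e/2 > 0" using that by simp
    have ex: "\<exists>d>0. \<forall>y. dist y x < d \<longrightarrow> \<bar>A v w y - A v w x\<bar> < e/2" for v w
      using cont[of v w] half unfolding continuous_at_eps_delta dist_real_def by blast
    obtain d1 where d1: "d1 > 0" "\<And>y. dist y x < d1 \<Longrightarrow> \<bar>A v w y - A v w x\<bar> < e/2"
      using ex[of v w] by blast
    obtain d2 where d2: "d2 > 0" "\<And>y. dist y x < d2 \<Longrightarrow> \<bar>A w v y - A w v x\<bar> < e/2"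
      using ex[of w v] by blast
    obtain d3 where d3: "d3 > 0" "ball x d3 \<subseteq> U" using assms(2,3) openE by blast
    define d where "d = Min {d1,d2,d3}"
    have d: "d > 0" "d \<le> d1" "d \<le> d2" "d \<le> d3" using d1 d2 d3 by (auto simp: d_def)
    define h where "h = d / (norm v + norm w + 1)"
    have h: "h > 0" using d by (auto simp: h_def intro!: divide_pos_pos add_nonneg_pos)
    have hd: "h * (norm v + norm w) < d"
    proof -
      have "h * (norm v + norm w + 1) = d" 
        using add_nonneg_pos[OF add_nonneg_nonneg[OF norm_ge_zero[of v] norm_ge_zero[of w]] zero_less_one]
        unfolding h_def by simp
      then show ?thesis using h by (simp add: algebra_simps)
    qed
    have near: "dist (x + a *\<^sub>R v + b *\<^sub>R w) x < d" if "0 \<le> a" "a \<le> h" "0 \<le> b" "b \<le> h" for a b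
    proof -
      have "dist (x + a *\<^sub>R v + b *\<^sub>R w) x \<le> norm (a *\<^sub>R v) + norm (b *\<^sub>R w)"
        by (metis add.assoc add_diff_cancel_left' dist_norm norm_triangle_ineq)
      also have "\<dots> \<le> h * norm v + h * norm w"
        using that by (auto intro!: add_mono mult_right_mono)
      finally show ?thesis using hd by (simp add: algebra_simps)
    qed
    have inU: "x + a *\<^sub>R v + b *\<^sub>R w \<in> U" if "0 \<le> a" "a \<le> h" "0 \<le> b" "b \<le> h" for a b
      using near[OF that] d d3 by (auto simp: dist_commute subset_iff)
    obtain a b where ab: "0 < a" "a < h" "0 < b" "b < h" and
      eq1: "f (x + h *\<^sub>R v + h *\<^sub>R w) - f (x + h *\<^sub>R v) - f (x + h *\<^sub>R w) + f x
       = h * h * A v w (x + a *\<^sub>R v + b *\<^sub>R w)"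
      using second_difference[OF f h inU] unfolding A_def by blast
    have inU': "x + a *\<^sub>R w + b *\<^sub>R v \<in> U" if "0 \<le> a" "a \<le> h" "0 \<le> b" "b \<le> h" for a b
      using inU[OF that(3,4,1,2)] by (simp add: algebra_simps)
    obtain a' b' where ab': "0 < a'" "a' < h" "0 < b'" "b' < h" and
      eq2: "f (x + h *\<^sub>R w + h *\<^sub>R v) - f (x + h *\<^sub>R w) - f (x + h *\<^sub>R v) + f x
       = h * h * A w v (x + a' *\<^sub>R w + b' *\<^sub>R v)"
      using second_difference[OF f h inU'] unfolding A_def by blast
    have "h * h * A v w (x + a *\<^sub>R v + b *\<^sub>R w) = h * h * A w v (x + b' *\<^sub>R v + a' *\<^sub>R w)"
      using eq1 eq2 by (simp add: algebra_simps)
    then have "A v w (x + a *\<^sub>R v + b *\<^sub>R w) = A w v (x + b' *\<^sub>R v + a' *\<^sub>R w)"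
      using h by simp
    moreover have "\<bar>A v w (x + a *\<^sub>R v + b *\<^sub>R w) - A v w x\<bar> < e/2"
      using d1(2) near[of a b] ab d by auto
    moreover have "\<bar>A w v (x + b' *\<^sub>R v + a' *\<^sub>R w) - A w v x\<bar> < e/2"
      using d2(2) near[of b' a'] ab' d by auto
    ultimately show ?thesis by linarith
  qed
  then have "\<bar>A v w x - A w v x\<bar> \<le> 0" using field_le_epsilon[of "\<bar>A v w x - A w v x\<bar>" 0] by simp
  then show ?thesis by (simp add: A_def)
qed

lemma frechet_derivative_bounded_linear_compose:
  assumes "bounded_linear L" "f differentiable (at x)"
  shows "frechet_derivative (\<lambda>y. L (f y)) (at x) v = L (frechet_derivative f (at x) v)"
  by (rule frechet_derivative_eq[OF bounded_linear.has_derivative[OF assms(1) frechet_derivative_works[THEN iffD1, OF assms(2)]]])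

lemma symmetric_second_derivative:
  fixes f :: "'a::real_normed_vector \<Rightarrow> 'b::euclidean_space"
  assumes f: "smooth_on U f" and U: "open U" "x \<in> U"
  shows "frechet_derivative (\<lambda>y. frechet_derivative f (at y) v) (at x) w =
    frechet_derivative (\<lambda>y. frechet_derivative f (at y) w) (at x) v"
proof (rule euclidean_eqI)
  fix b :: 'b assume "b \<in> Basis"
  have "smooth_on U (\<lambda>y. f y \<bullet> b)"
    by (rule smooth_on_bounded_linear_compose[OF bounded_linear_inner_left U(1) f])
  then have C: "Ck_on 2 U (\<lambda>y. f y \<bullet> b)" by (simp add: smooth_on_def)
  have "frechet_derivative (\<lambda>y. frechet_derivative (\<lambda>y. f y \<bullet> b) (at y) v) (at x) w
    = frechet_derivative (\<lambda>y. frechet_derivative f (at y) v) (at x) w \<bullet> b" for v w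
  proof -
    have "frechet_derivative (\<lambda>y. frechet_derivative (\<lambda>y. f y \<bullet> b) (at y) v) (at x)
      = frechet_derivative (\<lambda>y. frechet_derivative f (at y) v \<bullet> b) (at x)"
    proof (rule frechet_derivative_transform_within_open[OF _ U])
      show "(\<lambda>y. frechet_derivative (\<lambda>y. f y \<bullet> b) (at y) v) differentiable at x"
        using C U by (auto simp: numeral_2_eq_2)
      show "frechet_derivative (\<lambda>y. f y \<bullet> b) (at y) v = frechet_derivative f (at y) v \<bullet> b" if "y \<in> U" for y
        by (rule frechet_derivative_bounded_linear_compose[OF bounded_linear_inner_left smooth_on_differentiable[OF f that]])
    qed
    then show ?thesis
      using frechet_derivative_bounded_linear_compose[OF bounded_linear_inner_left 
         smooth_on_differentiable[OF smooth_on_frechet_derivative[OF f] U(2)]] by simp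
  qed
  then show "frechet_derivative (\<lambda>y. frechet_derivative f (at y) v) (at x) w \<bullet> b =
    frechet_derivative (\<lambda>y. frechet_derivative f (at y) w) (at x) v \<bullet> b"
    using symmetric_second_derivative_real[OF C U] by metis
qed

subsection \<open>Difference quotients of smooth curves\<close>

lemma pds_Nil [simp]: "pds [] f = f" by (simp add: pds_def)
lemma pds_Cons: "pds (i # is) f = pd i (pds is f)" by (simp add: pds_def)

lemma pd_cong:
  assumes "open U" "x \<in> U" "f differentiable (at x)" "\<And>y. y \<in> U \<Longrightarrow> f y = g y"
  shows "pd i f x = pd i g x"
  unfolding pd_def using frechet_derivative_transform_within_open[OF assms(3,1,2)] assms(4) by simp

lemma pds_cong:
  assumes "open U" "smooth_on U f" "\<And>x. x \<in> U \<Longrightarrow> f x = g x" "x \<in> U"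
  shows "pds is f x = pds is g x"
  using assms(4)
proof (induction "is" arbitrary: x)
  case (Cons i "is")
  show ?case unfolding pds_Cons
    by (rule pd_cong[OF assms(1) Cons.prems smooth_on_differentiable[OF smooth_on_pds[OF assms(2)] Cons.prems] Cons.IH])
qed (simp add: assms(3))

lemma pds_scaled_diff:
  assumes U: "open U" and f: "smooth_on U f" and g: "smooth_on U g" and "x \<in> U"
  shows "pds is (\<lambda>x. c *\<^sub>R (f x - g x)) x = c *\<^sub>R (pds is f x - pds is g x)"
  using \<open>x \<in> U\<close>
proof (induction "is" arbitrary: x)
  case (Cons i "is")
  have d: "smooth_on U (\<lambda>x. c *\<^sub>R (f x - g x))"
    by (intro smooth_on_scaleR smooth_on_diff f g U smooth_on_const)
  have "pd i (pds is (\<lambda>x. c *\<^sub>R (f x - g x))) x = pd i (\<lambda>x. c *\<^sub>R (pds is f x - pds is g x)) x"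
    by (rule pd_cong[OF U Cons.prems smooth_on_differentiable[OF smooth_on_pds[OF d] Cons.prems] Cons.IH])
  also have "\<dots> = c *\<^sub>R (pd i (pds is f) x - pd i (pds is g) x)"
    unfolding pd_def
    by (rule frechet_derivative_eq[OF has_derivative_scaleR_right[OF has_derivative_diff[
      OF smooth_on_has_derivative[OF smooth_on_pds[OF f] Cons.prems]
      smooth_on_has_derivative[OF smooth_on_pds[OF g] Cons.prems]]]])
  finally show ?case by (simp add: pds_Cons)
qed simp

lemma frechet_derivative_slice:
  fixes F :: "'a::real_normed_vector \<times> 'b::real_normed_vector \<Rightarrow> 'c::real_normed_vector"
  assumes "F differentiable (at (t, x))"
  shows "((\<lambda>y. F (t, y)) has_derivative (\<lambda>v. frechet_derivative F (at (t, x)) (0, v))) (at x)"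
    "((\<lambda>s. F (s, x)) has_derivative (\<lambda>r. frechet_derivative F (at (t, x)) (r, 0))) (at t)"
proof -
  have F: "(F has_derivative frechet_derivative F (at (t, x))) (at (t, x))"
    using assms by (simp add: frechet_derivative_works)
  show "((\<lambda>y. F (t, y)) has_derivative (\<lambda>v. frechet_derivative F (at (t, x)) (0, v))) (at x)"
    by (rule has_derivative_compose[OF has_derivative_Pair[OF has_derivative_const has_derivative_ident] F])
  show "((\<lambda>s. F (s, x)) has_derivative (\<lambda>r. frechet_derivative F (at (t, x)) (r, 0))) (at t)"
    by (rule has_derivative_compose[OF has_derivative_Pair[OF has_derivative_ident has_derivative_const] F])
qed

definition time_deriv :: "(real \<times> 'b::real_normed_vector \<Rightarrow> 'c::real_normed_vector) \<Rightarrow> real \<times> 'b \<Rightarrow> 'c" where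
  "time_deriv F p = frechet_derivative F (at p) (1, 0)"

lemma smooth_on_time_deriv: "smooth_on W F \<Longrightarrow> smooth_on W (time_deriv F)"
  unfolding time_deriv_def[abs_def] by (rule smooth_on_frechet_derivative)

lemma has_vector_derivative_time_deriv:
  assumes "smooth_on W F" "(t, x) \<in> W"
  shows "((\<lambda>s. F (s, x)) has_vector_derivative time_deriv F (t, x)) (at t)"
proof -
  have d: "F differentiable (at (t, x))" using assms smooth_on_differentiable by blast
  have "frechet_derivative F (at (t, x)) (r, 0) = r *\<^sub>R time_deriv F (t, x)" for r
    using linear_cmul[OF linear_frechet_derivative[OF d], of r "(1, 0)"] by (simp add: time_deriv_def)
  then show ?thesis
    using frechet_derivative_slice(2)[OF d] by (simp add: has_vector_derivative_def)
qed

text \<open>The time slices of a jointly smooth function can be differentiated jointly: their partial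
  derivatives are slices of one jointly smooth \<open>E\<close>, and by the symmetry of second derivatives \<open>E\<close>
  also records the partial derivatives of the velocity.\<close>

lemma pds_slice:
  fixes F :: "real \<times> (real^'n::finite) \<Rightarrow> 'c::euclidean_space"
  assumes W: "open W" and F: "smooth_on W F"
  shows "\<exists>E. smooth_on W E \<and> (\<forall>t x. (t, x) \<in> W \<longrightarrow>
     pds is (\<lambda>y. F (t, y)) x = E (t, x) \<and> pds is (\<lambda>y. time_deriv F (t, y)) x = time_deriv E (t, x))"
proof (induction "is")
  case Nil
  then show ?case using F by (intro exI[of _ F]) simp
next
  case (Cons i "is")
  then obtain E where E: "smooth_on W E"
    "\<And>t x. (t, x) \<in> W \<Longrightarrow> pds is (\<lambda>y. F (t, y)) x = E (t, x)"
    "\<And>t x. (t, x) \<in> W \<Longrightarrow> pds is (\<lambda>y. time_deriv F (t, y)) x = time_deriv E (t, x)" by blast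
  define E' where "E' p = frechet_derivative E (at p) (0, axis i 1)" for p
  have pdE: "pd i g x = frechet_derivative H (at (t, x)) (0, axis i 1)"
    if H: "smooth_on W H" and tx: "(t, x) \<in> W" and g: "\<And>y. (t, y) \<in> W \<Longrightarrow> g y = H (t, y)" for g H t x
  proof -
    have op: "open (Pair t -` W)" by (rule open_vimage[OF W]) (intro continuous_intros)
    have d: "((\<lambda>y. H (t, y)) has_derivative (\<lambda>v. frechet_derivative H (at (t, x)) (0, v))) (at x)"
      by (rule frechet_derivative_slice[OF smooth_on_differentiable[OF H tx]])
    have "(g has_derivative (\<lambda>v. frechet_derivative H (at (t, x)) (0, v))) (at x)"
      by (rule has_derivative_transform_within_open[OF d op]) (use tx g in auto)
    from frechet_derivative_eq[OF this] show ?thesis unfolding pd_def .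
  qed
  have "smooth_on W E'" unfolding E'_def[abs_def] by (rule smooth_on_frechet_derivative[OF E(1)])
  moreover have "pds (i # is) (\<lambda>y. F (t, y)) x = E' (t, x)" if "(t, x) \<in> W" for t x
    unfolding pds_Cons E'_def by (rule pdE[OF E(1) that E(2)])
  moreover have "pds (i # is) (\<lambda>y. time_deriv F (t, y)) x = time_deriv E' (t, x)" if "(t, x) \<in> W" for t x
  proof -
    have "pds (i # is) (\<lambda>y. time_deriv F (t, y)) x = frechet_derivative (time_deriv E) (at (t, x)) (0, axis i 1)"
      unfolding pds_Cons by (rule pdE[OF smooth_on_time_deriv[OF E(1)] that E(3)])
    also have "\<dots> = time_deriv E' (t, x)"
      unfolding time_deriv_def E'_def using symmetric_second_derivative[OF E(1) W that] by (simp add: time_deriv_def[abs_def])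
    finally show ?thesis .
  qed
  ultimately show ?case by blast
qed

text \<open>The partial derivative of the quotient is the quotient of the function \<open>E\<close> from \<open>pds_slice\<close>.
  For that one the mean value inequality bounds the error by the oscillation of the time derivative,
  which is uniformly continuous on a compact set.\<close>

lemma uniform_limit_difference_quotient:
  fixes F :: "real \<times> (real^'n::finite) \<Rightarrow> 'c::euclidean_space"
  assumes F: "smooth_on ({-\<epsilon><..<\<epsilon>} \<times> U) F" and U: "open U" and eps: "\<epsilon> > 0"
    and K: "compact K" "K \<subseteq> U"
    and \<tau>: "\<tau> \<longlonglongrightarrow> 0" "\<And>m. \<tau> m \<noteq> 0" "\<And>m. \<bar>\<tau> m\<bar> < \<epsilon>"
  shows "uniform_limit K (\<lambda>m. pds is (\<lambda>x. (1 / \<tau> m) *\<^sub>R (F (\<tau> m, x) - F (0, x))))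
     (pds is (\<lambda>x. time_deriv F (0, x))) sequentially"
proof -
  let ?W = "{-\<epsilon><..<\<epsilon>} \<times> U"
  have W: "open ?W" using U by (simp add: open_Times)
  obtain E where E: "smooth_on ?W E"
    "\<And>t x. (t, x) \<in> ?W \<Longrightarrow> pds is (\<lambda>y. F (t, y)) x = E (t, x)"
    "\<And>t x. (t, x) \<in> ?W \<Longrightarrow> pds is (\<lambda>y. time_deriv F (t, y)) x = time_deriv E (t, x)"
    using pds_slice[OF W F] by metis
  have slice: "smooth_on U (\<lambda>y. F (t, y))" if "\<bar>t\<bar> < \<epsilon>" for t
    by (rule smooth_on_compose[OF U W F]) (use that in \<open>auto intro!: smooth_on_Pair smooth_on_ident U\<close>)
  have quot: "pds is (\<lambda>x. (1 / \<tau> m) *\<^sub>R (F (\<tau> m, x) - F (0, x))) x = (1 / \<tau> m) *\<^sub>R (E (\<tau> m, x) - E (0, x))"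
    if "x \<in> U" for m x
    using pds_scaled_diff[OF U slice[OF \<tau>(3)] slice[of 0] that] E(2)[of "\<tau> m" x] E(2)[of 0 x] \<tau>(3)[of m] eps that
    by (auto simp: abs_less_iff)
  let ?C = "{-\<epsilon>/2..\<epsilon>/2} \<times> K"
  have CW: "?C \<subseteq> ?W" using eps K by auto
  have "compact ?C" using K by (intro compact_Times) auto
  then have uc: "uniformly_continuous_on ?C (time_deriv E)"
    using CW by (intro compact_uniformly_continuous continuous_on_subset[OF smooth_on_imp_continuous_on[OF smooth_on_time_deriv[OF E(1)]]])
  show ?thesis
  proof (rule uniform_limitI)
    fix e :: real assume e: "e > 0"
    obtain d where d: "d > 0" "\<And>p q. p \<in> ?C \<Longrightarrow> q \<in> ?C \<Longrightarrow> dist q p < d \<Longrightarrow> dist (time_deriv E q) (time_deriv E p) < e/2"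
      using uc e unfolding uniformly_continuous_on_def by (metis half_gt_zero)
    have "\<forall>\<^sub>F m in sequentially. dist (\<tau> m) 0 < min d (\<epsilon>/2)"
      using \<tau>(1) d(1) eps by (intro tendstoD) auto
    then show "\<forall>\<^sub>F m in sequentially. \<forall>x\<in>K. dist (pds is (\<lambda>x. (1 / \<tau> m) *\<^sub>R (F (\<tau> m, x) - F (0, x))) x)
        (pds is (\<lambda>x. time_deriv F (0, x)) x) < e"
    proof eventually_elim
      case (elim m)
      show ?case
      proof
        fix x assume x: "x \<in> K"
        let ?S = "closed_segment 0 (\<tau> m)"
        have S: "\<bar>s\<bar> \<le> \<bar>\<tau> m\<bar>" if "s \<in> ?S" for s
          using that by (auto simp: closed_segment_eq_real_ivl split: if_splits)
        have inC: "(s, x) \<in> ?C" if "s \<in> ?S" for s using S[OF that] elim x by auto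
        have "norm (E (\<tau> m, x) - E (0, x) - (\<tau> m - 0) *\<^sub>R time_deriv E (0, x)) \<le> norm (\<tau> m - 0) * (e/2)"
        proof (rule vector_differentiable_bound_linearization[of ?S "\<lambda>s. E (s, x)" "\<lambda>s. time_deriv E (s, x)" 0 "\<tau> m" 0 "e/2"])
          show "((\<lambda>s. E (s, x)) has_vector_derivative time_deriv E (s, x)) (at s within ?S)" if "s \<in> ?S" for s
            using has_vector_derivative_time_deriv[OF E(1)] CW inC[OF that] has_vector_derivative_at_within by blast
          show "norm (time_deriv E (s, x) - time_deriv E (0, x)) \<le> e/2" if "s \<in> ?S" for s
            using d(2)[of "(0, x)" "(s, x)"] inC[OF that] inC[of 0] S[OF that] elim
            by (force simp: dist_Pair_Pair dist_norm)
        qed auto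
        then have "\<bar>1 / \<tau> m\<bar> * norm (E (\<tau> m, x) - E (0, x) - \<tau> m *\<^sub>R time_deriv E (0, x)) \<le> \<bar>1 / \<tau> m\<bar> * (\<bar>\<tau> m\<bar> * (e/2))"
          by (intro mult_left_mono) auto
        then have "norm ((1 / \<tau> m) *\<^sub>R (E (\<tau> m, x) - E (0, x) - \<tau> m *\<^sub>R time_deriv E (0, x))) \<le> e/2"
          using \<tau>(2)[of m] by (simp add: abs_mult[symmetric])
        then have "norm ((1 / \<tau> m) *\<^sub>R (E (\<tau> m, x) - E (0, x)) - time_deriv E (0, x)) \<le> e/2"
          using \<tau>(2)[of m] by (simp add: scaleR_diff_right)
        moreover have "pds is (\<lambda>x. time_deriv F (0, x)) x = time_deriv E (0, x)" using E(3)[of 0 x] eps x K by auto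
        ultimately show "dist (pds is (\<lambda>x. (1 / \<tau> m) *\<^sub>R (F (\<tau> m, x) - F (0, x))) x) (pds is (\<lambda>x. time_deriv F (0, x)) x) < e"
          using quot[of x m] x K e by (auto simp: dist_norm)
      qed
    qed
  qed
qed

subsection \<open>Bump functions\<close>

text \<open>\<open>x\<^sup>-\<^sup>m exp (-1/x)\<close> continued by zero. The family, unlike the single function \<open>exp (-1/x)\<close>, is closed
  under differentiation up to linear combinations, which makes smoothness an induction.\<close>

definition flat :: "nat \<Rightarrow> real \<Rightarrow> real" where
  "flat m x = (if x > 0 then inverse x ^ m * exp (- inverse x) else 0)"

lemma flat_nonneg: "0 \<le> flat m x" by (simp add: flat_def)

text \<open>Compare with the term of order \<open>m + 2\<close> of the exponential series in \<open>1/x\<close>. The exponent \<open>2\<close> on the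
  right makes the derivative at \<open>0\<close> vanish.\<close>

lemma flat_le: "flat m x \<le> fact (m + 2) * x\<^sup>2"
proof (cases "x > 0")
  case True
  define u where "u = inverse x"
  have u: "u > 0" using True by (simp add: u_def)
  have "(\<Sum>i\<in>{m+2}. u ^ i /\<^sub>R fact i) \<le> exp u"
    unfolding exp_def using u by (intro sum_le_suminf summable_exp_generic) auto
  then have "u ^ (m + 2) / fact (m + 2) \<le> exp u"
    by (simp add: divide_inverse_commute)
  then have "u ^ (m + 2) \<le> fact (m + 2) * exp u"
    by (simp only: pos_divide_le_eq[OF fact_gt_zero] mult.commute)
  then have "u ^ m * exp (- u) \<le> fact (m + 2) * (inverse u)\<^sup>2"
    using u by (simp add: exp_minus field_simps power_add power2_eq_square)
  then show ?thesis using True by (simp add: flat_def u_def)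
qed (simp add: flat_def)

lemma DERIV_flat: "(flat m has_real_derivative flat (m + 2) x - real m * flat (m + 1) x) (at x)"
proof -
  consider "x > 0" | "x < 0" | "x = 0" by linarith
  then show ?thesis
  proof cases
    case 1
    have "((\<lambda>x. inverse x ^ m * exp (- inverse x)) has_real_derivative
        inverse x ^ (m + 2) * exp (- inverse x) - real m * (inverse x ^ (m + 1) * exp (- inverse x))) (at x)"
    proof -
      have "((\<lambda>x. inverse x ^ m) has_real_derivative real m * (- (inverse x * inverse x) * inverse x ^ (m - Suc 0))) (at x)"
        using DERIV_power[OF DERIV_inverse', of "\<lambda>x. x" 1 x UNIV m] 1 by simp
      moreover have "((\<lambda>x. exp (- inverse x)) has_real_derivative exp (- inverse x) * (inverse x * inverse x)) (at x)"
        using 1 by (auto intro!: derivative_eq_intros)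
      ultimately have "((\<lambda>x. inverse x ^ m * exp (- inverse x)) has_real_derivative
          real m * (- (inverse x * inverse x) * inverse x ^ (m - Suc 0)) * exp (- inverse x)
          + exp (- inverse x) * (inverse x * inverse x) * inverse x ^ m) (at x)"
        by (rule DERIV_mult)
      moreover have "real m * (- (inverse x * inverse x) * inverse x ^ (m - Suc 0)) * exp (- inverse x)
          + exp (- inverse x) * (inverse x * inverse x) * inverse x ^ m
        = inverse x ^ (m + 2) * exp (- inverse x) - real m * (inverse x ^ (m + 1) * exp (- inverse x))"
        by (cases m) (simp_all add: algebra_simps)
      ultimately show ?thesis by (simp only:)
    qed
    then have "(flat m has_real_derivative
        inverse x ^ (m + 2) * exp (- inverse x) - real m * (inverse x ^ (m + 1) * exp (- inverse x))) (at x)"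
      by (rule has_field_derivative_transform_within_open[of _ _ _ "{0<..}"]) (use 1 in \<open>auto simp: flat_def\<close>)
    then show ?thesis using 1 by (simp add: flat_def)
  next
    case 2
    have "(flat m has_real_derivative 0) (at x)"
      by (rule has_field_derivative_transform_within_open[of "\<lambda>x. 0" _ _ "{..<0}"]) (use 2 in \<open>auto simp: flat_def\<close>)
    then show ?thesis using 2 by (simp add: flat_def)
  next
    case 3
    have "(\<lambda>h. (flat m (0 + h) - flat m 0) / h) \<midarrow>0\<rightarrow> 0"
    proof (rule Lim_null_comparison)
      show "\<forall>\<^sub>F h in at 0. norm ((flat m (0 + h) - flat m 0) / h) \<le> fact (m + 2) * \<bar>h\<bar>"
      proof (rule always_eventually, rule)
        fix h :: real
        have "\<bar>flat m h\<bar> \<le> fact (m + 2) * h\<^sup>2" using flat_le[of m h] flat_nonneg[of m h] by simp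
        also have "\<dots> = (fact (m + 2) * \<bar>h\<bar>) * \<bar>h\<bar>" by (simp add: power2_eq_square)
        finally show "norm ((flat m (0 + h) - flat m 0) / h) \<le> fact (m + 2) * \<bar>h\<bar>"
          by (cases "h = 0") (simp_all add: flat_def[of m 0] pos_divide_le_eq)
      qed
      have "((\<lambda>h::real. fact (m + 2) * \<bar>h\<bar>) \<longlongrightarrow> fact (m + 2) * \<bar>0\<bar>) (at 0)" by (intro tendsto_intros)
      then show "((\<lambda>h::real. fact (m + 2) * \<bar>h\<bar>) \<longlongrightarrow> 0) (at 0)" by simp
    qed
    then show ?thesis using 3 by (simp add: DERIV_def flat_def)
  qed
qed

lemma smooth_on_flat: "smooth_on UNIV (flat m)"
proof -
  have "Ck_on k UNIV (flat m)" for k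
  proof (induction k arbitrary: m)
    case 0
    have "isCont (flat m) x" for x using DERIV_flat by (rule DERIV_isCont)
    then show ?case by (simp add: continuous_at_imp_continuous_on)
  next
    case (Suc k)
    have "Ck_on k UNIV (\<lambda>x. (flat (m + 2) x + (- real m) * flat (m + 1) x) * v)" for v
      by (rule Ck_on_bounded_bilinear[OF bounded_bilinear_mult open_UNIV Ck_on_add[OF open_UNIV Suc
            Ck_on_bounded_bilinear[OF bounded_bilinear_mult open_UNIV Ck_on_const Suc]] Ck_on_const])
    then show ?case
      by (intro Ck_on_SucI[OF _ _ open_UNIV, where f' = "\<lambda>x v. (flat (m + 2) x + (- real m) * flat (m + 1) x) * v"])
        (use DERIV_flat[of m] in \<open>simp_all add: has_field_derivative_def\<close>)
  qed
  then show ?thesis by (simp add: smooth_on_def)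
qed

lemma bump_exists:
  fixes c :: "'a::euclidean_space"
  obtains \<psi> :: "'a \<Rightarrow> real" where "smooth_on UNIV \<psi>" "\<And>x. x \<in> ball c r \<Longrightarrow> \<psi> x > 0"
    "\<And>x. x \<notin> ball c r \<Longrightarrow> \<psi> x = 0"
proof
  let ?q = "\<lambda>x. r\<^sup>2 - (x - c) \<bullet> (x - c)"
  let ?\<psi> = "\<lambda>x. if r > 0 then flat 0 (?q x) else 0"
  have "smooth_on UNIV ?q"
    by (intro smooth_on_diff smooth_on_inner smooth_on_ident smooth_on_const open_UNIV)
  then show "smooth_on UNIV ?\<psi>"
    using smooth_on_compose[OF open_UNIV open_UNIV smooth_on_flat] by (cases "r > 0") simp_all
  have q: "?q x > 0 \<longleftrightarrow> x \<in> ball c r" if "r > 0" for x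
  proof -
    have "(x - c) \<bullet> (x - c) = (dist c x)\<^sup>2" by (simp add: dist_norm norm_minus_commute[of c x] power2_norm_eq_inner)
    then show ?thesis using that
      by simp (metis abs_of_nonneg abs_of_pos dist_not_less_zero linorder_not_less power2_le_iff_abs_le power2_less_imp_less less_imp_le)
  qed
  show "?\<psi> x > 0" if "x \<in> ball c r" for x
  proof -
    have "r > 0" using that by (metis ball_eq_empty empty_iff not_le)
    then show ?thesis using q[of x] that by (simp add: flat_def)
  qed
  show "?\<psi> x = 0" if "x \<notin> ball c r" for x
    using that q[of x] by (auto simp: flat_def)
qed

subsection \<open>Diffeomorphisms of Euclidean space near the identity\<close>

text \<open>The derivative of \<open>\<Theta>\<close> is the inverse matrix of \<open>D\<Psi>\<close> composed with \<open>\<Theta>\<close>. So it is as often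
  differentiable as \<open>\<Theta>\<close> itself, which gives one more derivative in each step.\<close>

lemma smooth_inverse_function:
  fixes \<Psi> \<Theta> :: "real^'n::finite \<Rightarrow> real^'n"
  assumes \<Psi>: "smooth_on UNIV \<Psi>" and \<Theta>: "continuous_on UNIV \<Theta>"
    and inv: "\<And>y. \<Psi> (\<Theta> y) = y" and det: "\<And>x. det (jacobian \<Psi> (at x)) \<noteq> 0"
  shows "smooth_on UNIV \<Theta>"
proof -
  have der: "(\<Theta> has_derivative (*v) (matrix_inv (jacobian \<Psi> (at (\<Theta> y))))) (at y)" for y
  proof (rule has_derivative_inverse_basic[where f = \<Psi> and g = \<Theta> and T = UNIV])
    show "(\<Psi> has_derivative (*v) (jacobian \<Psi> (at (\<Theta> y)))) (at (\<Theta> y))"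
      using smooth_on_differentiable[OF \<Psi>, of "\<Theta> y"] jacobian_works by blast
    show "(*v) (matrix_inv (jacobian \<Psi> (at (\<Theta> y)))) \<circ> (*v) (jacobian \<Psi> (at (\<Theta> y))) = id"
      using matrix_inv_mult(2)[OF det] by (auto simp: matrix_vector_mul_assoc)
    show "continuous (at y) \<Theta>" using \<Theta> by (simp add: continuous_on_eq_continuous_at)
  qed (auto simp: inv matrix_vector_mul_bounded_linear)
  have "Ck_on k UNIV \<Theta>" for k
  proof (induction k)
    case 0
    then show ?case using \<Theta> by simp
  next
    case (Suc k)
    have "smooth_on UNIV (\<lambda>x. matrix_inv (jacobian \<Psi> (at x)) *v v)" for v
      by (intro smooth_on_matrix_vector_mult smooth_on_matrix_inv smooth_on_jacobian \<Psi> det open_UNIV smooth_on_const)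
    then have "Ck_on k UNIV (\<lambda>x. matrix_inv (jacobian \<Psi> (at x)) *v v)" for v
      by (simp add: smooth_on_def)
    then have "Ck_on k UNIV (\<lambda>y. matrix_inv (jacobian \<Psi> (at (\<Theta> y))) *v v)" for v
      by (rule Ck_on_compose[OF open_UNIV open_UNIV _ Suc]) simp
    then show ?case by (intro Ck_on_SucI[OF der _ open_UNIV])
  qed
  then show ?thesis by (simp add: smooth_on_def)
qed

text \<open>The partial derivatives are continuous with compact support, hence bounded.\<close>

lemma compact_support_lipschitz:
  fixes Y :: "'a::euclidean_space \<Rightarrow> 'b::real_normed_vector"
  assumes Y: "smooth_on UNIV Y" and K: "compact K" "\<And>x. x \<notin> K \<Longrightarrow> Y x = 0"
  obtains L where "L > 0" "\<And>x v. norm (frechet_derivative Y (at x) v) \<le> L * norm v"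
    "\<And>x y. norm (Y x - Y y) \<le> L * norm (x - y)"
proof -
  have D0: "frechet_derivative Y (at x) v = 0" if "x \<notin> K" for x v
  proof -
    have "(Y has_derivative (\<lambda>v. 0)) (at x)"
      by (rule has_derivative_transform_within_open[of "\<lambda>x. 0" _ _ _ "- K"])
        (use that K compact_imp_closed in \<open>auto simp: open_Compl\<close>)
    from frechet_derivative_eq[OF this] show ?thesis .
  qed
  have "\<exists>B. \<forall>x. norm (frechet_derivative Y (at x) b) \<le> B" for b
  proof -
    have "compact ((\<lambda>x. frechet_derivative Y (at x) b) ` K)"
      by (intro compact_continuous_image K continuous_on_subset[OF smooth_on_imp_continuous_on[OF smooth_on_frechet_derivative[OF Y]]]) auto
    from compact_imp_bounded[OF this] obtain B where
      "\<forall>z\<in>(\<lambda>x. frechet_derivative Y (at x) b) ` K. norm z \<le> B" unfolding bounded_iff by blast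
    then have B: "\<And>x. x \<in> K \<Longrightarrow> norm (frechet_derivative Y (at x) b) \<le> B" by simp
    then have "norm (frechet_derivative Y (at x) b) \<le> max B 0" for x
      using D0[of x b] by (cases "x \<in> K") (auto simp: le_max_iff_disj)
    then show ?thesis by blast
  qed
  then obtain B where B: "\<And>x b. norm (frechet_derivative Y (at x) b) \<le> B b" by metis
  have B0: "0 \<le> B b" for b using B[of undefined b] norm_ge_zero order_trans by blast
  define L where "L = (\<Sum>b\<in>Basis. B b) + 1"
  have L: "L > 0" unfolding L_def by (intro add_nonneg_pos sum_nonneg B0) simp
  have bound: "norm (frechet_derivative Y (at x) v) \<le> L * norm v" for x v
  proof -
    have l: "linear (frechet_derivative Y (at x))"
      using smooth_on_differentiable[OF Y] linear_frechet_derivative by blast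
    have "frechet_derivative Y (at x) v = (\<Sum>b\<in>Basis. (v \<bullet> b) *\<^sub>R frechet_derivative Y (at x) b)"
      by (subst euclidean_representation[of v, symmetric]) (simp only: linear_sum[OF l] linear_cmul[OF l])
    also have "norm \<dots> \<le> (\<Sum>b\<in>Basis. norm v * B b)"
      by (rule order_trans[OF norm_sum sum_mono]) (auto intro!: mult_mono B Basis_le_norm)
    also have "\<dots> \<le> L * norm v" by (simp add: L_def sum_distrib_left algebra_simps)
    finally show ?thesis .
  qed
  have "norm (Y x - Y y) \<le> L * norm (x - y)" for x y
  proof (rule differentiable_bound[of UNIV Y "\<lambda>x. frechet_derivative Y (at x)"])
    show "(Y has_derivative frechet_derivative Y (at x)) (at x)" for x
      using smooth_on_has_derivative[OF Y] by simp
    show "onorm (frechet_derivative Y (at x)) \<le> L" for x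
      by (rule onorm_le) (rule bound)
  qed auto
  with L bound that show ?thesis by blast
qed

text \<open>Let \<open>L\<close> be a Lipschitz constant of \<open>Y\<close>. If \<open>\<bar>t\<bar> L < 1\<close>, then \<open>x \<mapsto> y - t Y(x)\<close> is a contraction,
  and its unique fixed point is the unique solution of \<open>x + t Y(x) = y\<close>. The same bound makes
  the inverse Lipschitz and the derivative injective.\<close>

lemma near_identity_diffeomorphism:
  fixes Y :: "real^'n::finite \<Rightarrow> real^'n"
  assumes Y: "smooth_on UNIV Y" and K: "compact K" "\<And>x. x \<notin> K \<Longrightarrow> Y x = 0"
  obtains \<epsilon> where "\<epsilon> > 0" "\<And>t. \<bar>t\<bar> < \<epsilon> \<Longrightarrow> bij (\<lambda>x. x + t *\<^sub>R Y x)"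
    "\<And>t. \<bar>t\<bar> < \<epsilon> \<Longrightarrow> smooth_on UNIV (inv (\<lambda>x. x + t *\<^sub>R Y x))"
proof -
  obtain L where L: "L > 0" "\<And>x v. norm (frechet_derivative Y (at x) v) \<le> L * norm v"
    "\<And>x y. norm (Y x - Y y) \<le> L * norm (x - y)"
    using compact_support_lipschitz[OF Y K] by blast
  \<comment> \<open>\<open>\<epsilon> = 1 / L\<close> makes \<open>t Y\<close> a contraction.\<close>
  have main: "bij (\<lambda>x. x + t *\<^sub>R Y x) \<and> smooth_on UNIV (inv (\<lambda>x. x + t *\<^sub>R Y x))" if t: "\<bar>t\<bar> < 1 / L" for t
  proof -
    define \<Psi> where "\<Psi> x = x + t *\<^sub>R Y x" for x
    define c where "c = \<bar>t\<bar> * L"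
    have c: "0 \<le> c" "c < 1" using t L by (auto simp: c_def field_simps)
    have lip: "norm (t *\<^sub>R Y x - t *\<^sub>R Y y) \<le> c * norm (x - y)" for x y
      using mult_left_mono[OF L(3)[of x y] abs_ge_zero[of t]]
      by (simp add: c_def scaleR_diff_right[symmetric] mult.assoc)
    have "\<exists>!x. \<Psi> x = y" for y
    proof -
      have "\<exists>!x. y - t *\<^sub>R Y x = x"
        by (rule banach_fix_type[OF c]) (use lip in \<open>auto simp: dist_norm norm_minus_commute\<close>)
      moreover have "y - t *\<^sub>R Y x = x \<longleftrightarrow> \<Psi> x = y" for x by (auto simp: \<Psi>_def algebra_simps)
      ultimately show ?thesis by simp
    qed
    then have bij: "bij \<Psi>" by (metis bijI' )
    define \<Theta> where "\<Theta> = inv \<Psi>"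
    have inv: "\<Psi> (\<Theta> y) = y" for y using bij by (simp add: \<Theta>_def bij_is_surj surj_f_inv_f)
    have expand: "(1 - c) * norm (x - y) \<le> norm (\<Psi> x - \<Psi> y)" for x y
    proof -
      have "norm (x - y) = norm ((\<Psi> x - \<Psi> y) - (t *\<^sub>R Y x - t *\<^sub>R Y y))" by (simp add: \<Psi>_def)
      also have "\<dots> \<le> norm (\<Psi> x - \<Psi> y) + c * norm (x - y)"
        using norm_triangle_ineq4 lip by (meson add_left_mono order_trans)
      finally show ?thesis by (simp add: algebra_simps)
    qed
    have "norm (\<Theta> x - \<Theta> y) \<le> (1 / (1 - c)) * norm (x - y)" for x y
      using expand[of "\<Theta> x" "\<Theta> y"] c by (simp add: inv field_simps)
    then have cont: "continuous_on UNIV \<Theta>"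
      by (intro lipschitz_on_continuous_on[of "1 / (1 - c)"] lipschitz_onI) (use c in \<open>auto simp: dist_norm\<close>)
    have \<Psi>: "smooth_on UNIV \<Psi>" unfolding \<Psi>_def[abs_def]
      by (intro smooth_on_add smooth_on_scaleR smooth_on_ident smooth_on_const Y open_UNIV)
    have det: "det (jacobian \<Psi> (at x)) \<noteq> 0" for x
    proof -
      have d: "\<Psi> differentiable (at x)" using smooth_on_differentiable[OF \<Psi>] by simp
      have l: "linear (frechet_derivative \<Psi> (at x))" by (rule linear_frechet_derivative[OF d])
      have "(\<Psi> has_derivative (\<lambda>v. v + t *\<^sub>R frechet_derivative Y (at x) v)) (at x)"
        unfolding \<Psi>_def[abs_def]
        by (intro has_derivative_add has_derivative_ident has_derivative_scaleR_right smooth_on_has_derivative[OF Y]) simp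
      then have eq: "frechet_derivative \<Psi> (at x) v = v + t *\<^sub>R frechet_derivative Y (at x) v" for v
        by (rule frechet_derivative_eq)
      have "v = 0" if "frechet_derivative \<Psi> (at x) v = 0" for v
      proof -
        have "v = - (t *\<^sub>R frechet_derivative Y (at x) v)" using that eq[of v] by (simp add: add_eq_0_iff2)
        then have "norm v = \<bar>t\<bar> * norm (frechet_derivative Y (at x) v)" by (metis norm_minus_cancel norm_scaleR)
        also have "\<dots> \<le> c * norm v"
          unfolding c_def mult.assoc by (intro mult_left_mono L(2)) simp
        finally have "(1 - c) * norm v \<le> 0" by (simp add: algebra_simps)
        then show ?thesis using c by (simp add: mult_le_0_iff)
      qed
      then have "inj (frechet_derivative \<Psi> (at x))" using linear_injective_0[OF l] by blast
      then show ?thesis using det_nz_iff_inj[OF l] by (simp add: jacobian_def)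
    qed
    have "smooth_on UNIV \<Theta>" by (rule smooth_inverse_function[OF \<Psi> cont inv det])
    then show ?thesis using bij by (simp add: \<Theta>_def \<Psi>_def[abs_def])
  qed
  show ?thesis by (rule that[of "1 / L"]) (use main L in auto)
qed

section \<open>Charts, tensor fields and diffeomorphisms\<close>

lemma jacobian_mult_vec: "f differentiable (at x) \<Longrightarrow> jacobian f (at x) *v v = frechet_derivative f (at x) v"
  for f :: "real^'n::finite \<Rightarrow> real^'m::finite"
  using frechet_derivative_eq[OF jacobian_works[THEN iffD1]] by metis

lemma jacobian_eqI:
  fixes f :: "real^'n::finite \<Rightarrow> real^'m::finite"
  assumes "(f has_derivative (*v) M) (at x)"
  shows "jacobian f (at x) = M"
proof -
  have "(*v) (jacobian f (at x)) = (*v) M"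
    using jacobian_works assms has_derivative_unique differentiableI by (metis (no_types, lifting))
  then show ?thesis by (simp add: matrix_eq fun_eq_iff)
qed

lemma jacobian_compose:
  fixes f :: "real^'n::finite \<Rightarrow> real^'m::finite" and g :: "real^'m \<Rightarrow> real^'k::finite"
  assumes f: "f differentiable (at x)" and g: "g differentiable (at (f x))"
    and U: "open U" "x \<in> U" "\<And>y. y \<in> U \<Longrightarrow> h y = g (f y)"
  shows "jacobian h (at x) = jacobian g (at (f x)) ** jacobian f (at x)"
proof (rule jacobian_eqI)
  have f': "(f has_derivative (*v) (jacobian f (at x))) (at x)"
    using f jacobian_works by blast
  have g': "(g has_derivative (*v) (jacobian g (at (f x)))) (at (f x))"
    using g jacobian_works by blast
  have "((\<lambda>y. g (f y)) has_derivative (\<lambda>v. jacobian g (at (f x)) *v (jacobian f (at x) *v v))) (at x)"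
    by (rule has_derivative_compose[OF f' g'])
  then have "((\<lambda>y. g (f y)) has_derivative (*v) (jacobian g (at (f x)) ** jacobian f (at x))) (at x)"
    by (simp add: matrix_vector_mul_assoc)
  then show "(h has_derivative (*v) (jacobian g (at (f x)) ** jacobian f (at x))) (at x)"
    by (rule has_derivative_transform_within_open[OF _ U(1,2)]) (simp add: U(3))
qed

lemma jacobian_ident:
  fixes f :: "real^'n::finite \<Rightarrow> real^'n"
  assumes "open U" "x \<in> U" "\<And>y. y \<in> U \<Longrightarrow> f y = y"
  shows "jacobian f (at x) = mat 1"
proof (rule jacobian_eqI)
  have "((\<lambda>y. y) has_derivative (*v) (mat 1)) (at x)"
  proof -
    have "(*v) (mat 1) = (\<lambda>v::real^'n. v)" by (simp add: fun_eq_iff)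
    then show ?thesis by (simp add: has_derivative_ident)
  qed
  then show "(f has_derivative (*v) (mat 1)) (at x)"
    by (rule has_derivative_transform_within_open[OF _ assms(1,2)]) (simp add: assms(3))
qed

locale smooth_manifold =
  fixes A :: "('a::t2_space, 'n::finite) chart set"
  assumes smooth_structure: "smooth_structure A"
begin

lemma chart: "\<kappa> \<in> A \<Longrightarrow> is_chart \<kappa>"
  using smooth_structure by (simp add: smooth_structure_def)

lemma open_cdom: "\<kappa> \<in> A \<Longrightarrow> open (cdom \<kappa>)"
  and open_cimg: "\<kappa> \<in> A \<Longrightarrow> open (cimg \<kappa>)"
  using chart by (auto simp: is_chart_def)

lemma continuous_on_cmap: "\<kappa> \<in> A \<Longrightarrow> continuous_on (cdom \<kappa>) (cmap \<kappa>)"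
  and continuous_on_cinv: "\<kappa> \<in> A \<Longrightarrow> continuous_on (cimg \<kappa>) (cinv \<kappa>)"
  and cinv_cmap: "\<kappa> \<in> A \<Longrightarrow> p \<in> cdom \<kappa> \<Longrightarrow> cinv \<kappa> (cmap \<kappa> p) = p"
  using chart by (auto simp: is_chart_def homeomorphism_def)

lemma cmap_cinv: "x \<in> cimg \<kappa> \<Longrightarrow> cmap \<kappa> (cinv \<kappa> x) = x"
  and cinv_in_cdom: "x \<in> cimg \<kappa> \<Longrightarrow> cinv \<kappa> x \<in> cdom \<kappa>"
  by (auto simp: f_inv_into_f inv_into_into)

lemma cmap_in_cimg: "p \<in> cdom \<kappa> \<Longrightarrow> cmap \<kappa> p \<in> cimg \<kappa>" by simp

lemma chart_at: "chart_at A p \<in> A" "p \<in> cdom (chart_at A p)"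
proof -
  have "\<exists>\<kappa>. \<kappa> \<in> A \<and> p \<in> cdom \<kappa>"
    using smooth_structure unfolding smooth_structure_def by (metis UNIV_I UN_E)
  then have "chart_at A p \<in> A \<and> p \<in> cdom (chart_at A p)"
    unfolding chart_at_def by (rule someI_ex)
  then show "chart_at A p \<in> A" "p \<in> cdom (chart_at A p)" by simp_all
qed

lemma open_cmap_image:
  assumes "\<kappa> \<in> A" "open W" "W \<subseteq> cdom \<kappa>"
  shows "open (cmap \<kappa> ` W)"
proof -
  have "cmap \<kappa> ` W = cimg \<kappa> \<inter> cinv \<kappa> -` W"
    using assms cinv_cmap[OF assms(1)] cmap_cinv by (auto simp: subset_iff image_iff)
  then show ?thesis
    using continuous_open_preimage[OF continuous_on_cinv[OF assms(1)] open_cimg[OF assms(1)] assms(2)] by simp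
qed

definition overlap :: "('a, 'n) chart \<Rightarrow> ('a, 'n) chart \<Rightarrow> (real^'n) set" where
  "overlap \<kappa> \<tau> = cmap \<kappa> ` (cdom \<kappa> \<inter> cdom \<tau>)"

lemma open_overlap: "\<kappa> \<in> A \<Longrightarrow> \<tau> \<in> A \<Longrightarrow> open (overlap \<kappa> \<tau>)"
  unfolding overlap_def by (rule open_cmap_image) (auto intro: open_cdom)

lemma overlapD:
  assumes "\<kappa> \<in> A" "x \<in> overlap \<kappa> \<tau>"
  shows "x \<in> cimg \<kappa>" "cinv \<kappa> x \<in> cdom \<kappa>" "cinv \<kappa> x \<in> cdom \<tau>" "transition \<kappa> \<tau> x = cmap \<tau> (cinv \<kappa> x)"
  using assms cinv_cmap[OF assms(1)] by (auto simp: overlap_def transition_def)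

lemma overlapI: "p \<in> cdom \<kappa> \<Longrightarrow> p \<in> cdom \<tau> \<Longrightarrow> cmap \<kappa> p \<in> overlap \<kappa> \<tau>"
  by (simp add: overlap_def)

lemma cinv_transition: "\<kappa> \<in> A \<Longrightarrow> \<tau> \<in> A \<Longrightarrow> x \<in> overlap \<kappa> \<tau> \<Longrightarrow> cinv \<tau> (transition \<kappa> \<tau> x) = cinv \<kappa> x"
  using overlapD[of \<kappa> x \<tau>] cinv_cmap by simp

lemma smooth_transition: "\<kappa> \<in> A \<Longrightarrow> \<tau> \<in> A \<Longrightarrow> smooth_on (overlap \<kappa> \<tau>) (transition \<kappa> \<tau>)"
  using smooth_structure by (auto simp: smooth_structure_def compatible_def overlap_def)

lemma differentiable_transition:
  "\<kappa> \<in> A \<Longrightarrow> \<tau> \<in> A \<Longrightarrow> x \<in> overlap \<kappa> \<tau> \<Longrightarrow> transition \<kappa> \<tau> differentiable (at x)"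
  using smooth_on_differentiable[OF smooth_transition] by blast

definition jac :: "('a, 'n) chart \<Rightarrow> ('a, 'n) chart \<Rightarrow> 'a \<Rightarrow> real^'n^'n" where
  "jac \<kappa> \<tau> p = jacobian (transition \<kappa> \<tau>) (at (cmap \<kappa> p))"

lemma jac_trans:
  assumes "\<kappa> \<in> A" "\<tau> \<in> A" "\<sigma> \<in> A" "p \<in> cdom \<kappa>" "p \<in> cdom \<tau>" "p \<in> cdom \<sigma>"
  shows "jac \<kappa> \<sigma> p = jac \<tau> \<sigma> p ** jac \<kappa> \<tau> p"
proof -
  have t: "transition \<kappa> \<tau> (cmap \<kappa> p) = cmap \<tau> p"
    using assms cinv_cmap by (simp add: transition_def)
  have "jacobian (transition \<kappa> \<sigma>) (at (cmap \<kappa> p))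
    = jacobian (transition \<tau> \<sigma>) (at (transition \<kappa> \<tau> (cmap \<kappa> p))) ** jacobian (transition \<kappa> \<tau>) (at (cmap \<kappa> p))"
  proof (rule jacobian_compose[of _ _ _ "overlap \<kappa> \<tau>"])
    show "transition \<tau> \<sigma> differentiable at (transition \<kappa> \<tau> (cmap \<kappa> p))"
      unfolding t using assms by (intro differentiable_transition overlapI)
    show "transition \<kappa> \<sigma> y = transition \<tau> \<sigma> (transition \<kappa> \<tau> y)" if "y \<in> overlap \<kappa> \<tau>" for y
      using cinv_transition[OF assms(1,2) that] by (simp add: transition_def)
  qed (use assms in \<open>auto intro: differentiable_transition overlapI open_overlap\<close>)
  then show ?thesis by (simp add: jac_def t)
qed

lemma jac_self: "\<kappa> \<in> A \<Longrightarrow> p \<in> cdom \<kappa> \<Longrightarrow> jac \<kappa> \<kappa> p = mat 1"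
  unfolding jac_def
  by (rule jacobian_ident[OF open_cimg]) (auto simp: transition_def cmap_cinv)

lemma jac_inverse:
  assumes "\<kappa> \<in> A" "\<tau> \<in> A" "p \<in> cdom \<kappa>" "p \<in> cdom \<tau>"
  shows "jac \<tau> \<kappa> p ** jac \<kappa> \<tau> p = mat 1"
  using jac_trans[of \<kappa> \<tau> \<kappa> p] jac_self assms by simp

lemma det_jac_nonzero:
  assumes "\<kappa> \<in> A" "\<tau> \<in> A" "p \<in> cdom \<kappa>" "p \<in> cdom \<tau>"
  shows "det (jac \<kappa> \<tau> p) \<noteq> 0"
  using arg_cong[OF jac_inverse[OF assms], of det] by (auto simp: det_mul)

lemma coords_vec_eq:
  "\<kappa> \<in> A \<Longrightarrow> p \<in> cdom \<kappa> \<Longrightarrow> coords_vec A \<kappa> X (cmap \<kappa> p) = jac (chart_at A p) \<kappa> p *v X p"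
  by (simp add: coords_vec_def Let_def cinv_cmap jac_def)

lemma coords_ten_eq:
  "\<kappa> \<in> A \<Longrightarrow> p \<in> cdom \<kappa> \<Longrightarrow> coords_ten A \<kappa> h (cmap \<kappa> p) =
    transpose (jac \<kappa> (chart_at A p) p) ** h p ** jac \<kappa> (chart_at A p) p"
  by (simp add: coords_ten_def Let_def cinv_cmap jac_def)

lemma coords_vec_change:
  assumes "\<kappa> \<in> A" "\<tau> \<in> A" "p \<in> cdom \<kappa>" "p \<in> cdom \<tau>"
  shows "coords_vec A \<tau> X (cmap \<tau> p) = jac \<kappa> \<tau> p *v coords_vec A \<kappa> X (cmap \<kappa> p)"
  using jac_trans[of "chart_at A p" \<kappa> \<tau> p] assms chart_at
  by (simp add: coords_vec_eq matrix_vector_mul_assoc)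

lemma coords_ten_change:
  assumes "\<kappa> \<in> A" "\<tau> \<in> A" "p \<in> cdom \<kappa>" "p \<in> cdom \<tau>"
  shows "coords_ten A \<kappa> h (cmap \<kappa> p) = transpose (jac \<kappa> \<tau> p) ** coords_ten A \<tau> h (cmap \<tau> p) ** jac \<kappa> \<tau> p"
  using jac_trans[of \<kappa> \<tau> "chart_at A p" p] assms chart_at
  by (simp add: coords_ten_eq matrix_transpose_mul matrix_mul_assoc)

lemma coords_ten_chart_at: "coords_ten A (chart_at A p) h (cmap (chart_at A p) p) = h p"
  by (simp add: coords_ten_eq chart_at jac_self transpose_mat)

subsection \<open>Pullback in coordinates\<close>

text \<open>The pullback is defined with the charts chosen at \<open>p\<close> and \<open>\<phi> p\<close>. Passing to \<open>\<kappa>\<close> and \<open>\<tau>\<close> factors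
  the Jacobian of the map from \<open>\<kappa>\<close> to the chart at \<open>\<phi> p\<close> in two ways.\<close>

lemma coords_ten_pullback:
  assumes \<phi>: "smooth_map A \<phi>" and "\<kappa> \<in> A" "\<tau> \<in> A" "p \<in> cdom \<kappa>" "\<phi> p \<in> cdom \<tau>"
  shows "coords_ten A \<kappa> (pullback A \<phi> h) (cmap \<kappa> p) =
    transpose (jacobian (cmap \<tau> \<circ> \<phi> \<circ> cinv \<kappa>) (at (cmap \<kappa> p))) ** coords_ten A \<tau> h (cmap \<tau> (\<phi> p))
      ** jacobian (cmap \<tau> \<circ> \<phi> \<circ> cinv \<kappa>) (at (cmap \<kappa> p))"
proof -
  define \<phi>h where "\<phi>h \<kappa> \<tau> = cmap \<tau> \<circ> \<phi> \<circ> cinv \<kappa>" for \<kappa> \<tau> :: "('a, 'n) chart"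
  define D where "D \<kappa> \<tau> = cmap \<kappa> ` (cdom \<kappa> \<inter> \<phi> -` cdom \<tau>)" for \<kappa> \<tau> :: "('a, 'n) chart"
  have cont: "continuous_on UNIV \<phi>" using \<phi> by (simp add: smooth_map_def)
  have D: "open (D \<kappa> \<tau>)" if "\<kappa> \<in> A" "\<tau> \<in> A" for \<kappa> \<tau>
    unfolding D_def using that
    by (intro open_cmap_image open_Int open_cdom open_vimage cont) auto
  have sm: "smooth_on (D \<kappa> \<tau>) (\<phi>h \<kappa> \<tau>)" if "\<kappa> \<in> A" "\<tau> \<in> A" for \<kappa> \<tau>
    using \<phi> that by (simp add: smooth_map_def D_def \<phi>h_def)
  define \<sigma> where "\<sigma> = chart_at A p"
  define \<sigma>' where "\<sigma>' = chart_at A (\<phi> p)"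
  have \<sigma>: "\<sigma> \<in> A" "p \<in> cdom \<sigma>" "\<sigma>' \<in> A" "\<phi> p \<in> cdom \<sigma>'" by (simp_all add: \<sigma>_def \<sigma>'_def chart_at)
  have diff: "\<phi>h \<kappa> \<tau> differentiable (at (cmap \<kappa> p))" if "\<kappa> \<in> A" "\<tau> \<in> A" "p \<in> cdom \<kappa>" "\<phi> p \<in> cdom \<tau>" for \<kappa> \<tau>
    by (rule smooth_on_differentiable[OF sm]) (use that in \<open>auto simp: D_def\<close>)
  have 1: "jacobian (\<phi>h \<kappa> \<sigma>') (at (cmap \<kappa> p)) =
     jacobian (\<phi>h \<sigma> \<sigma>') (at (transition \<kappa> \<sigma> (cmap \<kappa> p))) ** jacobian (transition \<kappa> \<sigma>) (at (cmap \<kappa> p))"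
  proof (rule jacobian_compose[of _ _ _ "overlap \<kappa> \<sigma>"])
    have "transition \<kappa> \<sigma> (cmap \<kappa> p) = cmap \<sigma> p" using assms by (simp add: transition_def cinv_cmap)
    then show "\<phi>h \<sigma> \<sigma>' differentiable at (transition \<kappa> \<sigma> (cmap \<kappa> p))"
      using diff \<sigma> by simp
    show "\<phi>h \<kappa> \<sigma>' y = \<phi>h \<sigma> \<sigma>' (transition \<kappa> \<sigma> y)" if "y \<in> overlap \<kappa> \<sigma>" for y
      using cinv_transition[OF assms(2) \<sigma>(1) that] by (simp add: \<phi>h_def)
  qed (use assms \<sigma> in \<open>auto intro: differentiable_transition overlapI open_overlap\<close>)
  have 2: "jacobian (\<phi>h \<kappa> \<sigma>') (at (cmap \<kappa> p)) =
     jacobian (transition \<tau> \<sigma>') (at (\<phi>h \<kappa> \<tau> (cmap \<kappa> p))) ** jacobian (\<phi>h \<kappa> \<tau>) (at (cmap \<kappa> p))"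
  proof (rule jacobian_compose[of _ _ _ "D \<kappa> \<tau>"])
    have "\<phi>h \<kappa> \<tau> (cmap \<kappa> p) = cmap \<tau> (\<phi> p)" using assms by (simp add: \<phi>h_def cinv_cmap)
    then show "transition \<tau> \<sigma>' differentiable at (\<phi>h \<kappa> \<tau> (cmap \<kappa> p))"
      using assms \<sigma> by (auto intro!: differentiable_transition overlapI)
    show "\<phi>h \<kappa> \<sigma>' y = transition \<tau> \<sigma>' (\<phi>h \<kappa> \<tau> y)" if "y \<in> D \<kappa> \<tau>" for y
      using that assms by (auto simp: \<phi>h_def D_def transition_def cinv_cmap)
  qed (use assms \<sigma> D in \<open>auto intro: diff simp: D_def\<close>)
  have t: "transition \<kappa> \<sigma> (cmap \<kappa> p) = cmap \<sigma> p" "\<phi>h \<kappa> \<tau> (cmap \<kappa> p) = cmap \<tau> (\<phi> p)"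
    using assms by (simp_all add: transition_def cinv_cmap \<phi>h_def)
  have "coords_ten A \<kappa> (pullback A \<phi> h) (cmap \<kappa> p) =
    transpose (jac \<kappa> \<sigma> p) ** (transpose (jacobian (\<phi>h \<sigma> \<sigma>') (at (cmap \<sigma> p))) ** h (\<phi> p) **
      jacobian (\<phi>h \<sigma> \<sigma>') (at (cmap \<sigma> p))) ** jac \<kappa> \<sigma> p"
    using assms by (simp add: coords_ten_eq pullback_def Let_def \<sigma>_def \<sigma>'_def \<phi>h_def)
  also have "\<dots> = transpose (jacobian (\<phi>h \<sigma> \<sigma>') (at (cmap \<sigma> p)) ** jac \<kappa> \<sigma> p) ** h (\<phi> p) **
      (jacobian (\<phi>h \<sigma> \<sigma>') (at (cmap \<sigma> p)) ** jac \<kappa> \<sigma> p)"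
    by (simp add: matrix_transpose_mul matrix_mul_assoc)
  also have "jacobian (\<phi>h \<sigma> \<sigma>') (at (cmap \<sigma> p)) ** jac \<kappa> \<sigma> p = jac \<tau> \<sigma>' (\<phi> p) ** jacobian (\<phi>h \<kappa> \<tau>) (at (cmap \<kappa> p))"
    using 1 2 by (simp add: jac_def t)
  also have "transpose (jac \<tau> \<sigma>' (\<phi> p) ** jacobian (\<phi>h \<kappa> \<tau>) (at (cmap \<kappa> p))) ** h (\<phi> p) **
      (jac \<tau> \<sigma>' (\<phi> p) ** jacobian (\<phi>h \<kappa> \<tau>) (at (cmap \<kappa> p)))
    = transpose (jacobian (\<phi>h \<kappa> \<tau>) (at (cmap \<kappa> p))) ** coords_ten A \<tau> h (cmap \<tau> (\<phi> p)) ** jacobian (\<phi>h \<kappa> \<tau>) (at (cmap \<kappa> p))"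
    using assms by (simp add: coords_ten_eq matrix_transpose_mul matrix_mul_assoc \<sigma>'_def)
  finally show ?thesis by (simp add: \<phi>h_def)
qed

subsection \<open>Smooth functions\<close>

lemma smooth_funD: "smooth_fun A f \<Longrightarrow> \<kappa> \<in> A \<Longrightarrow> smooth_on (cimg \<kappa>) (\<lambda>x. f (cinv \<kappa> x))"
  by (simp add: smooth_fun_def comp_def)

lemma smooth_funI: "(\<And>\<kappa>. \<kappa> \<in> A \<Longrightarrow> smooth_on (cimg \<kappa>) (\<lambda>x. f (cinv \<kappa> x))) \<Longrightarrow> smooth_fun A f"
  by (simp add: smooth_fun_def comp_def)

lemma smooth_fun_const: "smooth_fun A (\<lambda>p. c)" by (rule smooth_funI) simp

lemma smooth_fun_mult: "smooth_fun A f \<Longrightarrow> smooth_fun A g \<Longrightarrow> smooth_fun A (\<lambda>p. f p * g p)"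
  by (rule smooth_funI, rule smooth_on_mult) (auto intro: open_cimg smooth_funD)

lemma smooth_fun_sum: "(\<And>i. i \<in> I \<Longrightarrow> smooth_fun A (f i)) \<Longrightarrow> smooth_fun A (\<lambda>p. \<Sum>i\<in>I. f i p)"
  by (rule smooth_funI, rule smooth_on_sum) (auto intro: open_cimg smooth_funD)

lemma smooth_fun_divide:
  "smooth_fun A f \<Longrightarrow> smooth_fun A g \<Longrightarrow> (\<And>p. g p \<noteq> 0) \<Longrightarrow> smooth_fun A (\<lambda>p. f p / g p)"
  by (rule smooth_funI, rule smooth_on_divide) (auto intro: open_cimg smooth_funD)

text \<open>Since transition maps are smooth, smoothness near a point may be tested in any one chart.\<close>

lemma smooth_fun_local:
  assumes "\<And>p. \<exists>\<kappa> W. \<kappa> \<in> A \<and> open W \<and> p \<in> W \<and> W \<subseteq> cdom \<kappa> \<and> smooth_on (cmap \<kappa> ` W) (\<lambda>x. f (cinv \<kappa> x))"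
  shows "smooth_fun A f"
proof (intro smooth_funI smooth_on_local)
  fix \<tau> y assume \<tau>: "\<tau> \<in> A" and y: "y \<in> cimg \<tau>"
  obtain \<kappa> W where W: "\<kappa> \<in> A" "open W" "cinv \<tau> y \<in> W" "W \<subseteq> cdom \<kappa>" "smooth_on (cmap \<kappa> ` W) (\<lambda>x. f (cinv \<kappa> x))"
    using assms by metis
  define V where "V = cmap \<tau> ` (cdom \<tau> \<inter> W)"
  have V: "open V" unfolding V_def using W \<tau> by (intro open_cmap_image open_Int open_cdom) auto
  have yV: "y \<in> V" unfolding V_def using y W cmap_cinv[OF y] cinv_in_cdom[OF y] by (metis IntI imageI)
  have Vo: "V \<subseteq> overlap \<tau> \<kappa>" using W by (auto simp: V_def overlap_def)
  have "smooth_on V (\<lambda>x. f (cinv \<kappa> (transition \<tau> \<kappa> x)))"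
  proof (rule smooth_on_compose[OF V open_cmap_image[OF W(1,2,4)] W(5)])
    show "smooth_on V (transition \<tau> \<kappa>)" using smooth_on_subset[OF smooth_transition[OF \<tau> W(1)] Vo] .
    show "transition \<tau> \<kappa> x \<in> cmap \<kappa> ` W" if "x \<in> V" for x
      using that cinv_cmap[OF \<tau>] by (auto simp: V_def transition_def)
  qed
  then have "smooth_on V (\<lambda>x. f (cinv \<tau> x))"
    by (rule smooth_on_cong[OF V]) (use Vo cinv_transition[OF \<tau> W(1)] in auto)
  then show "\<exists>V. open V \<and> y \<in> V \<and> smooth_on V (\<lambda>x. f (cinv \<tau> x))" using V yV by blast
qed

lemma smooth_fun_continuous: "smooth_fun A f \<Longrightarrow> continuous_on UNIV f"
proof -
  assume f: "smooth_fun A f"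
  have "isCont f p" for p
  proof -
    let ?\<kappa> = "chart_at A p"
    have "continuous_on (cdom ?\<kappa>) (\<lambda>q. f (cinv ?\<kappa> (cmap ?\<kappa> q)))"
      by (rule continuous_on_compose2[OF smooth_on_imp_continuous_on[OF smooth_funD[OF f chart_at(1)]]
            continuous_on_cmap[OF chart_at(1)]]) auto
    then have "continuous_on (cdom ?\<kappa>) f"
      by (rule continuous_on_eq) (simp add: cinv_cmap chart_at)
    then show ?thesis using continuous_on_eq_continuous_at[OF open_cdom[OF chart_at(1)]] chart_at(2) by blast
  qed
  then show ?thesis by (simp add: continuous_at_imp_continuous_on)
qed

lemma compact_cinv_image: "\<kappa> \<in> A \<Longrightarrow> compact K \<Longrightarrow> K \<subseteq> cimg \<kappa> \<Longrightarrow> compact (cinv \<kappa> ` K)"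
  by (intro compact_continuous_image continuous_on_subset[OF continuous_on_cinv])

lemma open_compl_cinv_image: "\<kappa> \<in> A \<Longrightarrow> compact K \<Longrightarrow> K \<subseteq> cimg \<kappa> \<Longrightarrow> open (- cinv \<kappa> ` K)"
  by (simp add: open_Compl compact_imp_closed compact_cinv_image)

lemma outside_chart_outside_support:
  assumes "K \<subseteq> cimg \<kappa>" "p \<notin> cdom \<kappa>"
  shows "p \<notin> cinv \<kappa> ` K"
proof
  assume "p \<in> cinv \<kappa> ` K"
  then obtain x where "x \<in> K" "p = cinv \<kappa> x" by (rule imageE)
  with assms(2) cinv_in_cdom[OF subsetD[OF assms(1)]] show False by metis
qed

lemma coords_vec_outside_support:
  assumes K: "K \<subseteq> cimg \<kappa>" and X: "\<And>p. p \<notin> cinv \<kappa> ` K \<Longrightarrow> X p = 0" and x: "x \<in> cimg \<kappa>" "x \<notin> K"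
  shows "coords_vec A \<kappa> X x = 0"
proof -
  have "cinv \<kappa> x \<notin> cinv \<kappa> ` K"
  proof
    assume "cinv \<kappa> x \<in> cinv \<kappa> ` K"
    then obtain k where "k \<in> K" "cinv \<kappa> x = cinv \<kappa> k" by (rule imageE)
    then have "x = k" using cmap_cinv[OF x(1)] cmap_cinv[OF subsetD[OF K]] by metis
    then show False using \<open>k \<in> K\<close> x(2) by simp
  qed
  then have "X (cinv \<kappa> x) = 0" by (rule X)
  then show ?thesis by (simp add: coords_vec_def Let_def)
qed

lemma smooth_fun_extend_by_zero:
  assumes \<kappa>: "\<kappa> \<in> A" and K: "compact K" "K \<subseteq> cimg \<kappa>"
    and \<psi>: "smooth_on (cimg \<kappa>) \<psi>" "\<And>x. x \<notin> K \<Longrightarrow> \<psi> x = 0"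
  shows "smooth_fun A (\<lambda>p. if p \<in> cdom \<kappa> then \<psi> (cmap \<kappa> p) else 0)"
proof (rule smooth_fun_local)
  let ?f = "\<lambda>p. if p \<in> cdom \<kappa> then \<psi> (cmap \<kappa> p) else 0"
  fix p
  show "\<exists>\<tau> W. \<tau> \<in> A \<and> open W \<and> p \<in> W \<and> W \<subseteq> cdom \<tau> \<and> smooth_on (cmap \<tau> ` W) (\<lambda>x. ?f (cinv \<tau> x))"
  proof (cases "p \<in> cdom \<kappa>")
    case True
    have "smooth_on (cimg \<kappa>) (\<lambda>x. ?f (cinv \<kappa> x))"
      by (rule smooth_on_cong[OF open_cimg[OF \<kappa>] \<psi>(1)]) (simp add: cinv_in_cdom cmap_cinv)
    then show ?thesis using True \<kappa> open_cdom by blast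
  next
    case False
    let ?\<tau> = "chart_at A p"
    let ?W = "cdom ?\<tau> \<inter> - cinv \<kappa> ` K"
    have W: "open ?W" by (intro open_Int open_cdom open_compl_cinv_image chart_at \<kappa> K)
    have "?f q = 0" if "q \<in> ?W" for q
    proof (cases "q \<in> cdom \<kappa>")
      case True
      then have "cmap \<kappa> q \<notin> K" using that cinv_cmap[OF \<kappa> True] by (metis ComplD IntE image_eqI)
      then show ?thesis using \<psi>(2) by simp
    qed simp
    then have eq0: "0 = ?f (cinv ?\<tau> x)" if x: "x \<in> cmap ?\<tau> ` ?W" for x
    proof -
      from x obtain q where q: "q \<in> ?W" "x = cmap ?\<tau> q" by blast
      then have "cinv ?\<tau> x = q" using cinv_cmap[OF chart_at(1)] by simp
      with \<open>\<And>q. q \<in> ?W \<Longrightarrow> ?f q = 0\<close>[OF q(1)] show ?thesis by (simp only:)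
    qed
    have sm: "smooth_on (cmap ?\<tau> ` ?W) (\<lambda>x. ?f (cinv ?\<tau> x))"
    proof (rule smooth_on_cong)
      show "open (cmap ?\<tau> ` ?W)" by (rule open_cmap_image[OF chart_at(1) W]) simp
    qed (rule smooth_on_const, rule eq0)
    have "p \<in> ?W" using chart_at(2) outside_chart_outside_support[OF K(2) False] by simp
    with W sm chart_at(1) show ?thesis
      by (intro exI[of _ ?\<tau>] exI[of _ ?W] conjI) simp_all
  qed
qed

end

context smooth_manifold
begin

subsection \<open>Diffeomorphisms supported in one chart\<close>

definition chart_transfer :: "('a, 'n) chart \<Rightarrow> (real^'n \<Rightarrow> real^'n) \<Rightarrow> 'a \<Rightarrow> 'a" where
  "chart_transfer \<kappa> \<Psi> p = (if p \<in> cdom \<kappa> then cinv \<kappa> (\<Psi> (cmap \<kappa> p)) else p)"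

lemma chart_transfer_outside:
  assumes "\<kappa> \<in> A" "\<And>x. x \<notin> K \<Longrightarrow> \<Psi> x = x" "p \<notin> cinv \<kappa> ` K"
  shows "chart_transfer \<kappa> \<Psi> p = p"
proof (cases "p \<in> cdom \<kappa>")
  case True
  then have "cmap \<kappa> p \<notin> K" using assms(3) cinv_cmap[OF assms(1) True] by (metis image_eqI)
  then show ?thesis using True assms cinv_cmap by (simp add: chart_transfer_def)
qed (simp add: chart_transfer_def)

text \<open>The manifold is covered by two open sets: the chart domain, where the map is \<open>\<Psi>\<close> in
  coordinates, and the complement of the support, where it is the identity. The complement is open
  because a compact subset of a Hausdorff space is closed.\<close>

lemma smooth_map_chart_transfer:
  assumes \<kappa>: "\<kappa> \<in> A" and K: "compact K" "K \<subseteq> cimg \<kappa>"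
    and \<Psi>: "smooth_on UNIV \<Psi>" "\<And>x. x \<notin> K \<Longrightarrow> \<Psi> x = x" "\<And>x. x \<in> cimg \<kappa> \<Longrightarrow> \<Psi> x \<in> cimg \<kappa>"
  shows "smooth_map A (chart_transfer \<kappa> \<Psi>)"
proof -
  let ?\<phi> = "chart_transfer \<kappa> \<Psi>"
  define W where "W = - cinv \<kappa> ` K"
  have W: "open W" unfolding W_def by (rule open_compl_cinv_image[OF \<kappa> K])
  have id: "?\<phi> p = p" if "p \<in> W" for p
    using chart_transfer_outside[OF \<kappa> \<Psi>(2)] that by (auto simp: W_def)
  have "p \<in> W" if "p \<notin> cdom \<kappa>" for p
    unfolding W_def using outside_chart_outside_support[OF K(2) that] by simp
  then have cover: "cdom \<kappa> \<union> W = UNIV" by auto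
  have c1: "continuous_on (cdom \<kappa>) ?\<phi>"
  proof (rule continuous_on_eq)
    show "continuous_on (cdom \<kappa>) (\<lambda>p. cinv \<kappa> (\<Psi> (cmap \<kappa> p)))"
    proof (rule continuous_on_compose2[OF continuous_on_cinv[OF \<kappa>]])
      show "continuous_on (cdom \<kappa>) (\<lambda>p. \<Psi> (cmap \<kappa> p))"
        by (rule continuous_on_compose2[OF smooth_on_imp_continuous_on[OF \<Psi>(1)] continuous_on_cmap[OF \<kappa>]]) simp
      show "(\<lambda>p. \<Psi> (cmap \<kappa> p)) ` cdom \<kappa> \<subseteq> cimg \<kappa>" using \<Psi>(3) by blast
    qed
  qed (simp add: chart_transfer_def)
  have c2: "continuous_on W ?\<phi>"
    by (rule continuous_on_eq[OF continuous_on_id]) (simp add: id)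
  have cont: "continuous_on UNIV ?\<phi>"
    using continuous_on_open_Un[OF open_cdom[OF \<kappa>] W c1 c2] cover by simp
  have "smooth_on (cmap \<sigma> ` (cdom \<sigma> \<inter> ?\<phi> -` cdom \<tau>)) (cmap \<tau> \<circ> ?\<phi> \<circ> cinv \<sigma>)" if \<sigma>: "\<sigma> \<in> A" and \<tau>: "\<tau> \<in> A" for \<sigma> \<tau>
  proof (rule smooth_on_local)
    fix y assume "y \<in> cmap \<sigma> ` (cdom \<sigma> \<inter> ?\<phi> -` cdom \<tau>)"
    then obtain p where p: "p \<in> cdom \<sigma>" "?\<phi> p \<in> cdom \<tau>" "y = cmap \<sigma> p" by blast
    have op: "open (?\<phi> -` cdom \<tau>)" by (rule open_vimage[OF open_cdom[OF \<tau>] cont])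
    show "\<exists>V. open V \<and> y \<in> V \<and> smooth_on V (cmap \<tau> \<circ> ?\<phi> \<circ> cinv \<sigma>)"
    proof (cases "p \<in> cdom \<kappa>")
      case True
      define V where "V = cmap \<sigma> ` (cdom \<sigma> \<inter> (?\<phi> -` cdom \<tau> \<inter> cdom \<kappa>))"
      have V: "open V" unfolding V_def using \<sigma> \<kappa> op by (intro open_cmap_image open_Int open_cdom) auto
      have t: "transition \<sigma> \<kappa> x \<in> cimg \<kappa>" "\<Psi> (transition \<sigma> \<kappa> x) \<in> overlap \<kappa> \<tau>"
        "?\<phi> (cinv \<sigma> x) = cinv \<kappa> (\<Psi> (transition \<sigma> \<kappa> x))" if "x \<in> V" for x
      proof -
        from that obtain q where q: "q \<in> cdom \<sigma>" "?\<phi> q \<in> cdom \<tau>" "q \<in> cdom \<kappa>" "x = cmap \<sigma> q"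
          unfolding V_def by blast
        have tr: "transition \<sigma> \<kappa> x = cmap \<kappa> q" using q cinv_cmap[OF \<sigma>] by (simp add: transition_def)
        then show 1: "transition \<sigma> \<kappa> x \<in> cimg \<kappa>" using q by simp
        show 2: "?\<phi> (cinv \<sigma> x) = cinv \<kappa> (\<Psi> (transition \<sigma> \<kappa> x))"
          using q tr cinv_cmap[OF \<sigma>] by (simp add: chart_transfer_def)
        have 3: "\<Psi> (transition \<sigma> \<kappa> x) \<in> cimg \<kappa>" by (rule \<Psi>(3)[OF 1])
        have "cinv \<kappa> (\<Psi> (transition \<sigma> \<kappa> x)) \<in> cdom \<tau>" using q 2 cinv_cmap[OF \<sigma>] by simp
        then show "\<Psi> (transition \<sigma> \<kappa> x) \<in> overlap \<kappa> \<tau>"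
          using overlapI[OF cinv_in_cdom[OF 3]] cmap_cinv[OF 3] by metis
      qed
      have "smooth_on V (\<lambda>x. \<Psi> (transition \<sigma> \<kappa> x))"
        by (rule smooth_on_compose[OF V open_UNIV \<Psi>(1) smooth_on_subset[OF smooth_transition[OF \<sigma> \<kappa>]]])
          (auto simp: V_def overlap_def)
      then have "smooth_on V (\<lambda>x. transition \<kappa> \<tau> (\<Psi> (transition \<sigma> \<kappa> x)))"
        by (rule smooth_on_compose[OF V open_overlap[OF \<kappa> \<tau>] smooth_transition[OF \<kappa> \<tau>]]) (rule t(2))
      then have "smooth_on V (cmap \<tau> \<circ> ?\<phi> \<circ> cinv \<sigma>)"
        by (rule smooth_on_cong[OF V]) (simp add: t transition_def)
      moreover have "y \<in> V" using p True by (auto simp: V_def)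
      ultimately show ?thesis using V by blast
    next
      case False
      then have pW: "p \<in> W" using cover by blast
      define V where "V = cmap \<sigma> ` (cdom \<sigma> \<inter> (?\<phi> -` cdom \<tau> \<inter> W))"
      have V: "open V" unfolding V_def using \<sigma> W op by (intro open_cmap_image open_Int open_cdom) auto
      have "V \<subseteq> overlap \<sigma> \<tau>" by (auto simp: V_def overlap_def id)
      then have "smooth_on V (transition \<sigma> \<tau>)" using smooth_on_subset[OF smooth_transition[OF \<sigma> \<tau>]] by blast
      then have "smooth_on V (cmap \<tau> \<circ> ?\<phi> \<circ> cinv \<sigma>)"
      proof (rule smooth_on_cong[OF V])
        fix x assume "x \<in> V"
        then obtain q where "q \<in> cdom \<sigma>" "q \<in> W" "x = cmap \<sigma> q" unfolding V_def by blast
        then show "transition \<sigma> \<tau> x = (cmap \<tau> \<circ> ?\<phi> \<circ> cinv \<sigma>) x"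
          using cinv_cmap[OF \<sigma>] by (simp add: transition_def id)
      qed
      moreover have "y \<in> V" using p pW by (auto simp: V_def)
      ultimately show ?thesis using V by blast
    qed
  qed
  with cont show ?thesis by (simp add: smooth_map_def)
qed

text \<open>A point of \<open>U\<close> that left \<open>U\<close> would land on a fixed point, against injectivity.\<close>

lemma bij_preserves_support:
  assumes "bij \<Psi>" "\<And>x. x \<notin> K \<Longrightarrow> \<Psi> x = x" "K \<subseteq> U" "x \<in> U"
  shows "\<Psi> x \<in> U"
proof (rule ccontr)
  assume "\<Psi> x \<notin> U"
  then have "\<Psi> (\<Psi> x) = \<Psi> x" using assms by blast
  then have "\<Psi> x = x" using bij_is_inj[OF assms(1)] by (simp add: inj_eq)
  then show False using \<open>\<Psi> x \<notin> U\<close> assms(4) by simp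
qed

lemma diffeo_chart_transfer:
  assumes \<kappa>: "\<kappa> \<in> A" and K: "compact K" "K \<subseteq> cimg \<kappa>"
    and \<Psi>: "smooth_on UNIV \<Psi>" "\<And>x. x \<notin> K \<Longrightarrow> \<Psi> x = x" "bij \<Psi>" "smooth_on UNIV (inv \<Psi>)"
  shows "diffeo A (chart_transfer \<kappa> \<Psi>)"
proof -
  have inv_id: "inv \<Psi> x = x" if "x \<notin> K" for x
    using \<Psi>(2)[OF that] \<Psi>(3) by (metis bij_inv_eq_iff)
  have bi: "bij (inv \<Psi>)" by (rule bij_imp_bij_inv[OF \<Psi>(3)])
  have comp: "chart_transfer \<kappa> \<Theta> (chart_transfer \<kappa> \<Xi> p) = p"
    if "\<And>x. \<Theta> (\<Xi> x) = x" "\<And>x. x \<in> cimg \<kappa> \<Longrightarrow> \<Xi> x \<in> cimg \<kappa>" for \<Theta> \<Xi> p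
  proof (cases "p \<in> cdom \<kappa>")
    case True
    then have "\<Xi> (cmap \<kappa> p) \<in> cimg \<kappa>" using that(2) by simp
    then show ?thesis using True that(1) cinv_cmap[OF \<kappa> True]
      by (simp add: chart_transfer_def cinv_in_cdom cmap_cinv)
  qed (simp add: chart_transfer_def)
  have m: "\<Psi> x \<in> cimg \<kappa>" "inv \<Psi> x \<in> cimg \<kappa>" if "x \<in> cimg \<kappa>" for x
    using bij_preserves_support[OF \<Psi>(3,2) K(2) that] bij_preserves_support[OF bi inv_id K(2) that] by blast+
  have 1: "chart_transfer \<kappa> (inv \<Psi>) (chart_transfer \<kappa> \<Psi> p) = p" for p
    by (rule comp) (use m \<Psi>(3) in \<open>simp_all add: bij_is_inj\<close>)
  have 2: "chart_transfer \<kappa> \<Psi> (chart_transfer \<kappa> (inv \<Psi>) p) = p" for p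
    by (rule comp) (use m \<Psi>(3) in \<open>simp_all add: bij_is_surj surj_f_inv_f\<close>)
  have "bij (chart_transfer \<kappa> \<Psi>)" by (rule bijI') (metis 1, metis 2)
  moreover have "inv (chart_transfer \<kappa> \<Psi>) = chart_transfer \<kappa> (inv \<Psi>)"
    by (rule inv_equality) (fact 1, fact 2)
  ultimately show ?thesis
    unfolding diffeo_def
    using smooth_map_chart_transfer[OF \<kappa> K \<Psi>(1,2) m(1)] smooth_map_chart_transfer[OF \<kappa> K \<Psi>(4) inv_id m(2)] by simp
qed

subsection \<open>Curves of tensor fields\<close>

definition smooth_curve :: "real \<Rightarrow> (real \<Rightarrow> 'a \<Rightarrow> real^'n^'n) \<Rightarrow> bool" where
  "smooth_curve \<epsilon> \<gamma> \<longleftrightarrow> (\<forall>\<kappa>\<in>A. smooth_on ({-\<epsilon><..<\<epsilon>} \<times> cimg \<kappa>) (\<lambda>z. coords_ten A \<kappa> (\<gamma> (fst z)) (snd z)))"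

lemma smooth_on_snd:
  fixes f :: "'c::euclidean_space \<Rightarrow> 'd::real_normed_vector" and I :: "'b::euclidean_space set"
  assumes "open I" "open U" "smooth_on U f"
  shows "smooth_on (I \<times> U) (\<lambda>z. f (snd z))"
  by (rule smooth_on_compose[OF _ assms(2,3) smooth_on_linear[OF bounded_linear_snd]])
    (use assms in \<open>auto simp: open_Times\<close>)

text \<open>The analogue of \<open>smooth_fun_local\<close>; the transformation law of tensors does not involve the
  parameter.\<close>

lemma smooth_curve_local:
  assumes "\<And>p. \<exists>\<kappa> W. \<kappa> \<in> A \<and> open W \<and> p \<in> W \<and> W \<subseteq> cdom \<kappa> \<and>
    smooth_on ({-\<epsilon><..<\<epsilon>} \<times> cmap \<kappa> ` W) (\<lambda>z. coords_ten A \<kappa> (\<gamma> (fst z)) (snd z))"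
  shows "smooth_curve \<epsilon> \<gamma>"
  unfolding smooth_curve_def
proof (intro ballI smooth_on_local)
  fix \<tau> and z :: "real \<times> (real^'n)" assume \<tau>: "\<tau> \<in> A" and z: "z \<in> {-\<epsilon><..<\<epsilon>} \<times> cimg \<tau>"
  obtain \<kappa> W where W: "\<kappa> \<in> A" "open W" "cinv \<tau> (snd z) \<in> W" "W \<subseteq> cdom \<kappa>"
    "smooth_on ({-\<epsilon><..<\<epsilon>} \<times> cmap \<kappa> ` W) (\<lambda>z. coords_ten A \<kappa> (\<gamma> (fst z)) (snd z))"
    using assms[of "cinv \<tau> (snd z)"] by (elim exE conjE)
  let ?I = "{-\<epsilon><..<\<epsilon>}"
  define V where "V = cmap \<tau> ` (cdom \<tau> \<inter> W)"
  have V: "open V" unfolding V_def using W \<tau> by (intro open_cmap_image open_Int open_cdom) auto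
  have IV: "open (?I \<times> V)" using V by (simp add: open_Times)
  have "snd z \<in> cimg \<tau>" using z by auto
  then have yV: "snd z \<in> V" unfolding V_def
    by (intro image_eqI[of _ _ "cinv \<tau> (snd z)"]) (simp_all add: cmap_cinv cinv_in_cdom W(3))
  have Vo: "V \<subseteq> overlap \<tau> \<kappa>" using W by (auto simp: V_def overlap_def)
  have tV: "smooth_on V (transition \<tau> \<kappa>)" using smooth_on_subset[OF smooth_transition[OF \<tau> W(1)] Vo] .
  have J: "smooth_on (?I \<times> V) (\<lambda>z. jacobian (transition \<tau> \<kappa>) (at (snd z)))"
    by (rule smooth_on_snd[OF open_greaterThanLessThan V smooth_on_jacobian[OF V tV]])
  have "smooth_on (?I \<times> V) (\<lambda>z. coords_ten A \<kappa> (\<gamma> (fst (fst z, transition \<tau> \<kappa> (snd z)))) (snd (fst z, transition \<tau> \<kappa> (snd z))))"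
  proof (rule smooth_on_compose[OF IV _ W(5), where g = "\<lambda>z. (fst z, transition \<tau> \<kappa> (snd z))"])
    show "open (?I \<times> cmap \<kappa> ` W)" by (intro open_Times open_cmap_image W open_greaterThanLessThan)
    show "smooth_on (?I \<times> V) (\<lambda>z. (fst z, transition \<tau> \<kappa> (snd z)))"
      by (intro smooth_on_Pair IV smooth_on_linear[OF bounded_linear_fst] smooth_on_snd[OF open_greaterThanLessThan V tV])
    show "(fst z, transition \<tau> \<kappa> (snd z)) \<in> ?I \<times> cmap \<kappa> ` W" if "z \<in> ?I \<times> V" for z
      using that cinv_cmap[OF \<tau>] by (auto simp: V_def transition_def)
  qed
  then have "smooth_on (?I \<times> V) (\<lambda>z. transpose (jacobian (transition \<tau> \<kappa>) (at (snd z))) **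
      coords_ten A \<kappa> (\<gamma> (fst z)) (transition \<tau> \<kappa> (snd z)) ** jacobian (transition \<tau> \<kappa>) (at (snd z)))"
    by (intro smooth_on_matrix_mult smooth_on_transpose IV J) simp
  then have "smooth_on (?I \<times> V) (\<lambda>z. coords_ten A \<tau> (\<gamma> (fst z)) (snd z))"
  proof (rule smooth_on_cong[OF IV])
    fix z :: "real \<times> (real^'n)" assume "z \<in> ?I \<times> V"
    then obtain q where q: "q \<in> cdom \<tau>" "q \<in> W" "snd z = cmap \<tau> q" unfolding V_def by auto
    then have "q \<in> cdom \<kappa>" using W by blast
    from coords_ten_change[OF \<tau> W(1) q(1) this] q cinv_cmap[OF \<tau>]
    show "transpose (jacobian (transition \<tau> \<kappa>) (at (snd z))) **
      coords_ten A \<kappa> (\<gamma> (fst z)) (transition \<tau> \<kappa> (snd z)) ** jacobian (transition \<tau> \<kappa>) (at (snd z))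
      = coords_ten A \<tau> (\<gamma> (fst z)) (snd z)"
      by (simp add: jac_def transition_def)
  qed
  moreover have "z \<in> ?I \<times> V" using z yV by auto
  ultimately show "\<exists>V. open V \<and> z \<in> V \<and> smooth_on V (\<lambda>z. coords_ten A \<tau> (\<gamma> (fst z)) (snd z))"
    using IV by blast
qed

lemma smooth_curve_slice:
  assumes "smooth_curve \<epsilon> \<gamma>" "\<bar>t\<bar> < \<epsilon>" "\<kappa> \<in> A"
  shows "smooth_on (cimg \<kappa>) (coords_ten A \<kappa> (\<gamma> t))"
proof -
  have "smooth_on (cimg \<kappa>) (\<lambda>x. coords_ten A \<kappa> (\<gamma> (fst (t, x))) (snd (t, x)))"
    by (rule smooth_on_compose[where V = "{-\<epsilon><..<\<epsilon>} \<times> cimg \<kappa>" and f = "\<lambda>z. coords_ten A \<kappa> (\<gamma> (fst z)) (snd z)"])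
      (use assms in \<open>auto intro!: open_Times smooth_on_Pair smooth_on_ident open_cimg simp: smooth_curve_def\<close>)
  then show ?thesis by simp
qed

lemma bounded_linear_congruence:
  fixes P :: "real^'m::finite^'k::finite" and Q :: "real^'l::finite^'j::finite"
  shows "bounded_linear (\<lambda>M. P ** M ** Q)"
proof -
  have "linear (\<lambda>M. P ** M ** Q)"
    by (rule linearI) (simp_all add: vec_eq_iff
        matrix_matrix_mult_def sum_distrib_left sum_distrib_right algebra_simps sum.distrib)
  then show ?thesis by (simp add: linear_conv_bounded_linear)
qed

lemma coords_ten_scaled_diff:
  "coords_ten A \<kappa> (\<lambda>p. c *\<^sub>R (h p - k p)) x = c *\<^sub>R (coords_ten A \<kappa> h x - coords_ten A \<kappa> k x)"
  unfolding coords_ten_def Let_def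
  by (simp add: linear_simps[OF bounded_linear_congruence])

text \<open>The chain rule. The difference quotients \<open>H m = (\<gamma> (\<tau> m) - g) / \<tau> m\<close> converge to the velocity \<open>h\<close> in
  the \<open>C\<^sup>\<infinity>\<close> topology, and the point \<open>g + \<tau> m H m\<close> is exactly \<open>\<gamma> (\<tau> m)\<close>; Hadamard differentiability is made
  for this situation.\<close>

lemma functional_derivative_along_curve:
  assumes D: "has_functional_derivative A S g D"
    and \<gamma>: "smooth_curve \<epsilon> \<gamma>" "\<epsilon> > 0" "\<And>t p. transpose (\<gamma> t p) = \<gamma> t p" "\<gamma> 0 = g"
    and h: "sym_tensor A h" "\<And>p. ((\<lambda>t. \<gamma> t p) has_vector_derivative h p) (at 0)"
  shows "((\<lambda>t. S (\<gamma> t)) has_real_derivative D h) (at 0)"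
proof -
  have "((\<lambda>t. (S (\<gamma> t) - S g) / t) \<longlongrightarrow> D h) (at 0 within {-\<epsilon><..<\<epsilon>})"
    unfolding tendsto_at_iff_sequentially
  proof (intro allI impI)
    fix \<tau> :: "nat \<Rightarrow> real"
    assume \<tau>0: "\<forall>i. \<tau> i \<in> {-\<epsilon><..<\<epsilon>} - {0}" and \<tau>1: "\<tau> \<longlonglongrightarrow> 0"
    have \<tau>: "\<tau> m \<noteq> 0" "\<bar>\<tau> m\<bar> < \<epsilon>" for m using \<tau>0 by (auto simp: abs_less_iff dest: spec[of _ m])
    define H where "H m p = (1 / \<tau> m) *\<^sub>R (\<gamma> (\<tau> m) p - g p)" for m p
    have cH: "coords_ten A \<kappa> (H m) x = (1 / \<tau> m) *\<^sub>R (coords_ten A \<kappa> (\<gamma> (\<tau> m)) x - coords_ten A \<kappa> (\<gamma> 0) x)" for \<kappa> m x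
      unfolding H_def[abs_def] \<gamma>(4) by (rule coords_ten_scaled_diff)
    have "smooth_on (cimg \<kappa>) (coords_ten A \<kappa> (H m))" if "\<kappa> \<in> A" for \<kappa> m
      unfolding cH using smooth_curve_slice[OF \<gamma>(1) _ that, of "\<tau> m"] smooth_curve_slice[OF \<gamma>(1) _ that, of 0] \<tau> \<gamma>(2) that
      by (intro smooth_on_scaleR smooth_on_const smooth_on_diff open_cimg) auto
    moreover have "transpose (H m p) = H m p" for m p
      using \<gamma>(3)[of "\<tau> m" p] \<gamma>(3)[of 0 p] by (simp add: H_def \<gamma>(4) transpose_def vec_eq_iff)
    ultimately have symH: "sym_tensor A (H m)" for m by (simp add: sym_tensor_def)
    have "Cinf_tendsto A H h"
      unfolding Cinf_tendsto_def
    proof (intro ballI allI impI)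
      fix \<kappa> K and \<alpha> :: "'n list" assume \<kappa>: "\<kappa> \<in> A" and K: "compact K \<and> K \<subseteq> cimg \<kappa>"
      define F where "F z = coords_ten A \<kappa> (\<gamma> (fst z)) (snd z)" for z
      have F: "smooth_on ({-\<epsilon><..<\<epsilon>} \<times> cimg \<kappa>) F"
        using \<gamma>(1) \<kappa> by (simp add: smooth_curve_def F_def[abs_def])
      have "time_deriv F (0, x) = coords_ten A \<kappa> h x" if x: "x \<in> cimg \<kappa>" for x
      proof -
        have 1: "((\<lambda>s. F (s, x)) has_vector_derivative time_deriv F (0, x)) (at 0)"
          by (rule has_vector_derivative_time_deriv[OF F]) (use x \<gamma>(2) in auto)
        have 2: "((\<lambda>s. F (s, x)) has_vector_derivative coords_ten A \<kappa> h x) (at 0)"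
          unfolding F_def coords_ten_def Let_def fst_conv snd_conv
          by (rule bounded_linear.has_vector_derivative[OF bounded_linear_congruence h(2)])
        show ?thesis by (rule vector_derivative_unique_at[OF 1 2])
      qed
      then have eq: "pds \<alpha> (coords_ten A \<kappa> h) x = pds \<alpha> (\<lambda>x. time_deriv F (0, x)) x" if "x \<in> cimg \<kappa>" for x
        using that h(1) \<kappa> by (intro pds_cong[OF open_cimg[OF \<kappa>]]) (auto simp: sym_tensor_def)
      have "uniform_limit K (\<lambda>m. pds \<alpha> (\<lambda>x. (1 / \<tau> m) *\<^sub>R (F (\<tau> m, x) - F (0, x))))
          (pds \<alpha> (\<lambda>x. time_deriv F (0, x))) sequentially"
        by (rule uniform_limit_difference_quotient[OF F open_cimg[OF \<kappa>] \<gamma>(2) _ _ \<tau>1 \<tau>]) (use K in auto)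
      moreover have "coords_ten A \<kappa> (H m) = (\<lambda>x. (1 / \<tau> m) *\<^sub>R (F (\<tau> m, x) - F (0, x)))" for m
        by (simp add: fun_eq_iff cH F_def)
      ultimately show "uniform_limit K (\<lambda>m. pds \<alpha> (coords_ten A \<kappa> (H m))) (pds \<alpha> (coords_ten A \<kappa> h)) sequentially"
        using eq K by (simp add: subset_iff cong: uniform_limit_cong')
    qed
    then have "(\<lambda>m. (S (\<lambda>p. g p + \<tau> m *\<^sub>R H m p) - S g) / \<tau> m) \<longlonglongrightarrow> D h"
      using D symH h(1) \<tau>1 \<tau>(1) unfolding has_functional_derivative_def by blast
    moreover have "(\<lambda>p. g p + \<tau> m *\<^sub>R H m p) = \<gamma> (\<tau> m)" for m
      using \<tau>(1)[of m] by (simp add: H_def)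
    ultimately show "((\<lambda>t. (S (\<gamma> t) - S g) / t) \<circ> \<tau>) \<longlonglongrightarrow> D h" by (simp add: comp_def)
  qed
  then have "((\<lambda>t. (S (\<gamma> t) - S g) / t) \<longlongrightarrow> D h) (at 0)"
    using \<gamma>(2) by (simp add: at_within_open[of 0 "{-\<epsilon><..<\<epsilon>}"])
  then show ?thesis by (simp add: DERIV_def \<gamma>(4))
qed

end

section \<open>Lie derivative and divergence\<close>

lemma bounded_bilinear_matrix_mult:
  "bounded_bilinear ((**) :: real^'m::finite^'k::finite \<Rightarrow> real^'n::finite^'m \<Rightarrow> real^'n^'k)"
  unfolding bilinear_conv_bounded_bilinear[symmetric] bilinear_def
  by (auto intro!: linearI simp: vec_eq_iff matrix_matrix_mult_def sum_distrib_left algebra_simps sum.distrib)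

lemma bounded_bilinear_matrix_vector_mult:
  "bounded_bilinear ((*v) :: real^'m::finite^'k::finite \<Rightarrow> real^'m \<Rightarrow> real^'k)"
  unfolding bilinear_conv_bounded_bilinear[symmetric] bilinear_def
  by (auto intro!: linearI simp: vec_eq_iff matrix_vector_mult_def sum_distrib_left algebra_simps sum.distrib)

lemma bounded_linear_transpose: "bounded_linear (transpose :: real^'m::finite^'k::finite \<Rightarrow> real^'k^'m)"
  unfolding linear_conv_bounded_linear[symmetric]
  by (auto intro!: linearI simp: vec_eq_iff transpose_def)

lemma frechet_derivative_expand:
  assumes "f differentiable (at x)"
  shows "frechet_derivative f (at x) v = (\<Sum>k\<in>UNIV. v $ k *\<^sub>R pd k f x)"
proof -
  have l: "linear (frechet_derivative f (at x))" using assms by (rule linear_frechet_derivative)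
  have "v = (\<Sum>k\<in>UNIV. v $ k *\<^sub>R axis k 1)"
    using basis_expansion[of v] by (simp add: scalar_mult_eq_scaleR)
  then have "frechet_derivative f (at x) v = frechet_derivative f (at x) (\<Sum>k\<in>UNIV. v $ k *\<^sub>R axis k 1)"
    by simp
  then show ?thesis by (simp add: linear_sum[OF l] linear_cmul[OF l] pd_def)
qed

lemma jacobian_component: "jacobian f (at x) $ k $ j = pd j f x $ k"
  for f :: "real^'n::finite \<Rightarrow> real^'m::finite"
  by (simp add: jacobian_def matrix_def pd_def)

text \<open>The components of \<open>\<L>\<^sub>Y G\<close> in coordinates, as a matrix.\<close>

definition lie_mat :: "(real^'n \<Rightarrow> real^'n^'n) \<Rightarrow> (real^'n \<Rightarrow> real^'n) \<Rightarrow> real^'n \<Rightarrow> real^'n::finite^'n" where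
  "lie_mat G Y x = frechet_derivative G (at x) (Y x) + transpose (jacobian Y (at x)) ** G x + G x ** jacobian Y (at x)"

lemma lie_mat_component:
  assumes "G differentiable (at x)"
  shows "lie_mat G Y x $ i $ j = (\<Sum>k\<in>UNIV. Y x $ k * pd k G x $ i $ j + G x $ k $ j * pd i Y x $ k + G x $ i $ k * pd j Y x $ k)"
  by (simp add: lie_mat_def frechet_derivative_expand[OF assms] sum_component matrix_matrix_mult_def
     transpose_def jacobian_component sum.distrib mult.commute)

text \<open>Both the derivative of \<open>H\<close> along \<open>Z\<close> and the Jacobian of \<open>Z\<close> produce second derivatives of \<open>T\<close>.
  They match because \<open>D\<^sup>2T(Z, v) = D\<^sup>2T(v, Z)\<close>.\<close>

lemma lie_mat_change:
  fixes T :: "real^'n::finite \<Rightarrow> real^'n"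
  assumes U: "open U" "x \<in> U" and T: "smooth_on U T"
    and G: "G differentiable (at (T x))" and Y: "Y differentiable (at (T x))" and Z: "Z differentiable (at x)"
    and H: "\<And>y. y \<in> U \<Longrightarrow> H y = transpose (jacobian T (at y)) ** G (T y) ** jacobian T (at y)"
    and YZ: "\<And>y. y \<in> U \<Longrightarrow> Y (T y) = jacobian T (at y) *v Z y"
  shows "lie_mat H Z x = transpose (jacobian T (at x)) ** lie_mat G Y (T x) ** jacobian T (at x)"
proof -
  define J where "J y = jacobian T (at y)" for y
  have T': "(T has_derivative (*v) (J x)) (at x)"
    unfolding J_def using smooth_on_differentiable[OF T U(2)] jacobian_works by blast
  define J' where "J' = frechet_derivative J (at x)"
  have "smooth_on U J" unfolding J_def[abs_def] by (rule smooth_on_jacobian[OF U(1) T])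
  then have J': "(J has_derivative J') (at x)"
    unfolding J'_def by (rule smooth_on_has_derivative[OF _ U(2)])
  \<comment> \<open>Symmetry of the second derivative of \<open>T\<close>.\<close>
  have J'_sym: "J' v *v w = J' w *v v" for v w
  proof -
    have *: "J' v *v w = frechet_derivative (\<lambda>y. frechet_derivative T (at y) w) (at x) v" for v w
    proof -
      have "((\<lambda>y. J y *v w) has_derivative (\<lambda>v. J' v *v w)) (at x)"
        using bounded_bilinear.FDERIV[OF bounded_bilinear_matrix_vector_mult J' has_derivative_const] by simp
      then have "((\<lambda>y. frechet_derivative T (at y) w) has_derivative (\<lambda>v. J' v *v w)) (at x)"
        by (rule has_derivative_transform_within_open[OF _ U])
          (simp add: J_def jacobian_mult_vec smooth_on_differentiable[OF T])
      then show ?thesis using frechet_derivative_eq by metis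
    qed
    show ?thesis unfolding * by (rule symmetric_second_derivative[OF T U])
  qed
  define DG where "DG = frechet_derivative G (at (T x))"
  have GT: "((\<lambda>y. G (T y)) has_derivative (\<lambda>v. DG (J x *v v))) (at x)"
    unfolding DG_def using has_derivative_compose[OF T' frechet_derivative_works[THEN iffD1, OF G]] .
  have JT: "((\<lambda>y. transpose (J y)) has_derivative (\<lambda>v. transpose (J' v))) (at x)"
    by (rule bounded_linear.has_derivative[OF bounded_linear_transpose J'])
  have "((\<lambda>y. transpose (J y) ** G (T y) ** J y) has_derivative
     (\<lambda>v. transpose (J x) ** G (T x) ** J' v + (transpose (J x) ** DG (J x *v v) + transpose (J' v) ** G (T x)) ** J x)) (at x)"
    by (rule bounded_bilinear.FDERIV[OF bounded_bilinear_matrix_mult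
          bounded_bilinear.FDERIV[OF bounded_bilinear_matrix_mult JT GT] J'])
  then have "(H has_derivative
     (\<lambda>v. transpose (J x) ** G (T x) ** J' v + (transpose (J x) ** DG (J x *v v) + transpose (J' v) ** G (T x)) ** J x)) (at x)"
    by (rule has_derivative_transform_within_open[OF _ U]) (simp add: H J_def)
  then have DH: "frechet_derivative H (at x) (Z x) = transpose (J x) ** G (T x) ** J' (Z x)
      + (transpose (J x) ** DG (Y (T x)) + transpose (J' (Z x)) ** G (T x)) ** J x"
    using YZ[OF U(2)] by (simp add: frechet_derivative_eq J_def)
  have DYJ: "jacobian Y (at (T x)) ** J x = J' (Z x) + J x ** jacobian Z (at x)"
  proof -
    have 1: "((\<lambda>y. Y (T y)) has_derivative (\<lambda>v. (jacobian Y (at (T x)) ** J x) *v v)) (at x)"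
      using has_derivative_compose[OF T' jacobian_works[THEN iffD1, OF Y]] by (simp add: matrix_vector_mul_assoc)
    have "((\<lambda>y. J y *v Z y) has_derivative (\<lambda>v. J x *v (jacobian Z (at x) *v v) + J' v *v Z x)) (at x)"
      by (rule bounded_bilinear.FDERIV[OF bounded_bilinear_matrix_vector_mult J' jacobian_works[THEN iffD1, OF Z]])
    then have "((\<lambda>y. Y (T y)) has_derivative (\<lambda>v. J x *v (jacobian Z (at x) *v v) + J' v *v Z x)) (at x)"
      by (rule has_derivative_transform_within_open[OF _ U]) (simp add: YZ J_def)
    from has_derivative_unique[OF 1 this]
    have "(jacobian Y (at (T x)) ** J x) *v v = (J' (Z x) + J x ** jacobian Z (at x)) *v v" for v
      by (simp add: fun_eq_iff J'_sym[of _ "Z x"] matrix_vector_mul_assoc matrix_vector_mult_add_rdistrib)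
    then show ?thesis by (simp add: matrix_eq)
  qed
  then have DYJ': "transpose (J x) ** transpose (jacobian Y (at (T x))) = transpose (J' (Z x)) + transpose (jacobian Z (at x)) ** transpose (J x)"
  proof -
    have "transpose (jacobian Y (at (T x)) ** J x) = transpose (J' (Z x) + J x ** jacobian Z (at x))"
      by (simp only: DYJ)
    then show ?thesis
      by (simp only: matrix_transpose_mul linear_simps(1)[OF bounded_linear_transpose])
  qed
  have dist: "P ** (Q + R) = P ** Q + P ** R" "(Q + R) ** S = Q ** S + R ** S" for P Q R S :: "real^'n^'n"
    by (simp_all add: bounded_bilinear.add_left[OF bounded_bilinear_matrix_mult] bounded_bilinear.add_right[OF bounded_bilinear_matrix_mult])
  have "transpose (J x) ** lie_mat G Y (T x) ** J x =
     transpose (J x) ** DG (Y (T x)) ** J x + (transpose (J x) ** transpose (jacobian Y (at (T x)))) ** G (T x) ** J x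
       + transpose (J x) ** G (T x) ** (jacobian Y (at (T x)) ** J x)"
    by (simp add: lie_mat_def DG_def dist matrix_mul_assoc)
  also have "\<dots> = lie_mat H Z x"
    unfolding DYJ DYJ' lie_mat_def DH using H[OF U(2)] by (simp add: dist matrix_mul_assoc J_def)
  finally show ?thesis by (simp add: J_def)
qed

subsection \<open>The divergence is half the trace of the Lie derivative of the metric\<close>

lemma transpose_matrix_inv:
  fixes P :: "real^'n::finite^'n"
  assumes "det P \<noteq> 0" "transpose P = P"
  shows "transpose (matrix_inv P) = matrix_inv P"
proof -
  let ?Q = "matrix_inv P"
  have "transpose ?Q ** P = mat 1"
    using arg_cong[OF matrix_inv_mult(1)[OF assms(1)], of transpose] assms(2)
    by (simp add: matrix_transpose_mul transpose_mat)
  then have "transpose ?Q ** P ** ?Q = ?Q" by simp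
  then show ?thesis by (simp add: matrix_mul_assoc[symmetric] matrix_inv_mult[OF assms(1)])
qed

lemma matrix_inv_unique:
  fixes P Q :: "real^'n::finite^'n"
  assumes "Q ** P = mat 1"
  shows "matrix_inv P = Q"
proof -
  have "det Q * det P = 1" using arg_cong[OF assms, of det] by (simp add: det_mul)
  then have "det P \<noteq> 0" by auto
  then have "Q ** (P ** matrix_inv P) = Q" by (simp add: matrix_inv_mult)
  then show ?thesis by (simp add: matrix_mul_assoc assms)
qed

text \<open>In the trace against \<open>G\<^sup>-\<^sup>1\<close> the two Jacobian terms of the Lie derivative each contribute
  the trace of \<open>DY\<close>.\<close>

lemma trace_inv_lie_mat:
  fixes G :: "real^'n::finite \<Rightarrow> real^'n^'n"
  assumes G: "G differentiable (at x)" and nz: "det (G x) \<noteq> 0"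
  shows "trace (matrix_inv (G x) ** lie_mat G Y x) =
    (\<Sum>a\<in>UNIV. Y x $ a * trace (matrix_inv (G x) ** pd a G x)) + 2 * (\<Sum>a\<in>UNIV. pd a Y x $ a)"
proof -
  let ?N = "matrix_inv (G x)" and ?J = "jacobian Y (at x)"
  have tr_add: "trace (P + Q) = trace P + trace Q" for P Q :: "real^'n^'n"
    by (simp add: trace_def sum.distrib)
  have tr_sum: "trace (\<Sum>a\<in>UNIV. Y x $ a *\<^sub>R (P a)) = (\<Sum>a\<in>UNIV. Y x $ a * trace (P a))" for P :: "'n \<Rightarrow> real^'n^'n"
    unfolding trace_def by (simp add: sum_component sum_distrib_left sum.swap[of "\<lambda>a i. Y x $ a * P a $ i $ i"])
  have trace_jac: "trace ?J = (\<Sum>a\<in>UNIV. pd a Y x $ a)"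
    by (simp add: trace_def jacobian_component)
  have "trace (?N ** lie_mat G Y x) = trace (?N ** frechet_derivative G (at x) (Y x)) + trace (?N ** (transpose ?J ** G x)) + trace (?N ** (G x ** ?J))"
    unfolding lie_mat_def by (simp add: matrix_add_ldistrib tr_add)
  also have "trace (?N ** (G x ** ?J)) = trace ?J" by (simp add: matrix_mul_assoc matrix_inv_mult[OF nz])
  also have "trace (?N ** (transpose ?J ** G x)) = trace (transpose ?J)"
    by (subst trace_mul_sym) (simp add: matrix_mul_assoc[symmetric] matrix_inv_mult[OF nz])
  also have "trace (transpose ?J) = trace ?J" by (simp add: trace_def transpose_def)
  also have "trace (?N ** frechet_derivative G (at x) (Y x)) = (\<Sum>a\<in>UNIV. Y x $ a * trace (?N ** pd a G x))"
    unfolding frechet_derivative_expand[OF G]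
    by (simp add: bounded_bilinear.sum_right[OF bounded_bilinear_matrix_mult]
        bounded_bilinear.scaleR_right[OF bounded_bilinear_matrix_mult] tr_sum)
  finally show ?thesis by (simp add: trace_jac)
qed

text \<open>In the contracted Christoffel symbol \<open>\<Gamma>\<^sup>a\<^sub>a\<^sub>c\<close> the first and the last of the three terms cancel by
  symmetry, so it equals \<open>1/2 tr (G\<^sup>-\<^sup>1 \<partial>\<^sub>cG)\<close>. Hence the divergence is half the trace of the Lie derivative.\<close>

lemma sum_cov_deriv:
  fixes G :: "real^'n::finite \<Rightarrow> real^'n^'n"
  assumes U: "open U" "x \<in> U" and sym: "\<And>y. y \<in> U \<Longrightarrow> transpose (G y) = G y"
    and G: "G differentiable (at x)" and det: "det (G x) \<noteq> 0"
  shows "(\<Sum>a\<in>UNIV. cov_deriv G Y x a a) = 1/2 * trace (matrix_inv (G x) ** lie_mat G Y x)"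
proof -
  define N where "N = matrix_inv (G x)"
  have N_sym: "N $ i $ j = N $ j $ i" for i j
  proof -
    have "transpose N $ j $ i = N $ j $ i"
      using transpose_matrix_inv[OF det sym[OF U(2)]] by (simp only: N_def)
    then show ?thesis by (simp add: transpose_def)
  qed
  have pd_sym: "pd a G x $ i $ j = pd a G x $ j $ i" for a i j
  proof -
    have "pd a G x = pd a (\<lambda>y. transpose (G y)) x"
      by (rule pd_cong[OF U G]) (simp add: sym)
    also have "\<dots> = transpose (pd a G x)"
      unfolding pd_def by (rule frechet_derivative_bounded_linear_compose[OF bounded_linear_transpose G])
    finally have "pd a G x $ i $ j = transpose (pd a G x) $ i $ j" by (rule arg_cong)
    then show ?thesis by (simp add: transpose_def)
  qed
  have chr: "(\<Sum>a\<in>UNIV. christoffel G x a a c) = 1/2 * trace (N ** pd c G x)" for c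
  proof -
    have "(\<Sum>a\<in>UNIV. \<Sum>l\<in>UNIV. N $ a $ l * pd a G x $ c $ l) = (\<Sum>a\<in>UNIV. \<Sum>l\<in>UNIV. N $ a $ l * pd l G x $ a $ c)"
      by (subst sum.swap) (intro sum.cong refl arg_cong2[where f = "(*)"] N_sym pd_sym)
    then have "(\<Sum>a\<in>UNIV. \<Sum>l\<in>UNIV. N $ a $ l * (pd a G x $ c $ l + pd c G x $ a $ l - pd l G x $ a $ c))
      = (\<Sum>a\<in>UNIV. \<Sum>l\<in>UNIV. N $ a $ l * pd c G x $ l $ a)"
      by (simp add: ring_distribs sum.distrib sum_subtractf pd_sym[of c])
    then show ?thesis
      unfolding christoffel_def N_def[symmetric] sum_distrib_left[symmetric]
      by (simp add: trace_def matrix_matrix_mult_def)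
  qed
  have "(\<Sum>a\<in>UNIV. cov_deriv G Y x a a) = (\<Sum>a\<in>UNIV. pd a Y x $ a) + (\<Sum>c\<in>UNIV. (\<Sum>a\<in>UNIV. christoffel G x a a c) * Y x $ c)"
    unfolding cov_deriv_def sum.distrib sum_distrib_right by (subst sum.swap) simp
  also have "\<dots> = (\<Sum>a\<in>UNIV. pd a Y x $ a) + 1/2 * (\<Sum>c\<in>UNIV. Y x $ c * trace (N ** pd c G x))"
    unfolding chr by (simp add: sum_distrib_left mult_ac)
  finally show ?thesis
    using trace_inv_lie_mat[OF G det, of Y] by (simp add: N_def)
qed

lemma trace_congruence:
  fixes J M N :: "real^'n::finite^'n"
  assumes "det J \<noteq> 0" "det M \<noteq> 0"
  shows "trace (matrix_inv (transpose J ** M ** J) ** (transpose J ** N ** J)) = trace (matrix_inv M ** N)"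
proof -
  let ?I = "matrix_inv J"
  have tJ: "transpose ?I ** transpose J = mat 1"
    using arg_cong[OF matrix_inv_mult(1)[OF assms(1)], of transpose] by (simp add: matrix_transpose_mul transpose_mat)
  have "?I ** matrix_inv M ** transpose ?I ** (transpose J ** M ** J)
      = ?I ** (matrix_inv M ** ((transpose ?I ** transpose J) ** M)) ** J"
    by (simp add: matrix_mul_assoc)
  also have "\<dots> = mat 1" by (simp add: tJ matrix_inv_mult assms)
  finally have inv: "matrix_inv (transpose J ** M ** J) = ?I ** matrix_inv M ** transpose ?I"
    by (rule matrix_inv_unique)
  have "trace (matrix_inv (transpose J ** M ** J) ** (transpose J ** N ** J)) =
    trace (?I ** (matrix_inv M ** ((transpose ?I ** transpose J) ** N) ** J))"
    unfolding inv by (simp add: matrix_mul_assoc)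
  also have "\<dots> = trace ((matrix_inv M ** N ** J) ** ?I)"
    by (subst trace_mul_sym) (simp add: tJ)
  also have "\<dots> = trace (matrix_inv M ** N)"
    by (simp add: matrix_mul_assoc[symmetric] matrix_inv_mult assms)
  finally show ?thesis .
qed

text \<open>The determinant does not vanish on the segment from the identity to \<open>M\<close>, which consists of
  positive definite matrices.\<close>

lemma positive_definite_det_pos:
  fixes M :: "real^'n::finite^'n"
  assumes pos: "\<And>v. v \<noteq> 0 \<Longrightarrow> v \<bullet> (M *v v) > 0"
  shows "det M > 0"
proof -
  define P where "P t = (1 - t) *\<^sub>R mat 1 + t *\<^sub>R M" for t :: real
  have nz: "det (P t) \<noteq> 0" if "0 \<le> t" "t \<le> 1" for t
  proof -
    have "P t *v v \<noteq> 0" if "v \<noteq> 0" for v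
    proof -
      have "v \<bullet> (P t *v v) = (1 - t) * (v \<bullet> v) + t * (v \<bullet> (M *v v))"
        by (simp add: P_def matrix_vector_mult_add_rdistrib inner_add_right scaleR_matrix_vector_assoc[symmetric])
      moreover have "\<dots> > 0"
      proof (cases "t = 0")
        case False
        then show ?thesis using \<open>0 \<le> t\<close> \<open>t \<le> 1\<close> pos[OF that]
          by (intro add_nonneg_pos mult_nonneg_nonneg mult_pos_pos) auto
      qed (use that in simp)
      ultimately show ?thesis by auto
    qed
    then have "invertible (P t)" unfolding invertible_left_inverse matrix_left_invertible_ker by blast
    then show ?thesis by (simp add: invertible_det_nz)
  qed
  have cont: "continuous_on {0..1} (\<lambda>t. det (P t))"
    unfolding det_def P_def by (intro continuous_intros)
  show ?thesis
  proof (rule ccontr)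
    assume "\<not> det M > 0"
    then have "det (P 1) \<le> 0" "0 \<le> det (P 0)" by (simp_all add: P_def)
    then obtain t where "0 \<le> t" "t \<le> 1" "det (P t) = 0"
      using IVT2'[of "\<lambda>t. det (P t)" 1 0 0] cont by auto
    then show False using nz by blast
  qed
qed

context smooth_manifold
begin

lemma metricD:
  assumes "riemannian_metric A g"
  shows "sym_tensor A g" "transpose (g p) = g p" "v \<noteq> 0 \<Longrightarrow> v \<bullet> (g p *v v) > 0"
  using assms by (auto simp: riemannian_metric_def sym_tensor_def)

lemma sym_tensorD:
  assumes "sym_tensor A h"
  shows "\<kappa> \<in> A \<Longrightarrow> smooth_on (cimg \<kappa>) (coords_ten A \<kappa> h)" "transpose (h p) = h p"
  using assms by (auto simp: sym_tensor_def)

lemma coords_ten_sym: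
  assumes "\<And>p. transpose (h p) = h p"
  shows "transpose (coords_ten A \<kappa> h x) = coords_ten A \<kappa> h x"
  by (simp add: coords_ten_def Let_def matrix_transpose_mul assms matrix_mul_assoc)

lemma coords_metric_det_pos:
  assumes g: "riemannian_metric A g" and "\<kappa> \<in> A" "x \<in> cimg \<kappa>"
  shows "det (coords_ten A \<kappa> g x) > 0"
proof -
  obtain p where p: "p \<in> cdom \<kappa>" "x = cmap \<kappa> p" using assms(3) by blast
  let ?J = "jac \<kappa> (chart_at A p) p"
  have "det ?J \<noteq> 0" using det_jac_nonzero assms(2) p chart_at by blast
  moreover have "det (g p) > 0" by (rule positive_definite_det_pos) (rule metricD(3)[OF g])
  moreover have "det (coords_ten A \<kappa> g x) = (det ?J)\<^sup>2 * det (g p)"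
    using assms(2) p by (simp add: coords_ten_eq det_mul power2_eq_square)
  ultimately show ?thesis by simp
qed

lemma smooth_coords_vec: "vector_field A X \<Longrightarrow> \<kappa> \<in> A \<Longrightarrow> smooth_on (cimg \<kappa>) (coords_vec A \<kappa> X)"
  by (simp add: vector_field_def)

lemma differentiable_coords_vec:
  "vector_field A X \<Longrightarrow> \<kappa> \<in> A \<Longrightarrow> x \<in> cimg \<kappa> \<Longrightarrow> coords_vec A \<kappa> X differentiable (at x)"
  using smooth_on_differentiable[OF smooth_coords_vec] by blast

lemma differentiable_coords_ten:
  "sym_tensor A h \<Longrightarrow> \<kappa> \<in> A \<Longrightarrow> x \<in> cimg \<kappa> \<Longrightarrow> coords_ten A \<kappa> h differentiable (at x)"
  using smooth_on_differentiable[OF sym_tensorD(1)] by blast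

lemma lie_mat_chart_change:
  assumes X: "vector_field A X" and h: "sym_tensor A h"
    and "\<kappa> \<in> A" "\<tau> \<in> A" "p \<in> cdom \<kappa>" "p \<in> cdom \<tau>"
  shows "lie_mat (coords_ten A \<kappa> h) (coords_vec A \<kappa> X) (cmap \<kappa> p) =
    transpose (jac \<kappa> \<tau> p) ** lie_mat (coords_ten A \<tau> h) (coords_vec A \<tau> X) (cmap \<tau> p) ** jac \<kappa> \<tau> p"
proof -
  have t: "transition \<kappa> \<tau> (cmap \<kappa> p) = cmap \<tau> p"
    using assms by (simp add: transition_def cinv_cmap)
  have "lie_mat (coords_ten A \<kappa> h) (coords_vec A \<kappa> X) (cmap \<kappa> p) =
    transpose (jacobian (transition \<kappa> \<tau>) (at (cmap \<kappa> p))) **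
      lie_mat (coords_ten A \<tau> h) (coords_vec A \<tau> X) (transition \<kappa> \<tau> (cmap \<kappa> p)) **
      jacobian (transition \<kappa> \<tau>) (at (cmap \<kappa> p))"
  proof (rule lie_mat_change[where U = "overlap \<kappa> \<tau>"])
    fix y assume y: "y \<in> overlap \<kappa> \<tau>"
    have y': "cmap \<kappa> (cinv \<kappa> y) = y" using cmap_cinv[OF overlapD(1)[OF assms(3) y]] .
    note d = overlapD[OF assms(3) y]
    show "coords_ten A \<kappa> h y = transpose (jacobian (transition \<kappa> \<tau>) (at y)) ** coords_ten A \<tau> h (transition \<kappa> \<tau> y)
        ** jacobian (transition \<kappa> \<tau>) (at y)"
      using coords_ten_change[OF assms(3,4) d(2,3), of h] by (simp add: y' jac_def d(4))
    show "coords_vec A \<tau> X (transition \<kappa> \<tau> y) = jacobian (transition \<kappa> \<tau>) (at y) *v coords_vec A \<kappa> X y"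
      using coords_vec_change[OF assms(3,4) d(2,3), of X] by (simp add: y' jac_def d(4))
  next
    show "coords_ten A \<tau> h differentiable at (transition \<kappa> \<tau> (cmap \<kappa> p))"
      unfolding t using differentiable_coords_ten[OF h assms(4)] assms(6) by simp
    show "coords_vec A \<tau> X differentiable at (transition \<kappa> \<tau> (cmap \<kappa> p))"
      unfolding t using differentiable_coords_vec[OF X assms(4)] assms(6) by simp
    show "coords_vec A \<kappa> X differentiable at (cmap \<kappa> p)"
      using differentiable_coords_vec[OF X assms(3)] assms(5) by simp
  qed (use assms in \<open>auto intro: open_overlap overlapI smooth_transition\<close>)
  then show ?thesis by (simp add: jac_def t)
qed

lemma lie_ten_eq:
  assumes X: "vector_field A X" and h: "sym_tensor A h"
  shows "lie_ten A X h p = lie_mat (coords_ten A (chart_at A p) h) (coords_vec A (chart_at A p) X) (cmap (chart_at A p) p)"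
  by (simp add: lie_ten_def Let_def vec_eq_iff
      lie_mat_component[OF differentiable_coords_ten[OF h chart_at(1) cmap_in_cimg[OF chart_at(2)]]])

lemma coords_lie_ten:
  assumes X: "vector_field A X" and h: "sym_tensor A h" and \<kappa>: "\<kappa> \<in> A" "x \<in> cimg \<kappa>"
  shows "coords_ten A \<kappa> (lie_ten A X h) x = lie_mat (coords_ten A \<kappa> h) (coords_vec A \<kappa> X) x"
proof -
  define p where "p = cinv \<kappa> x"
  have p: "p \<in> cdom \<kappa>" "x = cmap \<kappa> p" using \<kappa> by (simp_all add: p_def cinv_in_cdom cmap_cinv)
  show ?thesis
    unfolding p(2) coords_ten_eq[OF \<kappa>(1) p(1)] lie_ten_eq[OF X h]
    by (rule lie_mat_chart_change[OF X h \<kappa>(1) chart_at(1) p(1) chart_at(2), symmetric])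
qed

lemma smooth_lie_mat:
  assumes "open U" "smooth_on U G" "smooth_on U Y"
  shows "smooth_on U (lie_mat G Y)"
proof -
  have "smooth_on U (\<lambda>x. \<Sum>k\<in>UNIV. Y x $ k *\<^sub>R pd k G x)"
    by (intro smooth_on_sum smooth_on_scaleR smooth_on_nth smooth_on_pd assms)
  then have "smooth_on U (\<lambda>x. frechet_derivative G (at x) (Y x))"
    by (rule smooth_on_cong[OF assms(1)])
      (simp add: frechet_derivative_expand[OF smooth_on_differentiable[OF assms(2)]])
  then show ?thesis unfolding lie_mat_def[abs_def]
    by (intro smooth_on_add smooth_on_matrix_mult smooth_on_transpose smooth_on_jacobian assms)
qed

lemma sym_tensor_lie_ten:
  assumes X: "vector_field A X" and h: "sym_tensor A h"
  shows "sym_tensor A (lie_ten A X h)"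
proof -
  have "smooth_on (cimg \<kappa>) (coords_ten A \<kappa> (lie_ten A X h))" if "\<kappa> \<in> A" for \<kappa>
    by (rule smooth_on_cong[OF open_cimg[OF that] smooth_lie_mat[OF open_cimg[OF that] sym_tensorD(1)[OF h that] smooth_coords_vec[OF X that]]])
      (rule coords_lie_ten[OF X h that, symmetric])
  moreover have "transpose (lie_ten A X h p) = lie_ten A X h p" for p
  proof -
    let ?\<tau> = "chart_at A p" let ?H = "coords_ten A ?\<tau> h" let ?x = "cmap ?\<tau> p"
    have d: "?H differentiable (at ?x)" by (rule differentiable_coords_ten[OF h chart_at(1)]) (simp add: chart_at)
    have sym: "transpose (?H y) = ?H y" for y by (rule coords_ten_sym) (rule sym_tensorD(2)[OF h])
    have "transpose (frechet_derivative ?H (at ?x) v) = frechet_derivative (\<lambda>y. transpose (?H y)) (at ?x) v" for v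
      by (rule frechet_derivative_bounded_linear_compose[OF bounded_linear_transpose d, symmetric])
    then have "transpose (frechet_derivative ?H (at ?x) v) = frechet_derivative ?H (at ?x) v" for v
      by (simp add: sym)
    then show ?thesis
      unfolding lie_ten_eq[OF X h] lie_mat_def
      by (simp add: linear_simps(1)[OF bounded_linear_transpose] matrix_transpose_mul sym add.commute add.left_commute)
  qed
  ultimately show ?thesis by (simp add: sym_tensor_def)
qed

text \<open>The divergence becomes the trace of a tensor, and so may be computed in any chart.\<close>

lemma divergence_eq_trace:
  assumes g: "riemannian_metric A g" and X: "vector_field A X" and \<kappa>: "\<kappa> \<in> A" "p \<in> cdom \<kappa>"
  shows "divergence A g X p =
    1/2 * trace (matrix_inv (coords_ten A \<kappa> g (cmap \<kappa> p)) ** lie_mat (coords_ten A \<kappa> g) (coords_vec A \<kappa> X) (cmap \<kappa> p))"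
proof -
  let ?\<tau> = "chart_at A p"
  note \<tau> = chart_at[of p]
  have "divergence A g X p =
     1/2 * trace (matrix_inv (coords_ten A ?\<tau> g (cmap ?\<tau> p)) ** lie_mat (coords_ten A ?\<tau> g) (coords_vec A ?\<tau> X) (cmap ?\<tau> p))"
    unfolding divergence_def Let_def
  proof (rule sum_cov_deriv[OF open_cimg[OF \<tau>(1)]])
    show x: "cmap ?\<tau> p \<in> cimg ?\<tau>" using \<tau> by simp
    show "transpose (coords_ten A ?\<tau> g y) = coords_ten A ?\<tau> g y" for y
      by (rule coords_ten_sym) (rule metricD(2)[OF g])
    show "coords_ten A ?\<tau> g differentiable (at (cmap ?\<tau> p))"
      by (rule differentiable_coords_ten[OF metricD(1)[OF g] \<tau>(1) x])
    show "det (coords_ten A ?\<tau> g (cmap ?\<tau> p)) \<noteq> 0" using coords_metric_det_pos[OF g \<tau>(1) x] by simp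
  qed
  also have "trace (matrix_inv (coords_ten A ?\<tau> g (cmap ?\<tau> p)) ** lie_mat (coords_ten A ?\<tau> g) (coords_vec A ?\<tau> X) (cmap ?\<tau> p))
    = trace (matrix_inv (coords_ten A \<kappa> g (cmap \<kappa> p)) ** lie_mat (coords_ten A \<kappa> g) (coords_vec A \<kappa> X) (cmap \<kappa> p))"
  proof -
    have "det (coords_ten A \<kappa> g (cmap \<kappa> p)) \<noteq> 0" using coords_metric_det_pos[OF g \<kappa>(1), of "cmap \<kappa> p"] \<kappa>(2) by simp
    then show ?thesis
      unfolding coords_ten_change[OF \<tau>(1) \<kappa>(1) \<tau>(2) \<kappa>(2), of g] lie_mat_chart_change[OF X metricD(1)[OF g] \<tau>(1) \<kappa>(1) \<tau>(2) \<kappa>(2)]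
      by (intro trace_congruence det_jac_nonzero \<tau> \<kappa>)
  qed
  finally show ?thesis .
qed

lemma smooth_divergence:
  assumes g: "riemannian_metric A g" and X: "vector_field A X"
  shows "smooth_fun A (divergence A g X)"
proof (rule smooth_funI)
  fix \<kappa> assume \<kappa>: "\<kappa> \<in> A"
  note U = open_cimg[OF \<kappa>]
  have G: "smooth_on (cimg \<kappa>) (coords_ten A \<kappa> g)" by (rule sym_tensorD(1)[OF metricD(1)[OF g] \<kappa>])
  have "smooth_on (cimg \<kappa>) (\<lambda>x. matrix_inv (coords_ten A \<kappa> g x) ** lie_mat (coords_ten A \<kappa> g) (coords_vec A \<kappa> X) x)"
  proof (intro smooth_on_matrix_mult smooth_on_matrix_inv U G)
    show "det (coords_ten A \<kappa> g x) \<noteq> 0" if "x \<in> cimg \<kappa>" for x using coords_metric_det_pos[OF g \<kappa> that] by simp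
    show "smooth_on (cimg \<kappa>) (lie_mat (coords_ten A \<kappa> g) (coords_vec A \<kappa> X))"
      by (rule smooth_lie_mat[OF U G smooth_coords_vec[OF X \<kappa>]])
  qed
  then have "smooth_on (cimg \<kappa>) (\<lambda>x. 1/2 * trace (matrix_inv (coords_ten A \<kappa> g x) ** lie_mat (coords_ten A \<kappa> g) (coords_vec A \<kappa> X) x))"
    unfolding trace_def by (intro smooth_on_mult smooth_on_const smooth_on_sum smooth_on_entry U)
  then show "smooth_on (cimg \<kappa>) (\<lambda>x. divergence A g X (cinv \<kappa> x))"
  proof (rule smooth_on_cong[OF U])
    fix x assume x: "x \<in> cimg \<kappa>"
    show "1/2 * trace (matrix_inv (coords_ten A \<kappa> g x) ** lie_mat (coords_ten A \<kappa> g) (coords_vec A \<kappa> X) x) = divergence A g X (cinv \<kappa> x)"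
      using divergence_eq_trace[OF g X \<kappa> cinv_in_cdom[OF x]] by (simp add: cmap_cinv[OF x])
  qed
qed

subsection \<open>Linearity in the vector field\<close>

lemma coords_vec_scaled: "coords_vec A \<kappa> (\<lambda>p. f p *\<^sub>R X p) x = f (cinv \<kappa> x) *\<^sub>R coords_vec A \<kappa> X x"
  by (simp add: coords_vec_def Let_def matrix_vector_mult_scaleR)

lemma coords_vec_sum:
  "coords_vec A \<kappa> (\<lambda>p. \<Sum>i\<in>I. X i p) x = (\<Sum>i\<in>I. coords_vec A \<kappa> (X i) x)"
  by (simp add: coords_vec_def Let_def linear_sum[OF matrix_vector_mul_linear])

lemma vector_field_scaled:
  assumes "smooth_fun A f" "vector_field A X"
  shows "vector_field A (\<lambda>p. f p *\<^sub>R X p)"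
  unfolding vector_field_def
proof
  fix \<kappa> assume \<kappa>: "\<kappa> \<in> A"
  have "smooth_on (cimg \<kappa>) (\<lambda>x. f (cinv \<kappa> x) *\<^sub>R coords_vec A \<kappa> X x)"
    by (intro smooth_on_scaleR open_cimg smooth_funD smooth_coords_vec assms \<kappa>)
  then show "smooth_on (cimg \<kappa>) (coords_vec A \<kappa> (\<lambda>p. f p *\<^sub>R X p))"
    by (simp add: coords_vec_scaled[abs_def])
qed

lemma lie_mat_sum:
  assumes Y: "\<And>i. i \<in> I \<Longrightarrow> Y i differentiable (at x)" and I: "finite I" and G: "G differentiable (at x)"
  shows "lie_mat G (\<lambda>y. \<Sum>i\<in>I. Y i y) x = (\<Sum>i\<in>I. lie_mat G (Y i) x)"
proof -
  have "((\<lambda>y. \<Sum>i\<in>I. Y i y) has_derivative (\<lambda>v. \<Sum>i\<in>I. jacobian (Y i) (at x) *v v)) (at x)"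
    by (rule has_derivative_sum) (use Y jacobian_works in blast)
  moreover have "(\<lambda>v. \<Sum>i\<in>I. jacobian (Y i) (at x) *v v) = (*v) (\<Sum>i\<in>I. jacobian (Y i) (at x))"
    by (simp add: fun_eq_iff bounded_bilinear.sum_left[OF bounded_bilinear_matrix_vector_mult])
  ultimately have J: "jacobian (\<lambda>y. \<Sum>i\<in>I. Y i y) (at x) = (\<Sum>i\<in>I. jacobian (Y i) (at x))"
    by (intro jacobian_eqI) simp
  show ?thesis
    unfolding lie_mat_def J
    by (simp add: sum.distrib linear_sum[OF linear_frechet_derivative[OF G]]
        linear_sum[OF bounded_linear.linear[OF bounded_linear_transpose]]
        bounded_bilinear.sum_left[OF bounded_bilinear_matrix_mult] bounded_bilinear.sum_right[OF bounded_bilinear_matrix_mult])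
qed

lemma lie_ten_sum:
  assumes X: "\<And>i. i \<in> I \<Longrightarrow> vector_field A (X i)" and I: "finite I" and h: "sym_tensor A h"
    and sum: "vector_field A (\<lambda>p. \<Sum>i\<in>I. X i p)"
  shows "lie_ten A (\<lambda>p. \<Sum>i\<in>I. X i p) h p = (\<Sum>i\<in>I. lie_ten A (X i) h p)"
proof -
  have x: "cmap (chart_at A p) p \<in> cimg (chart_at A p)" using chart_at by simp
  show ?thesis
    unfolding lie_ten_eq[OF sum h] coords_vec_sum[abs_def]
    using lie_mat_sum[OF differentiable_coords_vec[OF X chart_at(1) x] I differentiable_coords_ten[OF h chart_at(1) x]]
    by (simp add: lie_ten_eq[OF X h])
qed

lemma divergence_lie_ten:
  assumes g: "riemannian_metric A g" and X: "vector_field A X"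
  shows "divergence A g X p = 1/2 * trace (matrix_inv (g p) ** lie_ten A X g p)"
  using divergence_eq_trace[OF g X chart_at(1) chart_at(2), of p]
  by (simp add: lie_ten_eq[OF X metricD(1)[OF g]] coords_ten_chart_at)

lemma divergence_sum:
  assumes g: "riemannian_metric A g" and X: "\<And>i. i \<in> I \<Longrightarrow> vector_field A (X i)" and I: "finite I"
    and sum: "vector_field A (\<lambda>p. \<Sum>i\<in>I. X i p)"
  shows "divergence A g (\<lambda>p. \<Sum>i\<in>I. X i p) p = (\<Sum>i\<in>I. divergence A g (X i) p)"
proof -
  have tr: "trace (\<Sum>i\<in>I. M i) = (\<Sum>i\<in>I. trace (M i))" for M :: "_ \<Rightarrow> real^'n^'n"
    unfolding trace_def by (subst sum.swap) simp
  show ?thesis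
    by (simp add: divergence_lie_ten[OF g sum] divergence_lie_ten[OF g X] lie_ten_sum[OF X I metricD(1)[OF g] sum]
       bounded_bilinear.sum_right[OF bounded_bilinear_matrix_mult] tr sum_divide_distrib)
qed

text \<open>The Christoffel terms carry no derivative of the vector field, so only the product rule matters.\<close>

lemma divergence_scaled:
  assumes f: "smooth_fun A f" and X: "vector_field A X"
  shows "divergence A g (\<lambda>p. f p *\<^sub>R X p) p = f p * divergence A g X p + lie_fun A X f p"
proof -
  let ?\<tau> = "chart_at A p"
  let ?x = "cmap ?\<tau> p" and ?Y = "coords_vec A ?\<tau> X" and ?f = "\<lambda>x. f (cinv ?\<tau> x)" and ?G = "coords_ten A ?\<tau> g"
  have x: "?x \<in> cimg ?\<tau>" and fx: "?f ?x = f p" using chart_at cinv_cmap by auto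
  have df: "?f differentiable (at ?x)" by (rule smooth_on_differentiable[OF smooth_funD[OF f chart_at(1)] x])
  have dY: "?Y differentiable (at ?x)" by (rule differentiable_coords_vec[OF X chart_at(1) x])
  have pd: "pd a (\<lambda>x. ?f x *\<^sub>R ?Y x) ?x = f p *\<^sub>R pd a ?Y ?x + pd a ?f ?x *\<^sub>R ?Y ?x" for a
    unfolding pd_def using frechet_derivative_eq[OF has_derivative_scaleR[OF
       frechet_derivative_works[THEN iffD1, OF df] frechet_derivative_works[THEN iffD1, OF dY]]] fx by simp
  have "cov_deriv ?G (\<lambda>x. ?f x *\<^sub>R ?Y x) ?x a a = f p * cov_deriv ?G ?Y ?x a a + ?Y ?x $ a * pd a ?f ?x" for a
    by (simp add: cov_deriv_def pd fx sum_distrib_left algebra_simps)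
  then show ?thesis
    by (simp add: divergence_def lie_fun_def Let_def coords_vec_scaled[abs_def] sum.distrib sum_distrib_left comp_def)
qed

end

section \<open>Invariance under conformal vector fields\<close>

lemma jacobian_cong:
  fixes f :: "real^'n::finite \<Rightarrow> real^'m::finite"
  assumes "open U" "x \<in> U" "f differentiable (at x)" "\<And>y. y \<in> U \<Longrightarrow> f y = g y"
  shows "jacobian f (at x) = jacobian g (at x)"
  unfolding jacobian_def using frechet_derivative_transform_within_open[OF assms(3,1,2,4)] by simp

lemma lie_mat_cong:
  assumes "open U" "x \<in> U" "Y differentiable (at x)" "\<And>y. y \<in> U \<Longrightarrow> Y y = Z y"
  shows "lie_mat G Y x = lie_mat G Z x"
  unfolding lie_mat_def using jacobian_cong[OF assms] assms(4)[OF assms(2)] by simp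

lemma lie_mat_zero:
  fixes G :: "real^'n::finite \<Rightarrow> real^'n^'n"
  assumes "open U" "x \<in> U" "G differentiable (at x)" "\<And>y. y \<in> U \<Longrightarrow> Y y = 0"
  shows "lie_mat G Y x = 0"
proof -
  have "(*v) (0::real^'n^'n) = (\<lambda>v. 0)" by (simp add: fun_eq_iff)
  then have z: "((\<lambda>y::real^'n. 0::real^'n) has_derivative (*v) (0::real^'n^'n)) (at x)" by simp
  have "jacobian (\<lambda>y::real^'n. 0::real^'n) (at x) = 0" by (rule jacobian_eqI[OF z])
  then have "lie_mat G (\<lambda>y. 0) x = 0"
    using linear_0[OF linear_frechet_derivative[OF assms(3)]]
    by (simp add: lie_mat_def matrix_matrix_mult_def transpose_def vec_eq_iff)
  then show ?thesis
    using lie_mat_cong[of U x "\<lambda>y. 0" Y G] assms by simp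
qed

text \<open>The metric pulled back along \<open>x \<mapsto> x + t Y(x)\<close>; its velocity is the Lie derivative.\<close>

lemma pullback_curve_derivative:
  fixes G :: "real^'n::finite \<Rightarrow> real^'n^'n"
  assumes G: "G differentiable (at x)"
  shows "((\<lambda>t. transpose (mat 1 + t *\<^sub>R jacobian Y (at x)) ** G (x + t *\<^sub>R Y x) ** (mat 1 + t *\<^sub>R jacobian Y (at x)))
    has_vector_derivative lie_mat G Y x) (at 0)"
proof -
  let ?J = "jacobian Y (at x)"
  have J: "((\<lambda>t. mat 1 + t *\<^sub>R ?J) has_vector_derivative ?J) (at 0)"
    by (auto intro!: derivative_eq_intros simp: has_vector_derivative_def)
  have l: "linear (frechet_derivative G (at x))" by (rule linear_frechet_derivative[OF G])
  have "((\<lambda>t. G (x + t *\<^sub>R Y x)) has_derivative (\<lambda>r. frechet_derivative G (at x) (r *\<^sub>R Y x))) (at 0)"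
  proof (rule has_derivative_compose[of "\<lambda>t. x + t *\<^sub>R Y x" "\<lambda>r. r *\<^sub>R Y x"])
    show "((\<lambda>t. x + t *\<^sub>R Y x) has_derivative (\<lambda>r. r *\<^sub>R Y x)) (at 0)"
      by (auto intro!: derivative_eq_intros)
    show "(G has_derivative frechet_derivative G (at x)) (at (x + 0 *\<^sub>R Y x))"
      using G by (simp add: frechet_derivative_works)
  qed
  then have G': "((\<lambda>t. G (x + t *\<^sub>R Y x)) has_vector_derivative frechet_derivative G (at x) (Y x)) (at 0)"
    by (simp add: has_vector_derivative_def linear_cmul[OF l])
  have "((\<lambda>t. transpose (mat 1 + t *\<^sub>R ?J) ** G (x + t *\<^sub>R Y x) ** (mat 1 + t *\<^sub>R ?J)) has_vector_derivative
     transpose (mat 1 + 0 *\<^sub>R ?J) ** G (x + 0 *\<^sub>R Y x) ** ?J +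
     (transpose (mat 1 + 0 *\<^sub>R ?J) ** frechet_derivative G (at x) (Y x) + transpose ?J ** G (x + 0 *\<^sub>R Y x)) ** (mat 1 + 0 *\<^sub>R ?J)) (at 0)"
    by (intro bounded_bilinear.has_vector_derivative[OF bounded_bilinear_matrix_mult]
        bounded_linear.has_vector_derivative[OF bounded_linear_transpose] J G')
  then show ?thesis by (simp add: lie_mat_def transpose_mat add_ac)
qed

context smooth_manifold
begin

lemma lie_ten_zero:
  assumes X: "vector_field A X" and h: "sym_tensor A h" and W: "open W" "p \<in> W" "\<And>r. r \<in> W \<Longrightarrow> X r = 0"
  shows "lie_ten A X h p = 0"
proof -
  let ?\<sigma> = "chart_at A p" let ?V = "cdom (chart_at A p) \<inter> W"
  have V: "open ?V" by (intro open_Int open_cdom chart_at W)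
  show ?thesis
    unfolding lie_ten_eq[OF X h]
  proof (rule lie_mat_zero)
    show "open (cmap ?\<sigma> ` ?V)" by (rule open_cmap_image[OF chart_at(1) V]) simp
    show "cmap ?\<sigma> p \<in> cmap ?\<sigma> ` ?V" by (rule imageI) (simp add: W(2) chart_at(2))
    show "coords_ten A ?\<sigma> h differentiable (at (cmap ?\<sigma> p))"
      by (rule differentiable_coords_ten[OF h chart_at(1) cmap_in_cimg[OF chart_at(2)]])
    fix y assume "y \<in> cmap ?\<sigma> ` ?V"
    then obtain r where r: "r \<in> ?V" "y = cmap ?\<sigma> r" by (rule imageE)
    then show "coords_vec A ?\<sigma> X y = 0" using W(3) by (simp add: coords_vec_eq[OF chart_at(1)])
  qed
qed

lemma pullback_eq_self:
  assumes W: "open W" "q \<in> W" "\<And>r. r \<in> W \<Longrightarrow> \<phi> r = r"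
  shows "pullback A \<phi> h q = h q"
proof -
  let ?\<sigma> = "chart_at A q"
  have q: "\<phi> q = q" using W by blast
  have "jacobian (cmap ?\<sigma> \<circ> \<phi> \<circ> cinv ?\<sigma>) (at (cmap ?\<sigma> q)) = mat 1"
  proof (rule jacobian_ident)
    show "open (cmap ?\<sigma> ` (cdom ?\<sigma> \<inter> W))"
      by (intro open_cmap_image open_Int open_cdom chart_at W) auto
    show "cmap ?\<sigma> q \<in> cmap ?\<sigma> ` (cdom ?\<sigma> \<inter> W)" using chart_at W by blast
    fix y assume "y \<in> cmap ?\<sigma> ` (cdom ?\<sigma> \<inter> W)"
    then obtain r where "r \<in> cdom ?\<sigma>" "r \<in> W" "y = cmap ?\<sigma> r" by blast
    then show "(cmap ?\<sigma> \<circ> \<phi> \<circ> cinv ?\<sigma>) y = y" using W(3) cinv_cmap[OF chart_at(1)] by simp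
  qed
  then show ?thesis by (simp add: pullback_def Let_def q transpose_mat)
qed

text \<open>The diffeomorphisms \<open>x \<mapsto> x + t Y(x)\<close> of the chart image are extended by the identity. The
  pullbacks \<open>\<gamma> t\<close> of \<open>g\<close> form a smooth curve with velocity \<open>\<L>\<^sub>X g\<close>, along which \<open>S\<close> is constant.\<close>

lemma lie_derivative_in_kernel_local:
  assumes S: "riemannian_functional A S" and g: "riemannian_metric A g" and D: "has_functional_derivative A S g D"
    and X: "vector_field A X" and \<kappa>: "\<kappa> \<in> A" and K: "compact K" "K \<subseteq> cimg \<kappa>"
    and supp: "\<And>p. p \<notin> cinv \<kappa> ` K \<Longrightarrow> X p = 0"
  shows "D (lie_ten A X g) = 0"
proof -
  note gs = metricD(1)[OF g]
  let ?U = "cimg \<kappa>"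
  have U: "open ?U" by (rule open_cimg[OF \<kappa>])
  define G where "G = coords_ten A \<kappa> g"
  have G: "smooth_on ?U G" unfolding G_def by (rule sym_tensorD(1)[OF gs \<kappa>])
  define Y where "Y x = (if x \<in> ?U then coords_vec A \<kappa> X x else 0)" for x
  have Y0: "Y x = 0" if "x \<notin> K" for x
    using coords_vec_outside_support[OF K(2) supp] that by (simp add: Y_def)
  have Y: "smooth_on UNIV Y"
    unfolding Y_def[abs_def]
    by (rule smooth_on_extend_by_zero[OF U smooth_coords_vec[OF X \<kappa>] K coords_vec_outside_support[OF K(2) supp]])
  have YU: "smooth_on ?U Y" by (rule smooth_on_subset[OF Y]) simp
  obtain \<epsilon> where \<epsilon>: "\<epsilon> > 0" "\<And>t. \<bar>t\<bar> < \<epsilon> \<Longrightarrow> bij (\<lambda>x. x + t *\<^sub>R Y x)"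
    "\<And>t. \<bar>t\<bar> < \<epsilon> \<Longrightarrow> smooth_on UNIV (inv (\<lambda>x. x + t *\<^sub>R Y x))"
    using near_identity_diffeomorphism[OF Y K(1) Y0] by blast
  define \<Psi> where "\<Psi> t x = x + t *\<^sub>R Y x" for t x
  have \<Psi>: "smooth_on UNIV (\<Psi> t)" for t
    unfolding \<Psi>_def[abs_def] by (intro smooth_on_add smooth_on_scaleR smooth_on_const smooth_on_ident Y open_UNIV)
  have \<Psi>K: "\<Psi> t x = x" if "x \<notin> K" for t x using Y0[OF that] by (simp add: \<Psi>_def)
  have \<Psi>bij: "bij (\<Psi> t)" "smooth_on UNIV (inv (\<Psi> t))" if "\<bar>t\<bar> < \<epsilon>" for t
    using \<epsilon>(2,3)[OF that] by (simp_all add: \<Psi>_def[abs_def])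
  have \<Psi>U: "\<Psi> t x \<in> ?U" if "\<bar>t\<bar> < \<epsilon>" "x \<in> ?U" for t x
    by (rule bij_preserves_support[OF \<Psi>bij(1)[OF that(1)] \<Psi>K K(2) that(2)])
  define \<phi> where "\<phi> t = chart_transfer \<kappa> (\<Psi> t)" for t
  have \<phi>: "diffeo A (\<phi> t)" if "\<bar>t\<bar> < \<epsilon>" for t
    unfolding \<phi>_def by (rule diffeo_chart_transfer[OF \<kappa> K \<Psi> \<Psi>K \<Psi>bij[OF that]])
  define W where "W = - cinv \<kappa> ` K"
  have W: "open W" unfolding W_def by (rule open_compl_cinv_image[OF \<kappa> K])
  have WI: "p \<in> W" if "p \<notin> cdom \<kappa>" for p
    unfolding W_def using outside_chart_outside_support[OF K(2) that] by simp
  have \<phi>W: "\<phi> t p = p" if "p \<in> W" for t p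
    unfolding \<phi>_def using that by (intro chart_transfer_outside[OF \<kappa> \<Psi>K]) (simp_all add: W_def)
  define \<gamma> where "\<gamma> t = pullback A (\<phi> t) g" for t
  have \<gamma>W: "\<gamma> t p = g p" if "p \<in> W" for t p
    unfolding \<gamma>_def by (rule pullback_eq_self[OF W that \<phi>W])
  \<comment> \<open>The components of \<open>\<gamma> t\<close> in the chart \<open>\<kappa>\<close>.\<close>
  define M where "M t x = transpose (mat 1 + t *\<^sub>R jacobian Y (at x)) ** G (x + t *\<^sub>R Y x) ** (mat 1 + t *\<^sub>R jacobian Y (at x))" for t x
  have \<gamma>M: "coords_ten A \<kappa> (\<gamma> t) (cmap \<kappa> p) = M t (cmap \<kappa> p)" if t: "\<bar>t\<bar> < \<epsilon>" and p: "p \<in> cdom \<kappa>" for t p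
  proof -
    let ?x = "cmap \<kappa> p"
    have x: "?x \<in> ?U" using p by simp
    have \<phi>p: "\<phi> t p = cinv \<kappa> (\<Psi> t ?x)" using p by (simp add: \<phi>_def chart_transfer_def)
    have in\<kappa>: "\<phi> t p \<in> cdom \<kappa>" unfolding \<phi>p by (rule cinv_in_cdom[OF \<Psi>U[OF t x]])
    have "jacobian (\<Psi> t) (at ?x) = jacobian (cmap \<kappa> \<circ> \<phi> t \<circ> cinv \<kappa>) (at ?x)"
    proof (rule jacobian_cong[OF U x])
      show "\<Psi> t differentiable (at ?x)" by (rule smooth_on_differentiable[OF \<Psi>]) simp
      fix y assume y: "y \<in> ?U"
      show "\<Psi> t y = (cmap \<kappa> \<circ> \<phi> t \<circ> cinv \<kappa>) y"
        by (simp add: \<phi>_def chart_transfer_def cinv_in_cdom[OF y] cmap_cinv[OF y] cmap_cinv[OF \<Psi>U[OF t y]])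
    qed
    moreover have "jacobian (\<Psi> t) (at ?x) = mat 1 + t *\<^sub>R jacobian Y (at ?x)"
    proof (rule jacobian_eqI)
      have dY: "Y differentiable (at ?x)" by (rule smooth_on_differentiable[OF Y]) simp
      have "((\<lambda>x. x + t *\<^sub>R Y x) has_derivative (\<lambda>v. v + t *\<^sub>R (jacobian Y (at ?x) *v v))) (at ?x)"
        by (intro has_derivative_add has_derivative_ident has_derivative_scaleR_right jacobian_works[THEN iffD1, OF dY])
      moreover have "(\<lambda>v. v + t *\<^sub>R (jacobian Y (at ?x) *v v)) = (*v) (mat 1 + t *\<^sub>R jacobian Y (at ?x))"
        by (simp add: fun_eq_iff matrix_vector_mult_add_rdistrib scaleR_matrix_vector_assoc)
      ultimately show "(\<Psi> t has_derivative (*v) (mat 1 + t *\<^sub>R jacobian Y (at ?x))) (at ?x)"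
        by (simp add: \<Psi>_def[abs_def])
    qed
    ultimately have J: "jacobian (cmap \<kappa> \<circ> \<phi> t \<circ> cinv \<kappa>) (at ?x) = mat 1 + t *\<^sub>R jacobian Y (at ?x)" by simp
    have "cmap \<kappa> (\<phi> t p) = ?x + t *\<^sub>R Y ?x"
      unfolding \<phi>p cmap_cinv[OF \<Psi>U[OF t x]] by (simp add: \<Psi>_def)
    then show ?thesis
      using coords_ten_pullback[where \<phi> = "\<phi> t", OF _ \<kappa> \<kappa> p in\<kappa>, of g] \<phi>[OF t] J
      by (simp add: \<gamma>_def M_def G_def diffeo_def)
  qed
  have M_deriv: "((\<lambda>t. M t x) has_vector_derivative lie_mat G (coords_vec A \<kappa> X) x) (at 0)" if x: "x \<in> ?U" for x
  proof -
    have "lie_mat G Y x = lie_mat G (coords_vec A \<kappa> X) x"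
      by (rule lie_mat_cong[OF U x smooth_on_differentiable[OF Y]]) (simp_all add: Y_def)
    then show ?thesis
      unfolding M_def using pullback_curve_derivative[OF smooth_on_differentiable[OF G x], of Y] by simp
  qed
  have curve: "smooth_curve \<epsilon> \<gamma>"
  proof (rule smooth_curve_local)
    fix p
    let ?I = "{-\<epsilon><..<\<epsilon>}"
    show "\<exists>\<tau> V. \<tau> \<in> A \<and> open V \<and> p \<in> V \<and> V \<subseteq> cdom \<tau> \<and>
        smooth_on (?I \<times> cmap \<tau> ` V) (\<lambda>z. coords_ten A \<tau> (\<gamma> (fst z)) (snd z))"
    proof (cases "p \<in> cdom \<kappa>")
      case True
      have IU: "open (?I \<times> ?U)" by (intro open_Times U open_greaterThanLessThan)
      have J: "smooth_on (?I \<times> ?U) (\<lambda>z. mat 1 + fst z *\<^sub>R jacobian Y (at (snd z)))"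
        by (intro smooth_on_add smooth_on_const smooth_on_scaleR smooth_on_linear[OF bounded_linear_fst] IU
            smooth_on_snd[OF open_greaterThanLessThan U] smooth_on_jacobian U YU)
      have "smooth_on (?I \<times> ?U) (\<lambda>z. snd z + fst z *\<^sub>R Y (snd z))"
        by (intro smooth_on_add smooth_on_scaleR smooth_on_linear[OF bounded_linear_fst] smooth_on_linear[OF bounded_linear_snd] IU
            smooth_on_snd[OF open_greaterThanLessThan U] U YU)
      then have "smooth_on (?I \<times> ?U) (\<lambda>z. G (snd z + fst z *\<^sub>R Y (snd z)))"
        by (rule smooth_on_compose[OF IU U G]) (use \<Psi>U in \<open>auto simp: \<Psi>_def\<close>)
      then have "smooth_on (?I \<times> ?U) (\<lambda>z. M (fst z) (snd z))"
        unfolding M_def by (intro smooth_on_matrix_mult smooth_on_transpose J IU)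
      then have "smooth_on (?I \<times> ?U) (\<lambda>z. coords_ten A \<kappa> (\<gamma> (fst z)) (snd z))"
      proof (rule smooth_on_cong[OF IU])
        fix z :: "real \<times> (real^'n)" assume z: "z \<in> ?I \<times> ?U"
        then obtain q where "q \<in> cdom \<kappa>" "snd z = cmap \<kappa> q" by auto
        then show "M (fst z) (snd z) = coords_ten A \<kappa> (\<gamma> (fst z)) (snd z)"
          using \<gamma>M[of "fst z" q] z by auto
      qed
      then show ?thesis using True \<kappa> open_cdom[OF \<kappa>] by (intro exI[of _ \<kappa>] exI[of _ "cdom \<kappa>"] conjI) simp_all
    next
      case False
      let ?\<sigma> = "chart_at A p" let ?V = "cdom (chart_at A p) \<inter> W"
      have V: "open ?V" by (intro open_Int open_cdom chart_at W)
      have oV: "open (cmap ?\<sigma> ` ?V)" by (rule open_cmap_image[OF chart_at(1) V]) simp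
      have "smooth_on (?I \<times> cmap ?\<sigma> ` ?V) (\<lambda>z. coords_ten A ?\<sigma> g (snd z))"
        by (rule smooth_on_snd[OF open_greaterThanLessThan oV smooth_on_subset[OF sym_tensorD(1)[OF gs chart_at(1)]]]) auto
      then have "smooth_on (?I \<times> cmap ?\<sigma> ` ?V) (\<lambda>z. coords_ten A ?\<sigma> (\<gamma> (fst z)) (snd z))"
      proof (rule smooth_on_cong[OF open_Times[OF open_greaterThanLessThan oV]])
        fix z :: "real \<times> (real^'n)" assume "z \<in> ?I \<times> cmap ?\<sigma> ` ?V"
        then obtain q where q: "q \<in> cdom ?\<sigma>" "q \<in> W" "snd z = cmap ?\<sigma> q" by auto
        then show "coords_ten A ?\<sigma> g (snd z) = coords_ten A ?\<sigma> (\<gamma> (fst z)) (snd z)"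
          by (simp add: coords_ten_eq[OF chart_at(1)] \<gamma>W)
      qed
      then show ?thesis using V WI[OF False] chart_at[of p]
        by (intro exI[of _ ?\<sigma>] exI[of _ ?V] conjI) simp_all
    qed
  qed
  have \<gamma>0: "\<gamma> 0 = g"
  proof
    fix p
    have "\<phi> 0 q = q" for q
      by (cases "q \<in> cdom \<kappa>") (simp_all add: \<phi>_def chart_transfer_def \<Psi>_def cinv_cmap[OF \<kappa>])
    then show "\<gamma> 0 p = g p" unfolding \<gamma>_def by (intro pullback_eq_self[OF open_UNIV]) auto
  qed
  have \<gamma>sym: "transpose (\<gamma> t p) = \<gamma> t p" for t p
    by (simp add: \<gamma>_def pullback_def Let_def matrix_transpose_mul metricD(2)[OF g] matrix_mul_assoc)
  have deriv: "((\<lambda>t. \<gamma> t q) has_vector_derivative lie_ten A X g q) (at 0)" for q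
  proof (cases "q \<in> cdom \<kappa>")
    case True
    let ?\<sigma> = "chart_at A q"
    note \<sigma> = chart_at[of q]
    have x: "cmap \<kappa> q \<in> ?U" using True by simp
    have "((\<lambda>t. transpose (jac ?\<sigma> \<kappa> q) ** M t (cmap \<kappa> q) ** jac ?\<sigma> \<kappa> q) has_vector_derivative
        transpose (jac ?\<sigma> \<kappa> q) ** lie_mat G (coords_vec A \<kappa> X) (cmap \<kappa> q) ** jac ?\<sigma> \<kappa> q) (at 0)"
      by (rule bounded_linear.has_vector_derivative[OF bounded_linear_congruence M_deriv[OF x]])
    also have "transpose (jac ?\<sigma> \<kappa> q) ** lie_mat G (coords_vec A \<kappa> X) (cmap \<kappa> q) ** jac ?\<sigma> \<kappa> q = lie_ten A X g q"
      unfolding G_def lie_ten_eq[OF X gs] by (rule lie_mat_chart_change[OF X gs \<sigma>(1) \<kappa> \<sigma>(2) True, symmetric])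
    finally show ?thesis
    proof (rule has_vector_derivative_transform_within_open[of _ _ _ "{-\<epsilon><..<\<epsilon>}"])
      fix t assume "t \<in> {-\<epsilon><..<\<epsilon>}"
      then have "coords_ten A \<kappa> (\<gamma> t) (cmap \<kappa> q) = M t (cmap \<kappa> q)" using \<gamma>M[OF _ True] by auto
      then show "transpose (jac ?\<sigma> \<kappa> q) ** M t (cmap \<kappa> q) ** jac ?\<sigma> \<kappa> q = \<gamma> t q"
        using coords_ten_change[OF \<sigma>(1) \<kappa> \<sigma>(2) True, of "\<gamma> t"] by (simp add: coords_ten_chart_at)
    qed (use \<epsilon> in auto)
  next
    case False
    have "lie_ten A X g q = 0"
      by (rule lie_ten_zero[OF X gs W WI[OF False]]) (use supp in \<open>simp add: W_def\<close>)
    then show ?thesis by (simp add: \<gamma>W[OF WI[OF False]])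
  qed
  have "((\<lambda>t. S (\<gamma> t)) has_real_derivative D (lie_ten A X g)) (at 0)"
    by (rule functional_derivative_along_curve[OF D curve \<epsilon>(1) \<gamma>sym \<gamma>0 sym_tensor_lie_ten[OF X gs] deriv])
  moreover have "((\<lambda>t. S (\<gamma> t)) has_real_derivative 0) (at 0)"
  proof (rule has_field_derivative_transform_within_open[of "\<lambda>t. S g" _ _ "{-\<epsilon><..<\<epsilon>}"])
    fix t assume "t \<in> {-\<epsilon><..<\<epsilon>}"
    then have "diffeo A (\<phi> t)" using \<phi> by auto
    then show "S g = S (\<gamma> t)" using S g unfolding riemannian_functional_def \<gamma>_def by simp
  qed (use \<epsilon> in auto)
  ultimately show ?thesis by (rule DERIV_unique)
qed

end

locale closed_manifold = smooth_manifold A for A :: "('a::t2_space, 'n::finite) chart set" +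
  assumes compact_manifold: "compact (UNIV :: 'a set)"
begin

text \<open>Indexed by points: around each point take a bump function supported in a ball of the
  chart chosen there. By compactness finitely many of them have a positive sum everywhere.\<close>

lemma partition_of_unity:
  obtains P :: "'a set" and \<rho> :: "'a \<Rightarrow> 'a \<Rightarrow> real" and K where
    "finite P" "\<And>s. smooth_fun A (\<rho> s)" "\<And>s. compact (K s)" "\<And>s. K s \<subseteq> cimg (chart_at A s)"
    "\<And>s p. p \<notin> cinv (chart_at A s) ` K s \<Longrightarrow> \<rho> s p = 0" "\<And>p. (\<Sum>s\<in>P. \<rho> s p) = 1"
proof -
  have "\<exists>r>0. cball (cmap (chart_at A s) s) r \<subseteq> cimg (chart_at A s)" for s
    using open_cimg[OF chart_at(1)] cmap_in_cimg[OF chart_at(2)] open_contains_cball by metis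
  then obtain r where r: "\<And>s. r s > 0" "\<And>s. cball (cmap (chart_at A s) s) (r s) \<subseteq> cimg (chart_at A s)" by metis
  have "\<exists>\<psi>. smooth_on UNIV \<psi> \<and> (\<forall>x\<in>ball (cmap (chart_at A s) s) (r s). \<psi> x > 0) \<and>
      (\<forall>x. x \<notin> ball (cmap (chart_at A s) s) (r s) \<longrightarrow> \<psi> x = (0::real))" for s
    by (rule bump_exists[of "cmap (chart_at A s) s" "r s"]) blast
  then obtain \<psi> where \<psi>: "\<And>s. smooth_on UNIV (\<psi> s)"
    "\<And>s x. x \<in> ball (cmap (chart_at A s) s) (r s) \<Longrightarrow> \<psi> s x > 0"
    "\<And>s x. x \<notin> ball (cmap (chart_at A s) s) (r s) \<Longrightarrow> \<psi> s x = (0::real)" by metis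
  define K where "K s = cball (cmap (chart_at A s) s) (r s)" for s
  have K: "compact (K s)" "K s \<subseteq> cimg (chart_at A s)" for s using r(2) by (simp_all add: K_def)
  have \<psi>K: "\<psi> s x = 0" if "x \<notin> K s" for s x using that \<psi>(3) by (auto simp: K_def)
  have \<psi>0: "\<psi> s x \<ge> 0" for s x using \<psi>(2,3) by (metis less_imp_le order_refl)
  define f where "f s p = (if p \<in> cdom (chart_at A s) then \<psi> s (cmap (chart_at A s) p) else 0)" for s p
  have f: "smooth_fun A (f s)" for s
    unfolding f_def[abs_def]
    by (rule smooth_fun_extend_by_zero[OF chart_at(1) K(1) K(2) smooth_on_subset[OF \<psi>(1)] \<psi>K]) auto
  have f0: "f s p \<ge> 0" for s p using \<psi>0 by (simp add: f_def)
  have fs: "f s s > 0" for s using \<psi>(2) r(1) chart_at(2) by (simp add: f_def)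
  have fK: "f s p = 0" if p: "p \<notin> cinv (chart_at A s) ` K s" for s p
  proof (cases "p \<in> cdom (chart_at A s)")
    case True
    then have "cmap (chart_at A s) p \<notin> K s" using p cinv_cmap[OF chart_at(1) True] by (metis image_eqI)
    then show ?thesis using \<psi>K by (simp add: f_def)
  qed (simp add: f_def)
  define B where "B s = {p. f s p > 0}" for s
  have B: "open (B s)" for s
    unfolding B_def using smooth_fun_continuous[OF f] by (intro open_Collect_less continuous_on_const)
  have "UNIV \<subseteq> (\<Union>s\<in>UNIV. B s)" using fs by (auto simp: B_def)
  then obtain P where P: "finite P" "UNIV \<subseteq> (\<Union>s\<in>P. B s)"
    using compactE_image[OF compact_manifold, of UNIV B] B by metis
  define T where "T p = (\<Sum>s\<in>P. f s p)" for p
  have T: "T p > 0" for p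
  proof -
    obtain s where "s \<in> P" "f s p > 0" using P(2) by (auto simp: B_def)
    then show ?thesis unfolding T_def using f0 P(1) by (meson sum_pos2)
  qed
  show ?thesis
  proof (rule that[of P "\<lambda>s p. f s p / T p" K])
    show "smooth_fun A (\<lambda>p. f s p / T p)" for s
    proof (rule smooth_fun_divide[OF f])
      show "smooth_fun A T" unfolding T_def[abs_def] by (rule smooth_fun_sum[OF f])
      show "T p \<noteq> 0" for p using T[of p] by simp
    qed
    show "(\<Sum>s\<in>P. f s p / T p) = 1" for p
      using T[of p] unfolding sum_divide_distrib[symmetric] T_def[of p, symmetric] by simp
  qed (use P K fK in auto)
qed

text \<open>Linearity of \<open>D\<close> and of the Lie derivative in the vector field reduces this to the summands
  \<open>\<rho>\<^sub>s X\<close> of a partition of unity.\<close>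

theorem lie_derivative_in_kernel:
  assumes S: "riemannian_functional A S" and g: "riemannian_metric A g" and D: "has_functional_derivative A S g D"
    and X: "vector_field A X"
  shows "D (lie_ten A X g) = 0"
proof -
  obtain P \<rho> K where P: "finite P" "\<And>s. smooth_fun A (\<rho> s)" "\<And>s. compact (K s)" "\<And>s. K s \<subseteq> cimg (chart_at A s)"
    "\<And>s p. p \<notin> cinv (chart_at A s) ` K s \<Longrightarrow> \<rho> s p = 0" "\<And>p. (\<Sum>s\<in>P. \<rho> s p) = 1"
    by (rule partition_of_unity) (rule that, assumption+)
  define Z where "Z s p = \<rho> s p *\<^sub>R X p" for s p
  have Z: "vector_field A (Z s)" for s unfolding Z_def[abs_def] by (rule vector_field_scaled[OF P(2) X])
  have L: "sym_tensor A (lie_ten A (Z s) g)" for s by (rule sym_tensor_lie_ten[OF Z metricD(1)[OF g]])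
  have XZ: "(\<lambda>p. \<Sum>s\<in>P. Z s p) = X"
    by (simp add: Z_def fun_eq_iff scaleR_sum_left[symmetric] P(6))
  have Dlin: "D (\<lambda>p. a *\<^sub>R h p + b *\<^sub>R k p) = a * D h + b * D k" if "sym_tensor A h" "sym_tensor A k" for h k a b
    using D that unfolding has_functional_derivative_def by blast
  have "sym_tensor A (\<lambda>p. \<Sum>s\<in>Q. lie_ten A (Z s) g p) \<and> D (\<lambda>p. \<Sum>s\<in>Q. lie_ten A (Z s) g p) = 0" if "finite Q" for Q
    using that
  proof induction
    case empty
    have z: "sym_tensor A (\<lambda>p. 0)"
    proof -
      have "coords_ten A \<kappa> (\<lambda>p. 0) = (\<lambda>x. 0)" for \<kappa>
        by (simp add: coords_ten_def Let_def fun_eq_iff matrix_matrix_mult_def vec_eq_iff)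
      then show ?thesis by (simp add: sym_tensor_def transpose_def vec_eq_iff)
    qed
    then show ?case using Dlin[OF z z, of 0 0] by simp
  next
    case (insert s Q)
    let ?h = "lie_ten A (Z s) g" and ?k = "\<lambda>p. \<Sum>s\<in>Q. lie_ten A (Z s) g p"
    have eq: "(\<lambda>p. \<Sum>s\<in>insert s Q. lie_ten A (Z s) g p) = (\<lambda>p. 1 *\<^sub>R ?h p + 1 *\<^sub>R ?k p)"
      using insert by simp
    have k: "sym_tensor A ?k" "D ?k = 0" using insert by auto
    have co: "coords_ten A \<kappa> (\<lambda>p. 1 *\<^sub>R ?h p + 1 *\<^sub>R ?k p) x = coords_ten A \<kappa> ?h x + coords_ten A \<kappa> ?k x" for \<kappa> x
      by (simp add: coords_ten_def Let_def linear_simps[OF bounded_linear_congruence])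
    have "smooth_on (cimg \<kappa>) (coords_ten A \<kappa> (\<lambda>p. 1 *\<^sub>R ?h p + 1 *\<^sub>R ?k p))" if "\<kappa> \<in> A" for \<kappa>
      unfolding co[abs_def] by (intro smooth_on_add open_cimg that sym_tensorD(1)[OF L] sym_tensorD(1)[OF k(1)])
    then have "sym_tensor A (\<lambda>p. 1 *\<^sub>R ?h p + 1 *\<^sub>R ?k p)"
      using sym_tensorD(2)[OF L, of s] sym_tensorD(2)[OF k(1)]
      by (simp add: sym_tensor_def linear_simps[OF bounded_linear_transpose])
    moreover have "D ?h = 0"
      by (rule lie_derivative_in_kernel_local[OF S g D Z chart_at(1) P(3)[of s] P(4)[of s]]) (simp add: Z_def P(5))
    ultimately show ?case unfolding eq using Dlin[where a = 1 and b = 1, OF L[of s] k(1)] k(2) by simp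
  qed
  moreover have "lie_ten A X g = (\<lambda>p. \<Sum>s\<in>P. lie_ten A (Z s) g p)"
    using lie_ten_sum[where X = Z, OF Z P(1) metricD(1)[OF g]] X by (simp add: XZ fun_eq_iff)
  ultimately show ?thesis using P(1) by metis
qed

end

context smooth_manifold
begin

lemma coords_ten_scaled: "coords_ten A \<kappa> (\<lambda>p. f p *\<^sub>R h p) x = f (cinv \<kappa> x) *\<^sub>R coords_ten A \<kappa> h x"
  by (simp add: coords_ten_def Let_def linear_simps[OF bounded_linear_congruence])

lemma sym_tensor_scaled:
  assumes "smooth_fun A f" "sym_tensor A h"
  shows "sym_tensor A (\<lambda>p. f p *\<^sub>R h p)"
proof -
  have "smooth_on (cimg \<kappa>) (coords_ten A \<kappa> (\<lambda>p. f p *\<^sub>R h p))" if "\<kappa> \<in> A" for \<kappa>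
    unfolding coords_ten_scaled[abs_def]
    by (intro smooth_on_scaleR open_cimg smooth_funD sym_tensorD(1) assms that)
  then show ?thesis
    using sym_tensorD(2)[OF assms(2)] by (simp add: sym_tensor_def linear_simps[OF bounded_linear_transpose])
qed

text \<open>The chain rule for the curve \<open>exp (2 s \<omega>) g\<close>.\<close>

lemma conformal_derivative:
  assumes g: "riemannian_metric A g" and D: "has_functional_derivative A S g D" and \<omega>: "smooth_fun A \<omega>"
  shows "((\<lambda>s. S (\<lambda>p. exp (2 * s * \<omega> p) *\<^sub>R g p)) has_real_derivative D (\<lambda>p. (2 * \<omega> p) *\<^sub>R g p)) (at 0)"
proof (rule functional_derivative_along_curve[where \<epsilon> = 1, OF D])
  let ?I = "{-1<..<1::real}"
  show "smooth_curve 1 (\<lambda>s p. exp (2 * s * \<omega> p) *\<^sub>R g p)"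
    unfolding smooth_curve_def
  proof
    fix \<kappa> assume \<kappa>: "\<kappa> \<in> A"
    have IU: "open (?I \<times> cimg \<kappa>)" by (intro open_Times open_cimg \<kappa> open_greaterThanLessThan)
    have "smooth_on (?I \<times> cimg \<kappa>) (\<lambda>z. 2 * fst z * \<omega> (cinv \<kappa> (snd z)))"
      by (intro smooth_on_mult smooth_on_const smooth_on_linear[OF bounded_linear_fst] IU
          smooth_on_snd[OF open_greaterThanLessThan open_cimg[OF \<kappa>] smooth_funD[OF \<omega> \<kappa>]])
    then have "smooth_on (?I \<times> cimg \<kappa>) (\<lambda>z. exp (2 * fst z * \<omega> (cinv \<kappa> (snd z))))"
      by (rule smooth_on_compose[OF IU open_UNIV smooth_on_exp]) simp
    then have "smooth_on (?I \<times> cimg \<kappa>) (\<lambda>z. exp (2 * fst z * \<omega> (cinv \<kappa> (snd z))) *\<^sub>R coords_ten A \<kappa> g (snd z))"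
      by (intro smooth_on_scaleR IU
          smooth_on_snd[OF open_greaterThanLessThan open_cimg[OF \<kappa>] sym_tensorD(1)[OF metricD(1)[OF g] \<kappa>]])
    then show "smooth_on (?I \<times> cimg \<kappa>) (\<lambda>z. coords_ten A \<kappa> (\<lambda>p. exp (2 * fst z * \<omega> p) *\<^sub>R g p) (snd z))"
      by (simp add: coords_ten_scaled)
  qed
  show "transpose (exp (2 * t * \<omega> p) *\<^sub>R g p) = exp (2 * t * \<omega> p) *\<^sub>R g p" for t p
    by (simp add: linear_simps[OF bounded_linear_transpose] metricD(2)[OF g])
  show "sym_tensor A (\<lambda>p. (2 * \<omega> p) *\<^sub>R g p)"
    by (rule sym_tensor_scaled[OF smooth_fun_mult[OF smooth_fun_const \<omega>] metricD(1)[OF g]])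
  show "((\<lambda>t. exp (2 * t * \<omega> p) *\<^sub>R g p) has_vector_derivative (2 * \<omega> p) *\<^sub>R g p) (at 0)" for p
  proof -
    have "((\<lambda>t. exp (2 * t * \<omega> p)) has_real_derivative 2 * \<omega> p) (at 0)"
      by (auto intro!: derivative_eq_intros)
    then show ?thesis
      using has_vector_derivative_scaleR[OF _ has_vector_derivative_const[of "g p"]] by fastforce
  qed
qed auto

lemma conformal_class_metric:
  assumes "conformal_class A C" "g \<in> C"
  shows "riemannian_metric A g"
proof -
  obtain g0 \<Upsilon> where g0: "riemannian_metric A g0" and \<Upsilon>: "smooth_fun A \<Upsilon>"
    and g: "g = (\<lambda>p. exp (2 * \<Upsilon> p) *\<^sub>R g0 p)"
    using assms by (auto simp: conformal_class_def)
  have "smooth_fun A (\<lambda>p. exp (2 * \<Upsilon> p))"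
  proof (rule smooth_funI)
    fix \<kappa> assume \<kappa>: "\<kappa> \<in> A"
    show "smooth_on (cimg \<kappa>) (\<lambda>x. exp (2 * \<Upsilon> (cinv \<kappa> x)))"
      by (rule smooth_on_compose[OF open_cimg[OF \<kappa>] open_UNIV smooth_on_exp smooth_on_mult[OF open_cimg[OF \<kappa>] smooth_on_const smooth_funD[OF \<Upsilon> \<kappa>]]]) simp
  qed
  then have "sym_tensor A g" unfolding g by (rule sym_tensor_scaled[OF _ metricD(1)[OF g0]])
  then show ?thesis
    using metricD(3)[OF g0] by (simp add: riemannian_metric_def g scaleR_matrix_vector_assoc[symmetric])
qed

end

context closed_manifold
begin

text \<open>Evaluate \<open>D\<close> at \<open>\<L>\<^sub>X g = 2 \<omega> g\<close> in two ways: it vanishes by invariance, and it is \<open>2 \<integral> \<omega> V\<close> by the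
  choice of \<open>S\<close>.\<close>

theorem integral_divergence_times_invariant:
  assumes C: "conformal_class A C" "g \<in> C" and V: "naturally_conformally_variational A C V"
    and X: "conformal_vector_field A g X"
  shows "(\<integral>p. divergence A g X p * V g p \<partial>riemannian_measure A g) = 0"
proof -
  have g: "riemannian_metric A g" by (rule conformal_class_metric[OF C])
  have Xv: "vector_field A X" using X by (simp add: conformal_vector_field_def)
  let ?n = "real CARD('n)"
  define \<omega> where "\<omega> p = divergence A g X p / ?n" for p
  have \<omega>: "smooth_fun A \<omega>" unfolding \<omega>_def[abs_def]
    by (rule smooth_fun_divide[OF smooth_divergence[OF g Xv] smooth_fun_const]) simp
  have L: "lie_ten A X g = (\<lambda>p. (2 * \<omega> p) *\<^sub>R g p)"
    using X by (auto simp: conformal_vector_field_def \<omega>_def fun_eq_iff)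
  obtain S where S: "riemannian_functional A S" "differentiable_functional A S" "functional_for A C V S"
    using V by (auto simp: naturally_conformally_variational_def)
  obtain D where D: "has_functional_derivative A S g D"
    using S(2) g by (auto simp: differentiable_functional_def)
  have "((\<lambda>s. S (\<lambda>p. exp (2 * s * \<omega> p) *\<^sub>R g p)) has_real_derivative
           2 * (\<integral>p. \<omega> p * V g p \<partial>riemannian_measure A g)) (at 0)"
    using S(3) C(2) \<omega> unfolding functional_for_def by blast
  then have "2 * (\<integral>p. \<omega> p * V g p \<partial>riemannian_measure A g) = D (lie_ten A X g)"
    unfolding L by (rule DERIV_unique[OF _ conformal_derivative[OF g D \<omega>]])
  also have "\<dots> = 0" by (rule lie_derivative_in_kernel[OF S(1) g D Xv])
  finally have "(\<integral>p. \<omega> p * V g p \<partial>riemannian_measure A g) = 0" by simp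
  then show ?thesis by (simp add: \<omega>_def)
qed

end

section \<open>Change of variables for nonnegative functions\<close>

lemma nn_integral_lborel_eq_integral:
  fixes h :: "'a::euclidean_space \<Rightarrow> real"
  assumes meas: "(\<lambda>x. indicator S x * h x) \<in> borel_measurable borel" and nn: "\<And>x. x \<in> S \<Longrightarrow> 0 \<le> h x"
  shows "h absolutely_integrable_on S \<Longrightarrow> (\<integral>\<^sup>+x\<in>S. ennreal (h x) \<partial>lborel) = ennreal (integral S h)"
    and "(\<integral>\<^sup>+x\<in>S. ennreal (h x) \<partial>lborel) \<noteq> \<infinity> \<Longrightarrow> h absolutely_integrable_on S"
proof -
  have nn': "0 \<le> indicator S x * h x" for x using nn by (cases "x \<in> S") auto
  have e: "(\<integral>\<^sup>+x\<in>S. ennreal (h x) \<partial>lborel) = (\<integral>\<^sup>+x. ennreal (indicator S x * h x) \<partial>lebesgue)"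
    unfolding nn_integral_completion by (intro nn_integral_cong) (simp split: split_indicator)
  have i: "h absolutely_integrable_on S \<longleftrightarrow> integrable lebesgue (\<lambda>x. indicator S x * h x)"
    by (simp add: set_integrable_def)
  show "(\<integral>\<^sup>+x\<in>S. ennreal (h x) \<partial>lborel) = ennreal (integral S h)" if "h absolutely_integrable_on S"
  proof -
    have "(\<integral>\<^sup>+x. ennreal (indicator S x * h x) \<partial>lebesgue) = ennreal (\<integral>x. indicator S x * h x \<partial>lebesgue)"
      by (rule nn_integral_eq_integral) (use that i nn' in auto)
    also have "(\<integral>x. indicator S x * h x \<partial>lebesgue) = integral S h"
      using set_lebesgue_integral_eq_integral(2)[OF that] by (simp add: set_lebesgue_integral_def)
    finally show ?thesis using e by simp
  qed
  show "h absolutely_integrable_on S" if "(\<integral>\<^sup>+x\<in>S. ennreal (h x) \<partial>lborel) \<noteq> \<infinity>"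
    unfolding i
  proof (rule integrableI_nonneg)
    show "(\<lambda>x. indicator S x * h x) \<in> borel_measurable lebesgue"
      using meas by (intro measurable_completion) simp
    show "(\<integral>\<^sup>+x. ennreal (indicator S x * h x) \<partial>lebesgue) < \<infinity>"
      using that e by (simp add: less_top)
  qed (use nn' in auto)
qed

text \<open>The two sides are absolutely integrable at the same time. If they are, the integrals agree;
  otherwise both sides are infinite.\<close>

lemma nn_integral_change_of_variables_wellorder:
  fixes f :: "real^'m::{finite,wellorder} \<Rightarrow> real" and g :: "real^'m::_ \<Rightarrow> real^'m::_"
  assumes S: "S \<in> sets borel" and g: "\<And>x. x \<in> S \<Longrightarrow> (g has_derivative g' x) (at x within S)" and inj: "inj_on g S"
    and nn: "\<And>x. x \<in> S \<Longrightarrow> 0 \<le> f (g x)"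
    and m1: "(\<lambda>x. indicator S x * (\<bar>det (matrix (g' x))\<bar> * f (g x))) \<in> borel_measurable borel"
    and m2: "(\<lambda>y. indicator (g ` S) y * f y) \<in> borel_measurable borel"
  shows "(\<integral>\<^sup>+y\<in>g ` S. ennreal (f y) \<partial>lborel) = (\<integral>\<^sup>+x\<in>S. ennreal (\<bar>det (matrix (g' x))\<bar> * f (g x)) \<partial>lborel)"
proof -
  let ?h = "\<lambda>x. \<bar>det (matrix (g' x))\<bar> * f (g x)"
  have "S \<in> sets lebesgue" using S by simp
  then have cov: "?h absolutely_integrable_on S \<and> integral S ?h = b \<longleftrightarrow> f absolutely_integrable_on (g ` S) \<and> integral (g ` S) f = b" for b
    using has_absolute_integral_change_of_variables[OF _ g inj, of "\<lambda>x. vec (f x) :: real^1" "vec b"]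
    by (simp add: absolutely_integrable_on_1_iff integral_on_1_eq)
  have nn1: "0 \<le> ?h x" if "x \<in> S" for x using nn[OF that] by simp
  have nn2: "0 \<le> f y" if "y \<in> g ` S" for y using nn that by auto
  have I1: "(\<integral>\<^sup>+x\<in>S. ennreal (?h x) \<partial>lborel) = ennreal (integral S ?h)" if "?h absolutely_integrable_on S"
    by (rule nn_integral_lborel_eq_integral(1)[OF m1 _ that]) (rule nn1)
  have I2: "?h absolutely_integrable_on S" if "(\<integral>\<^sup>+x\<in>S. ennreal (?h x) \<partial>lborel) \<noteq> \<infinity>"
    by (rule nn_integral_lborel_eq_integral(2)[OF m1 _ that]) (rule nn1)
  have I3: "(\<integral>\<^sup>+y\<in>g ` S. ennreal (f y) \<partial>lborel) = ennreal (integral (g ` S) f)" if "f absolutely_integrable_on (g ` S)"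
    by (rule nn_integral_lborel_eq_integral(1)[OF m2 _ that]) (rule nn2)
  have I4: "f absolutely_integrable_on (g ` S)" if "(\<integral>\<^sup>+y\<in>g ` S. ennreal (f y) \<partial>lborel) \<noteq> \<infinity>"
    by (rule nn_integral_lborel_eq_integral(2)[OF m2 _ that]) (rule nn2)
  show ?thesis
  proof (cases "f absolutely_integrable_on (g ` S)")
    case True
    then have "?h absolutely_integrable_on S" "integral S ?h = integral (g ` S) f" using cov by blast+
    then show ?thesis using I1 I3[OF True] by simp
  next
    case False
    then have "\<not> ?h absolutely_integrable_on S" using cov by blast
    then have "(\<integral>\<^sup>+x\<in>S. ennreal (?h x) \<partial>lborel) = \<infinity>" by (rule contrapos_np) (rule I2)
    moreover from False have "(\<integral>\<^sup>+y\<in>g ` S. ennreal (f y) \<partial>lborel) = \<infinity>" by (rule contrapos_np) (rule I4)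
    ultimately show ?thesis by (simp only:)
  qed
qed

text \<open>The change of variables theorem is about index types with a well-order. An arbitrary finite
  index type \<open>'n\<close> is reached by renaming the coordinates: \<open>'n ordered_copy\<close> is a copy of \<open>'n\<close>, ordered by
  some injection into the natural numbers.\<close>

typedef 'a ordered_copy = "UNIV :: 'a set" morphisms original copy by simp

lemma original_copy [simp]: "original (copy a) = a" by (rule copy_inverse) simp

lemma bij_original: "bij original" and bij_copy: "bij copy"
  by (auto intro!: bijI' simp: original_inject copy_inject intro: original_inverse[symmetric] original_copy[symmetric])

instance ordered_copy :: (finite) finite
proof
  have "finite (range (copy :: 'a \<Rightarrow> 'a ordered_copy))" by simp
  then show "finite (UNIV :: 'a ordered_copy set)" by (simp only: bij_is_surj[OF bij_copy])
qed

definition copy_index :: "'a::finite ordered_copy \<Rightarrow> nat" where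
  "copy_index = (SOME f. inj f)"

lemma inj_copy_index: "inj (copy_index :: 'a::finite ordered_copy \<Rightarrow> nat)"
proof -
  have "\<exists>f :: 'a ordered_copy \<Rightarrow> nat. inj f"
    using finite_imp_inj_to_nat_seg[OF finite, of UNIV] by blast
  then show ?thesis unfolding copy_index_def by (rule someI_ex)
qed

instantiation ordered_copy :: (finite) wellorder
begin

definition less_eq_ordered_copy :: "'a ordered_copy \<Rightarrow> 'a ordered_copy \<Rightarrow> bool" where
  "x \<le> y \<longleftrightarrow> copy_index x \<le> copy_index y"

definition less_ordered_copy :: "'a ordered_copy \<Rightarrow> 'a ordered_copy \<Rightarrow> bool" where
  "x < y \<longleftrightarrow> copy_index x < copy_index y"

instance
proof
  fix P :: "'a ordered_copy \<Rightarrow> bool" and a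
  assume step: "\<And>x. (\<And>y. y < x \<Longrightarrow> P y) \<Longrightarrow> P x"
  show "P a"
    by (induction a rule: measure_induct_rule[of copy_index]) (use step in \<open>auto simp: less_ordered_copy_def\<close>)
qed (auto simp: less_eq_ordered_copy_def less_ordered_copy_def dest: injD[OF inj_copy_index])

end

lemma sign_conjugate:
  fixes f :: "'b::finite \<Rightarrow> 'a::finite"
  assumes f: "bij f" and "p permutes UNIV"
  shows "(inv f \<circ> p \<circ> f) permutes UNIV \<and> sign (inv f \<circ> p \<circ> f) = sign p"
  using assms(2) finite[of UNIV]
proof (induction p rule: permutes_induct)
  case id
  then show ?case using f by (simp add: bij_is_inj permutes_id sign_id id_def[symmetric])
next
  case (swap a b p)
  have ff: "f (inv f x) = x" "inv f (f y) = y" for x y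
    using f by (simp_all add: bij_is_surj surj_f_inv_f bij_is_inj)
  have "inv f \<circ> (Transposition.transpose a b \<circ> p) \<circ> f = Transposition.transpose (inv f a) (inv f b) \<circ> (inv f \<circ> p \<circ> f)"
    by (rule ext) (auto simp: Transposition.transpose_def ff, (metis ff)+)
  moreover have "inv f a \<noteq> inv f b" using swap ff by metis
  moreover have "Transposition.transpose (inv f a) (inv f b) permutes UNIV" by (rule permutes_swap_id) auto
  moreover have "permutation (Transposition.transpose a b)" "permutation p"
    "permutation (Transposition.transpose (inv f a) (inv f b))" "permutation (inv f \<circ> p \<circ> f)"
    using swap permutes_imp_permutation[OF finite] by (blast intro: permutation_swap_id)+
  moreover have "(inv f \<circ> p \<circ> f) permutes UNIV" "sign (inv f \<circ> p \<circ> f) = sign p" using swap by blast+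
  ultimately show ?case using swap by (simp only: permutes_compose sign_compose sign_swap_id if_False)
qed

lemma det_reindex:
  fixes M :: "real^'a::finite^'a" and f :: "'b::finite \<Rightarrow> 'a"
  assumes f: "bij f"
  shows "det (\<chi> i j. M $ f i $ f j) = det M"
proof -
  have ff: "f (inv f x) = x" "inv f (f y) = y" for x y
    using f by (simp_all add: bij_is_surj surj_f_inv_f bij_is_inj)
  have "bij_betw (\<lambda>p. inv f \<circ> p \<circ> f) {p. p permutes (UNIV :: 'a set)} {p. p permutes (UNIV :: 'b set)}"
  proof (rule bij_betwI[where g = "\<lambda>q. f \<circ> q \<circ> inv f"])
    show "(\<lambda>p. inv f \<circ> p \<circ> f) \<in> {p. p permutes UNIV} \<rightarrow> {p. p permutes UNIV}"
      using sign_conjugate[OF f] by blast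
    show "(\<lambda>q. f \<circ> q \<circ> inv f) \<in> {p. p permutes UNIV} \<rightarrow> {p. p permutes UNIV}"
      using sign_conjugate[OF bij_imp_bij_inv[OF f]] f by (auto simp: inv_inv_eq)
  qed (auto simp: ff fun_eq_iff)
  then have "(\<Sum>q | q permutes UNIV. of_int (sign q) * (\<Prod>i\<in>UNIV. M $ f i $ f (q i)))
    = (\<Sum>p | p permutes UNIV. of_int (sign (inv f \<circ> p \<circ> f)) * (\<Prod>i\<in>UNIV. M $ f i $ f ((inv f \<circ> p \<circ> f) i)))"
    by (rule sum.reindex_bij_betw[symmetric])
  also have "\<dots> = (\<Sum>p | p permutes UNIV. of_int (sign p) * (\<Prod>i\<in>UNIV. M $ i $ p i))"
  proof (rule sum.cong[OF refl])
    fix p assume "p \<in> {p. p permutes (UNIV :: 'a set)}"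
    then have "sign (inv f \<circ> p \<circ> f) = sign p" using sign_conjugate[OF f] by blast
    moreover have "(\<Prod>i\<in>UNIV. M $ f i $ f ((inv f \<circ> p \<circ> f) i)) = (\<Prod>i\<in>UNIV. M $ i $ p i)"
      using prod.reindex_bij_betw[of f UNIV UNIV "\<lambda>i. M $ i $ p i"] f by (simp add: ff)
    ultimately show "real_of_int (sign (inv f \<circ> p \<circ> f)) * (\<Prod>i\<in>UNIV. M $ f i $ f ((inv f \<circ> p \<circ> f) i))
      = of_int (sign p) * (\<Prod>i\<in>UNIV. M $ i $ p i)" by simp
  qed
  finally show ?thesis by (simp add: det_def)
qed

definition reindex :: "('b::finite \<Rightarrow> 'a::finite) \<Rightarrow> real^'a \<Rightarrow> real^'b" where
  "reindex f x = (\<chi> i. x $ f i)"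

lemma bounded_linear_reindex: "bounded_linear (reindex f)"
  unfolding linear_conv_bounded_linear[symmetric]
  by (rule linearI) (simp_all add: reindex_def vec_eq_iff)

lemma prod_Basis_vec: "(\<Prod>b\<in>(Basis :: (real^'a::finite) set). h b) = (\<Prod>i\<in>UNIV. h (axis i 1))"
proof -
  have B: "(Basis :: (real^'a) set) = range (\<lambda>i. axis i 1)" by (auto simp: Basis_vec_def)
  have inj: "inj (\<lambda>i :: 'a. axis i (1::real) :: real^'a)" by (auto intro!: injI simp: axis_eq_axis)
  show ?thesis unfolding B by (subst prod.reindex[OF inj]) (simp add: comp_def)
qed

lemma lborel_reindex:
  fixes f :: "'b::finite \<Rightarrow> 'a::finite"
  assumes f: "bij f"
  shows "distr lborel borel (reindex f) = lborel"
proof (rule lborel_eqI[symmetric])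
  have ff: "f (inv f x) = x" "inv f (f y) = y" for x y
    using f by (simp_all add: bij_is_surj surj_f_inv_f bij_is_inj)
  have meas: "reindex f \<in> measurable lborel borel"
    using linear_continuous_on[OF bounded_linear_reindex, of UNIV f] by (simp add: borel_measurable_continuous_onI)
  fix l u :: "real^'b" assume lu: "\<And>b. b \<in> Basis \<Longrightarrow> l \<bullet> b \<le> u \<bullet> b"
  have le: "l $ i \<le> u $ i" for i using lu[of "axis i 1"] by (simp add: inner_axis)
  let ?l = "reindex (inv f) l" and ?u = "reindex (inv f) u"
  have "reindex f -` box l u = box ?l ?u"
  proof -
    have "(\<forall>i. P i (f i)) \<longleftrightarrow> (\<forall>j. P (inv f j) j)" for P :: "'b \<Rightarrow> 'a \<Rightarrow> bool" using ff by metis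
    from this[of "\<lambda>i j. l $ i < x $ j \<and> x $ j < u $ i" for x]
    show ?thesis by (simp add: vimage_def mem_box_cart reindex_def set_eq_iff)
  qed
  then have "emeasure (distr lborel borel (reindex f)) (box l u) = emeasure lborel (box ?l ?u)"
    using meas by (simp add: emeasure_distr)
  also have "\<dots> = (\<Prod>b\<in>Basis. (?u - ?l) \<bullet> b)"
    by (rule emeasure_lborel_box) (auto simp: Basis_vec_def inner_axis reindex_def le)
  also have "(\<Prod>b\<in>Basis. (?u - ?l) \<bullet> b) = (\<Prod>b\<in>Basis. (u - l) \<bullet> b)"
    using prod.reindex_bij_betw[of f UNIV UNIV "\<lambda>i. u $ inv f i - l $ inv f i"] f
    by (simp add: prod_Basis_vec inner_axis reindex_def ff)
  finally show "emeasure (distr lborel borel (reindex f)) (box l u) = (\<Prod>b\<in>Basis. (u - l) \<bullet> b)" .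
qed simp

lemma nn_integral_reindex:
  fixes f :: "'b::finite \<Rightarrow> 'a::finite"
  assumes "bij f" "h \<in> borel_measurable borel"
  shows "(\<integral>\<^sup>+y. h y \<partial>lborel) = (\<integral>\<^sup>+x. h (reindex f x) \<partial>lborel)"
proof -
  have "reindex f \<in> measurable lborel borel"
    using linear_continuous_on[OF bounded_linear_reindex, of UNIV f] by (simp add: borel_measurable_continuous_onI)
  from nn_integral_distr[OF this, of h] show ?thesis
    using assms by (simp add: lborel_reindex)
qed

text \<open>Conjugate \<open>g\<close> by the renaming of coordinates, which preserves Lebesgue measure
  and determinants.\<close>

lemma nn_integral_change_of_variables:
  fixes f :: "real^'n::finite \<Rightarrow> real" and g :: "real^'n \<Rightarrow> real^'n"
  assumes S: "S \<in> sets borel" and g: "\<And>x. x \<in> S \<Longrightarrow> (g has_derivative g' x) (at x within S)" and inj: "inj_on g S"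
    and nn: "\<And>x. x \<in> S \<Longrightarrow> 0 \<le> f (g x)"
    and m1: "(\<lambda>x. indicator S x * (\<bar>det (matrix (g' x))\<bar> * f (g x))) \<in> borel_measurable borel"
    and m2: "(\<lambda>y. indicator (g ` S) y * f y) \<in> borel_measurable borel"
  shows "(\<integral>\<^sup>+y\<in>g ` S. ennreal (f y) \<partial>lborel) = (\<integral>\<^sup>+x\<in>S. ennreal (\<bar>det (matrix (g' x))\<bar> * f (g x)) \<partial>lborel)"
proof -
  define R :: "real^'n ordered_copy \<Rightarrow> real^'n" where "R = reindex copy"
  define Q :: "real^'n \<Rightarrow> real^'n ordered_copy" where "Q = reindex original"
  have RQ: "R (Q x) = x" and QR: "Q (R y) = y" for x y
    by (simp_all add: R_def Q_def reindex_def vec_eq_iff original_inverse)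
  have bl: "bounded_linear R" "bounded_linear Q" unfolding R_def Q_def by (rule bounded_linear_reindex)+
  have meas: "R \<in> borel_measurable borel" "Q \<in> borel_measurable borel"
    using linear_continuous_on[OF bl(1), of UNIV] linear_continuous_on[OF bl(2), of UNIV]
    by (auto intro: borel_measurable_continuous_onI)
  define T where "T = Q ` S"
  define G where "G = Q \<circ> g \<circ> R"
  define F where "F = f \<circ> R"
  define G' where "G' y = Q \<circ> g' (R y) \<circ> R" for y
  have T_iff: "y \<in> T \<longleftrightarrow> R y \<in> S" for y unfolding T_def using RQ QR by (metis image_iff)
  have GT_iff: "y \<in> G ` T \<longleftrightarrow> R y \<in> g ` S" for y
    unfolding G_def T_def image_comp comp_def using RQ QR by (auto simp: image_iff) (metis QR)+
  have T: "T \<in> sets borel"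
  proof -
    have "T = R -` S \<inter> space borel" using T_iff by auto
    then show ?thesis using measurable_sets[OF meas(1) S] by simp
  qed
  have dG: "(G has_derivative G' y) (at y within T)" if "y \<in> T" for y
  proof -
    have RT: "R ` T = S" unfolding T_def using RQ by (auto simp: image_iff)
    have "(R has_derivative R) (at y within T)" by (rule bounded_linear_imp_has_derivative[OF bl(1)])
    moreover have "(g has_derivative g' (R y)) (at (R y) within R ` T)" using g T_iff that RT by simp
    ultimately have "(g \<circ> R has_derivative g' (R y) \<circ> R) (at y within T)"
      by (rule diff_chain_within)
    then have "((\<lambda>z. Q ((g \<circ> R) z)) has_derivative (\<lambda>v. Q ((g' (R y) \<circ> R) v))) (at y within T)"
      by (rule bounded_linear.has_derivative[OF bl(2)])
    then show ?thesis by (simp add: G_def G'_def comp_def)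
  qed
  have dG': "det (matrix (G' y)) = det (matrix (g' (R y)))" for y
  proof -
    have Ra: "R (axis j 1) = axis (original j) 1" for j
      unfolding R_def reindex_def by (auto simp: vec_eq_iff axis_def original_inverse)
    have "matrix (G' y) = (\<chi> i j. matrix (g' (R y)) $ original i $ original j)"
      by (simp add: matrix_def G'_def Q_def reindex_def Ra)
    then show ?thesis by (simp add: det_reindex[OF bij_original])
  qed
  have iT: "indicator T y = indicator S (R y)" "indicator (G ` T) y = indicator (g ` S) (R y)" for y
    using T_iff GT_iff by (simp_all add: indicator_def)
  have "(\<integral>\<^sup>+y\<in>G ` T. ennreal (F y) \<partial>lborel) = (\<integral>\<^sup>+y\<in>T. ennreal (\<bar>det (matrix (G' y))\<bar> * F (G y)) \<partial>lborel)"
  proof (rule nn_integral_change_of_variables_wellorder[OF T dG])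
    show "inj_on G T"
      using inj T_iff unfolding inj_on_def G_def by (metis QR RQ comp_apply)
    show "0 \<le> F (G y)" if "y \<in> T" for y using nn T_iff that by (simp add: F_def G_def RQ)
    show "(\<lambda>y. indicator T y * (\<bar>det (matrix (G' y))\<bar> * F (G y))) \<in> borel_measurable borel"
      using measurable_compose[OF meas(1) m1] by (simp add: iT dG' F_def G_def RQ)
    show "(\<lambda>y. indicator (G ` T) y * F y) \<in> borel_measurable borel"
      using measurable_compose[OF meas(1) m2] by (simp add: iT F_def)
  qed
  moreover have "(\<integral>\<^sup>+y\<in>g ` S. ennreal (f y) \<partial>lborel) = (\<integral>\<^sup>+y\<in>G ` T. ennreal (F y) \<partial>lborel)"
  proof -
    have "(\<integral>\<^sup>+y\<in>g ` S. ennreal (f y) \<partial>lborel) = (\<integral>\<^sup>+y. ennreal (indicator (g ` S) y * f y) \<partial>lborel)"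
      by (intro nn_integral_cong) (simp split: split_indicator)
    also have "\<dots> = (\<integral>\<^sup>+y. ennreal (indicator (g ` S) (R y) * f (R y)) \<partial>lborel)"
      unfolding R_def by (rule nn_integral_reindex[OF bij_copy]) (use m2 in simp)
    also have "\<dots> = (\<integral>\<^sup>+y\<in>G ` T. ennreal (F y) \<partial>lborel)"
      by (intro nn_integral_cong) (simp add: iT F_def split: split_indicator)
    finally show ?thesis .
  qed
  moreover have "(\<integral>\<^sup>+x\<in>S. ennreal (\<bar>det (matrix (g' x))\<bar> * f (g x)) \<partial>lborel)
     = (\<integral>\<^sup>+y\<in>T. ennreal (\<bar>det (matrix (G' y))\<bar> * F (G y)) \<partial>lborel)"
  proof -
    have "(\<integral>\<^sup>+x\<in>S. ennreal (\<bar>det (matrix (g' x))\<bar> * f (g x)) \<partial>lborel)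
      = (\<integral>\<^sup>+x. ennreal (indicator S x * (\<bar>det (matrix (g' x))\<bar> * f (g x))) \<partial>lborel)"
      by (intro nn_integral_cong) (simp split: split_indicator)
    also have "\<dots> = (\<integral>\<^sup>+y. ennreal (indicator S (R y) * (\<bar>det (matrix (g' (R y)))\<bar> * f (g (R y)))) \<partial>lborel)"
      unfolding R_def by (rule nn_integral_reindex[OF bij_copy]) (use m1 in simp)
    also have "\<dots> = (\<integral>\<^sup>+y\<in>T. ennreal (\<bar>det (matrix (G' y))\<bar> * F (G y)) \<partial>lborel)"
      by (intro nn_integral_cong) (simp add: iT dG' F_def G_def RQ split: split_indicator)
    finally show ?thesis .
  qed
  ultimately show ?thesis by simp
qed

section \<open>Jacobi's formula and integration by parts\<close>

text \<open>In the Leibniz formula one factor of each product is differentiated. A permutation other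
  than the identity moves two points, hence another factor is an off-diagonal entry of the
  identity matrix, so only the product over the diagonal contributes.\<close>

lemma has_derivative_det_at_identity:
  fixes M :: "'a::real_normed_vector \<Rightarrow> real^'n::finite^'n"
  assumes M: "(M has_derivative M') (at x)" and "M x = mat 1"
  shows "((\<lambda>y. det (M y)) has_derivative (\<lambda>v. trace (M' v))) (at x)"
proof -
  have e: "((\<lambda>y. M y $ i $ j) has_derivative (\<lambda>v. M' v $ i $ j)) (at x)" for i j
    by (intro bounded_linear.has_derivative[OF bounded_linear_vec_nth] M)
  have "((\<lambda>y. det (M y)) has_derivative
     (\<lambda>v. \<Sum>p\<in>{p. p permutes UNIV}. of_int (sign p) *
        (\<Sum>i\<in>UNIV. M' v $ i $ p i * (\<Prod>j\<in>UNIV - {i}. M x $ j $ p j)))) (at x)"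
    unfolding det_def by (intro has_derivative_sum has_derivative_mult_right has_derivative_prod e)
  moreover have "(\<Sum>p\<in>{p. p permutes UNIV}. of_int (sign p) *
        (\<Sum>i\<in>UNIV. M' v $ i $ p i * (\<Prod>j\<in>UNIV - {i}. M x $ j $ p j))) = trace (M' v)" for v
  proof -
    have zero: "(\<Prod>j\<in>UNIV - {i}. M x $ j $ p j) = 0" if p: "p permutes UNIV" "p \<noteq> id" for p and i :: 'n
    proof -
      have "\<exists>j. j \<noteq> i \<and> p j \<noteq> j"
      proof (rule ccontr)
        assume a: "\<nexists>j. j \<noteq> i \<and> p j \<noteq> j"
        then have "p i = i" using permutes_inj[OF p(1)] by (metis injD)
        with a have "p = id" by (auto simp: fun_eq_iff)
        with p show False by simp
      qed
      then obtain j where "j \<noteq> i" "p j \<noteq> j" by blast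
      then have "M x $ j $ p j = 0" "j \<in> UNIV - {i}" using assms(2) by (auto simp: mat_def)
      then show ?thesis by (intro prod_zero) auto
    qed
    have id: "(\<Prod>j\<in>UNIV - {i}. M x $ j $ id j) = 1" for i :: 'n
      using assms(2) by (simp add: mat_def)
    have "(\<Sum>p\<in>{p. p permutes UNIV}. of_int (sign p) *
        (\<Sum>i\<in>UNIV. M' v $ i $ p i * (\<Prod>j\<in>UNIV - {i}. M x $ j $ p j)))
      = (\<Sum>p\<in>{p. p permutes (UNIV :: 'n set)}. if p = id then trace (M' v) else 0)"
    proof (intro sum.cong refl)
      fix p assume "p \<in> {p. p permutes (UNIV :: 'n set)}"
      then show "of_int (sign p) * (\<Sum>i\<in>UNIV. M' v $ i $ p i * (\<Prod>j\<in>UNIV - {i}. M x $ j $ p j))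
        = (if p = id then trace (M' v) else 0)"
      proof (cases "p = id")
        case True
        show ?thesis unfolding True id by (simp add: sign_id trace_def)
      next
        case False
        have "(\<Prod>j\<in>UNIV - {i}. M x $ j $ p j) = 0" for i
          by (rule zero) (use False \<open>p \<in> {p. p permutes UNIV}\<close> in auto)
        then show ?thesis using False by (simp only: mult_zero_right sum.neutral_const if_False)
      qed
    qed
    also have "\<dots> = trace (M' v)"
      by (subst sum.delta) (auto simp: permutes_id finite_permutations)
    finally show ?thesis .
  qed
  ultimately show ?thesis by simp
qed

text \<open>Jacobi's formula: factor out \<open>M x\<close> and differentiate at the identity.\<close>

lemma has_derivative_det:
  fixes M :: "'a::real_normed_vector \<Rightarrow> real^'n::finite^'n"
  assumes M: "(M has_derivative M') (at x)" and nz: "det (M x) \<noteq> 0"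
  shows "((\<lambda>y. det (M y)) has_derivative (\<lambda>v. det (M x) * trace (matrix_inv (M x) ** M' v))) (at x)"
proof -
  let ?I = "matrix_inv (M x)"
  have "((\<lambda>y. ?I ** M y) has_derivative (\<lambda>v. ?I ** M' v)) (at x)"
    by (rule bounded_linear.has_derivative[OF bounded_bilinear.bounded_linear_right[OF bounded_bilinear_matrix_mult] M])
  then have "((\<lambda>y. det (?I ** M y)) has_derivative (\<lambda>v. trace (?I ** M' v))) (at x)"
    by (rule has_derivative_det_at_identity) (rule matrix_inv_mult[OF nz])
  then have "((\<lambda>y. det (M x) * det (?I ** M y)) has_derivative (\<lambda>v. det (M x) * trace (?I ** M' v))) (at x)"
    by (rule has_derivative_mult_right)
  moreover have "det (M x) * det (?I ** M y) = det (M y)" for y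
    using arg_cong[OF matrix_inv_mult(1)[OF nz], of det] by (simp add: det_mul)
  ultimately show ?thesis by simp
qed

lemma sqrt_det_divergence:
  fixes G :: "real^'n::finite \<Rightarrow> real^'n^'n"
  assumes U: "open U" "x \<in> U" and sym: "\<And>y. y \<in> U \<Longrightarrow> transpose (G y) = G y"
    and G: "G differentiable (at x)" and det: "det (G x) > 0" and Y: "Y differentiable (at x)"
  shows "sqrt (det (G x)) * (\<Sum>a\<in>UNIV. cov_deriv G Y x a a) = (\<Sum>a\<in>UNIV. pd a (\<lambda>y. sqrt (det (G y)) * Y y $ a) x)"
proof -
  have nz: "det (G x) \<noteq> 0" using det by simp
  let ?s = "sqrt (det (G x))"
  have "((\<lambda>y. det (G y)) has_derivative (\<lambda>v. det (G x) * trace (matrix_inv (G x) ** frechet_derivative G (at x) v))) (at x)"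
    by (rule has_derivative_det[OF frechet_derivative_works[THEN iffD1, OF G] nz])
  from has_derivative_real_sqrt[OF _ this] 
  have "((\<lambda>y. sqrt (det (G y))) has_derivative
     (\<lambda>v. det (G x) * trace (matrix_inv (G x) ** frechet_derivative G (at x) v) * (inverse ?s / 2))) (at x)"
    using det by (simp add: mult.commute)
  moreover have "det (G x) * t * (inverse ?s / 2) = ?s * (1/2 * t)" for t
  proof -
    have "det (G x) = ?s * ?s" using det by simp
    moreover have "?s \<noteq> 0" using det by simp
    ultimately show ?thesis by (simp add: field_simps)
  qed
  ultimately have ds: "((\<lambda>y. sqrt (det (G y))) has_derivative
     (\<lambda>v. ?s * (1/2 * trace (matrix_inv (G x) ** frechet_derivative G (at x) v)))) (at x)" by (simp only:)
  have dY: "((\<lambda>y. Y y $ a) has_derivative (\<lambda>v. frechet_derivative Y (at x) v $ a)) (at x)" for a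
    by (rule bounded_linear.has_derivative[OF bounded_linear_vec_nth frechet_derivative_works[THEN iffD1, OF Y]])
  have pd: "pd a (\<lambda>y. sqrt (det (G y)) * Y y $ a) x =
     ?s * pd a Y x $ a + ?s * (1/2 * trace (matrix_inv (G x) ** pd a G x)) * Y x $ a" for a
    unfolding pd_def by (rule frechet_derivative_eq[OF has_derivative_mult[OF ds dY]])
  have "(\<Sum>a\<in>UNIV. cov_deriv G Y x a a) = (\<Sum>a\<in>UNIV. pd a Y x $ a) + 1/2 * (\<Sum>a\<in>UNIV. Y x $ a * trace (matrix_inv (G x) ** pd a G x))"
    using sum_cov_deriv[OF U sym G nz, of Y] trace_inv_lie_mat[OF G nz, of Y] by simp
  then show ?thesis unfolding pd by (simp add: sum.distrib sum_distrib_left algebra_simps)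
qed

text \<open>By translation invariance the integrals of the difference quotients are zero. The quotients are
  bounded by a Lipschitz constant and supported in one ball, so dominated convergence applies.\<close>

lemma integral_pd_compact_support:
  fixes W :: "real^'n::finite \<Rightarrow> real"
  assumes W: "smooth_on UNIV W" and K: "compact K" "\<And>x. x \<notin> K \<Longrightarrow> W x = 0"
  shows "integrable lborel (pd a W)" "(\<integral>x. pd a W x \<partial>lborel) = 0"
proof -
  obtain L where L: "L > 0" "\<And>x y. norm (W x - W y) \<le> L * norm (x - y)"
    using compact_support_lipschitz[OF W K] by metis
  obtain r where r: "\<And>x. x \<in> K \<Longrightarrow> norm x \<le> r" "r > 0"
    using compact_imp_bounded[OF K(1)] by (auto simp: bounded_pos)
  \<comment> \<open>All translates by vectors of norm at most \<open>1\<close> are still supported in \<open>C\<close>.\<close>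
  define C where "C = cball (0 :: real^'n) (r + 1)"
  have C: "C \<in> sets lborel" "emeasure lborel C < \<infinity>" unfolding C_def by (simp, rule emeasure_bounded_finite[OF bounded_cball])
  define e where "e m = (1 / real (Suc m)) *\<^sub>R (axis a 1 :: real^'n)" for m
  have e: "norm (e m) = 1 / real (Suc m)" "norm (e m) \<le> 1" for m
    by (simp_all add: e_def norm_axis_1)
  define q where "q m x = (W (e m + x) - W x) / (1 / real (Suc m))" for m x
  have cW: "continuous_on UNIV W" by (rule smooth_on_imp_continuous_on[OF W])
  have mW: "W \<in> borel_measurable lborel" using cW by (simp add: borel_measurable_continuous_onI)
  have bW: "\<bar>W x\<bar> \<le> L * (2 * r + 1)" if "x \<in> K" for x
  proof -
    \<comment> \<open>A point outside the support at distance at most \<open>2 r + 1\<close> from \<open>x\<close>, to which the Lipschitz bound applies.\<close>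
    let ?y = "(r + 1) *\<^sub>R (axis a 1 :: real^'n)"
    have "norm ?y = r + 1" using r(2) by (simp add: norm_axis_1)
    then have "?y \<notin> K" using r(1) by force
    then have "norm (W x) \<le> L * norm (x - ?y)" using L(2)[of x ?y] K(2) by simp
    also have "\<dots> \<le> L * (2 * r + 1)"
      using norm_triangle_ineq4[of x ?y] r(1)[OF that] \<open>norm ?y = r + 1\<close> L(1) by (intro mult_left_mono) auto
    finally show ?thesis by simp
  qed
  have iW: "integrable lborel W"
  proof (rule integrableI_bounded_set[where A = C and B = "L * (2 * r + 1)"])
    show "AE x in lborel. x \<in> C \<longrightarrow> norm (W x) \<le> L * (2 * r + 1)"
      using bW K(2) L(1) r(2) by (intro AE_I2) (metis abs_zero less_imp_le mult_nonneg_nonneg add_nonneg_nonneg mult_2 real_norm_def zero_le_one)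
    show "AE x in lborel. x \<notin> C \<longrightarrow> W x = 0"
      using K(2) r(1) by (intro AE_I2) (force simp: C_def)
  qed (use C mW in auto)
  have shift: "integrable lborel (\<lambda>x. W (c + x))" "(\<integral>x. W (c + x) \<partial>lborel) = (\<integral>x. W x \<partial>lborel)" for c
  proof -
    have d: "distr lborel borel ((+) c) = (lborel :: (real^'n) measure)" by (rule lborel_distr_plus)
    have m: "(+) c \<in> measurable lborel borel" by simp
    have "integrable (distr lborel borel ((+) c)) W" unfolding d by (rule iW)
    then show "integrable lborel (\<lambda>x. W (c + x))" using integrable_distr_eq[OF m, of W] mW by simp
    have "(\<integral>x. W x \<partial>(distr lborel borel ((+) c))) = (\<integral>x. W (c + x) \<partial>lborel)"
      by (rule integral_distr[OF m]) (use mW in simp)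
    then show "(\<integral>x. W (c + x) \<partial>lborel) = (\<integral>x. W x \<partial>lborel)" unfolding d by simp
  qed
  have q0: "(\<integral>x. q m x \<partial>lborel) = 0" for m
    unfolding q_def using shift iW by simp
  have lim: "(\<lambda>m. q m x) \<longlonglongrightarrow> pd a W x" for x
  proof -
    have d: "W differentiable (at x)" by (rule smooth_on_differentiable[OF W]) simp
    have l: "linear (frechet_derivative W (at x))" by (rule linear_frechet_derivative[OF d])
    have "((\<lambda>t. W (t *\<^sub>R axis a 1 + x)) has_derivative (\<lambda>t. frechet_derivative W (at x) (t *\<^sub>R axis a 1))) (at 0)"
    proof (rule has_derivative_compose[of "\<lambda>t. t *\<^sub>R axis a 1 + x" "\<lambda>t. t *\<^sub>R axis a 1"])
      show "((\<lambda>t. t *\<^sub>R axis a 1 + x) has_derivative (\<lambda>t. t *\<^sub>R axis a 1)) (at 0)"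
        by (auto intro!: derivative_eq_intros)
      show "(W has_derivative frechet_derivative W (at x)) (at (0 *\<^sub>R axis a 1 + x))"
        using d by (simp add: frechet_derivative_works)
    qed
    then have "((\<lambda>t. W (t *\<^sub>R axis a 1 + x)) has_real_derivative pd a W x) (at 0)"
      by (simp add: has_field_derivative_def linear_cmul[OF l] pd_def mult_commute_abs)
    then have "((\<lambda>t. (W (t *\<^sub>R axis a 1 + x) - W x) / t) \<longlongrightarrow> pd a W x) (at 0)"
      by (simp add: DERIV_def)
    moreover have "filterlim (\<lambda>m. 1 / real (Suc m)) (at 0) sequentially"
      using LIMSEQ_inverse_real_of_nat by (auto simp: filterlim_at inverse_eq_divide)
    ultimately show ?thesis unfolding q_def e_def by (rule filterlim_compose)
  qed
  have qb: "norm (q m x) \<le> L * indicator C x" for m x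
  proof (cases "x \<in> C")
    case True
    have "norm (W (e m + x) - W x) \<le> L * (1 / real (Suc m))" using L(2)[of "e m + x" x] e(1)[of m] by simp
    then have "norm (W (e m + x) - W x) * real (Suc m) \<le> L * (1 / real (Suc m)) * real (Suc m)"
      by (rule mult_right_mono) simp
    then show ?thesis using True by (simp add: q_def abs_mult del: of_nat_Suc)
  next
    case False
    then have x: "norm x > r + 1" by (simp add: C_def)
    then have "x \<notin> K" using r(1) by force
    moreover have "norm x - norm (e m) \<le> norm (e m + x)"
      using norm_triangle_ineq2[of x "- e m"] by (simp add: add.commute)
    then have "e m + x \<notin> K" using r(1)[of "e m + x"] x e(2)[of m] by force
    ultimately show ?thesis using False K(2) by (simp add: q_def)
  qed
  have dom: "integrable lborel (\<lambda>x. L * indicator C x)" using C by (intro integrable_mult_right integrable_real_indicator) auto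
  have mq: "q m \<in> borel_measurable lborel" for m
    unfolding q_def[abs_def] using mW by simp
  have mp: "pd a W \<in> borel_measurable lborel"
    using smooth_on_imp_continuous_on[OF smooth_on_pd[OF W]] by (simp add: borel_measurable_continuous_onI)
  have "AE x in lborel. (\<lambda>m. q m x) \<longlonglongrightarrow> pd a W x" using lim by simp
  moreover have "AE x in lborel. norm (q m x) \<le> L * indicator C x" for m using qb by simp
  ultimately show "integrable lborel (pd a W)"
    by (rule integrable_dominated_convergence[OF mp mq dom])
  have "(\<lambda>m. \<integral>x. q m x \<partial>lborel) \<longlonglongrightarrow> (\<integral>x. pd a W x \<partial>lborel)"
    by (rule integral_dominated_convergence[OF mp mq dom]) (use lim qb in auto)
  then have "(\<lambda>m. 0) \<longlonglongrightarrow> (\<integral>x. pd a W x \<partial>lborel)" by (simp only: q0)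
  then show "(\<integral>x. pd a W x \<partial>lborel) = 0" by (rule LIMSEQ_unique) (rule tendsto_const)
qed

section \<open>The Riemannian measure\<close>

context smooth_manifold
begin

definition vol_density :: "('a \<Rightarrow> real^'n^'n) \<Rightarrow> ('a, 'n) chart \<Rightarrow> real^'n \<Rightarrow> real" where
  "vol_density g \<kappa> x = sqrt (det (coords_ten A \<kappa> g x))"

definition chart_volume :: "('a \<Rightarrow> real^'n^'n) \<Rightarrow> ('a, 'n) chart \<Rightarrow> 'a set \<Rightarrow> ennreal" where
  "chart_volume g \<kappa> B = (\<integral>\<^sup>+x\<in>cmap \<kappa> ` B. ennreal (vol_density g \<kappa> x) \<partial>lborel)"

lemma vol_density_pos:
  "riemannian_metric A g \<Longrightarrow> \<kappa> \<in> A \<Longrightarrow> x \<in> cimg \<kappa> \<Longrightarrow> vol_density g \<kappa> x > 0"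
  unfolding vol_density_def by (simp add: coords_metric_det_pos)

lemma smooth_vol_density:
  assumes "riemannian_metric A g" "\<kappa> \<in> A"
  shows "smooth_on (cimg \<kappa>) (vol_density g \<kappa>)"
  unfolding vol_density_def[abs_def]
  by (rule smooth_on_compose[OF open_cimg[OF assms(2)] open_greaterThan smooth_on_sqrt
        smooth_on_det[OF open_cimg[OF assms(2)] sym_tensorD(1)[OF metricD(1)[OF assms(1)] assms(2)]]])
    (use coords_metric_det_pos[OF assms] in simp)

lemma chart_image_eq:
  assumes "\<kappa> \<in> A" "B \<subseteq> cdom \<kappa>"
  shows "cmap \<kappa> ` B = cinv \<kappa> -` B \<inter> cimg \<kappa>"
proof (rule set_eqI, rule iffI)
  fix x assume "x \<in> cmap \<kappa> ` B"
  then obtain p where p: "p \<in> B" "x = cmap \<kappa> p" by (rule imageE)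
  then show "x \<in> cinv \<kappa> -` B \<inter> cimg \<kappa>" using cinv_cmap[OF assms(1) subsetD[OF assms(2) p(1)]] assms(2) by auto
next
  fix x assume "x \<in> cinv \<kappa> -` B \<inter> cimg \<kappa>"
  then have x: "cinv \<kappa> x \<in> B" "x \<in> cimg \<kappa>" by simp_all
  show "x \<in> cmap \<kappa> ` B" by (rule image_eqI[of _ _ "cinv \<kappa> x"]) (simp_all add: x(1) cmap_cinv[OF x(2)])
qed

lemma measurable_cinv: "\<kappa> \<in> A \<Longrightarrow> cinv \<kappa> \<in> borel_measurable (restrict_space borel (cimg \<kappa>))"
  by (rule borel_measurable_continuous_on_restrict[OF continuous_on_cinv])

lemma borel_chart_image:
  assumes \<kappa>: "\<kappa> \<in> A" and B: "B \<in> sets borel" "B \<subseteq> cdom \<kappa>"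
  shows "cmap \<kappa> ` B \<in> sets borel"
proof -
  have "cinv \<kappa> -` B \<inter> cimg \<kappa> \<in> sets (restrict_space borel (cimg \<kappa>))"
    using measurable_sets[OF measurable_cinv[OF \<kappa>] B(1)] by (simp add: space_restrict_space)
  then show ?thesis
    unfolding chart_image_eq[OF \<kappa> B(2)] using open_cimg[OF \<kappa>] by (simp add: sets_restrict_space_iff)
qed

lemma measurable_indicator_continuous:
  fixes f :: "real^'n \<Rightarrow> real"
  assumes "open U" "continuous_on U f" "S \<in> sets borel" "S \<subseteq> U"
  shows "(\<lambda>x. indicator S x * f x) \<in> borel_measurable borel"
  using borel_measurable_continuous_on_indicator[OF assms(3) continuous_on_subset[OF assms(2,4)]] by simp

text \<open>The density \<open>sqrt (det g)\<close> picks up the absolute value of the Jacobian determinant, as required by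
  the change of variables formula.\<close>

lemma chart_volume_change:
  assumes g: "riemannian_metric A g" and \<kappa>: "\<kappa> \<in> A" and \<tau>: "\<tau> \<in> A"
    and B: "B \<in> sets borel" "B \<subseteq> cdom \<kappa>" "B \<subseteq> cdom \<tau>"
  shows "chart_volume g \<kappa> B = chart_volume g \<tau> B"
proof -
  let ?T = "transition \<kappa> \<tau>" let ?S = "cmap \<kappa> ` B"
  have So: "?S \<subseteq> overlap \<kappa> \<tau>" using B by (auto simp: overlap_def)
  have TS: "?T ` ?S = cmap \<tau> ` B"
    unfolding image_image by (rule image_cong) (use B cinv_cmap[OF \<kappa>] in \<open>auto simp: transition_def subset_iff\<close>)
  have dens: "\<bar>det (matrix (frechet_derivative ?T (at x)))\<bar> * vol_density g \<tau> (?T x) = vol_density g \<kappa> x" if x: "x \<in> ?S" for x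
  proof -
    from x obtain p where p: "p \<in> B" "x = cmap \<kappa> p" by (rule imageE)
    have p': "p \<in> cdom \<kappa>" "p \<in> cdom \<tau>" using p B by auto
    have "?T x = cmap \<tau> p" using cinv_cmap[OF \<kappa> p'(1)] p by (simp add: transition_def)
    moreover have "matrix (frechet_derivative ?T (at x)) = jac \<kappa> \<tau> p" by (simp add: jac_def jacobian_def p(2))
    moreover have "det (coords_ten A \<kappa> g (cmap \<kappa> p)) = (det (jac \<kappa> \<tau> p) * det (jac \<kappa> \<tau> p)) * det (coords_ten A \<tau> g (cmap \<tau> p))"
      unfolding coords_ten_change[OF \<kappa> \<tau> p', of g] by (simp add: det_mul)
    then have "vol_density g \<kappa> x = sqrt (det (jac \<kappa> \<tau> p) * det (jac \<kappa> \<tau> p)) * vol_density g \<tau> (cmap \<tau> p)"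
      unfolding vol_density_def p(2) using real_sqrt_mult by (simp only:)
    ultimately show ?thesis by (simp only: real_sqrt_abs2)
  qed
  have S: "?S \<in> sets borel" by (rule borel_chart_image[OF \<kappa> B(1,2)])
  have "(\<integral>\<^sup>+y\<in>?T ` ?S. ennreal (vol_density g \<tau> y) \<partial>lborel)
     = (\<integral>\<^sup>+x\<in>?S. ennreal (\<bar>det (matrix (frechet_derivative ?T (at x)))\<bar> * vol_density g \<tau> (?T x)) \<partial>lborel)"
  proof (rule nn_integral_change_of_variables[OF S])
    show "(?T has_derivative frechet_derivative ?T (at x)) (at x within ?S)" if "x \<in> ?S" for x
      using smooth_on_has_derivative[OF smooth_transition[OF \<kappa> \<tau>] subsetD[OF So that]] by (rule has_derivative_at_withinI)
    show "inj_on ?T ?S"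
    proof (rule inj_onI)
      fix x y assume xy: "x \<in> ?S" "y \<in> ?S" "?T x = ?T y"
      then have "cinv \<kappa> x = cinv \<kappa> y"
        using cinv_transition[OF \<kappa> \<tau> subsetD[OF So xy(1)]] cinv_transition[OF \<kappa> \<tau> subsetD[OF So xy(2)]] by simp
      then have "cmap \<kappa> (cinv \<kappa> x) = cmap \<kappa> (cinv \<kappa> y)" by (rule arg_cong)
      then show "x = y"
        by (simp only: cmap_cinv[OF overlapD(1)[OF \<kappa> subsetD[OF So xy(1)]]] cmap_cinv[OF overlapD(1)[OF \<kappa> subsetD[OF So xy(2)]]])
    qed
    show "0 \<le> vol_density g \<tau> (?T x)" if "x \<in> ?S" for x
    proof -
      have "?T x \<in> cmap \<tau> ` B" using TS that by blast
      then have "?T x \<in> cimg \<tau>" using B(3) by blast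
      then show ?thesis using vol_density_pos[OF g \<tau>] by (simp add: less_imp_le)
    qed
    show "(\<lambda>y. indicator (?T ` ?S) y * vol_density g \<tau> y) \<in> borel_measurable borel"
      unfolding TS
      by (rule measurable_indicator_continuous[OF open_cimg[OF \<tau>] smooth_on_imp_continuous_on[OF smooth_vol_density[OF g \<tau>]]
            borel_chart_image[OF \<tau> B(1,3)]]) (use B(3) in blast)
    have "(\<lambda>x. indicator ?S x * vol_density g \<kappa> x) \<in> borel_measurable borel"
      by (rule measurable_indicator_continuous[OF open_cimg[OF \<kappa>] smooth_on_imp_continuous_on[OF smooth_vol_density[OF g \<kappa>]] S])
        (use B(2) in blast)
    moreover have "indicator ?S x * vol_density g \<kappa> x =
        indicator ?S x * (\<bar>det (matrix (frechet_derivative ?T (at x)))\<bar> * vol_density g \<tau> (?T x))" for x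
      using dens[of x] by (simp split: split_indicator)
    ultimately show "(\<lambda>x. indicator ?S x * (\<bar>det (matrix (frechet_derivative ?T (at x)))\<bar> * vol_density g \<tau> (?T x))) \<in> borel_measurable borel"
      by simp
  qed
  also have "\<dots> = chart_volume g \<kappa> B"
    unfolding chart_volume_def by (intro nn_integral_cong) (use dens in \<open>simp split: split_indicator\<close>)
  finally show ?thesis unfolding TS chart_volume_def[of g \<tau>] by simp
qed

text \<open>Off the image of the chart, where \<open>chart_measure\<close> has density zero, the map is made constant so that
  it is measurable on the whole space.\<close>

definition chart_inverse :: "('a, 'n) chart \<Rightarrow> real^'n \<Rightarrow> 'a" where
  "chart_inverse \<kappa> x = (if x \<in> cimg \<kappa> then cinv \<kappa> x else undefined)"

definition chart_measure :: "('a \<Rightarrow> real^'n^'n) \<Rightarrow> ('a, 'n) chart \<Rightarrow> 'a measure" where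
  "chart_measure g \<kappa> = distr (density lborel (\<lambda>x. ennreal (indicator (cimg \<kappa>) x * vol_density g \<kappa> x))) borel (chart_inverse \<kappa>)"

lemma measurable_chart_inverse: "\<kappa> \<in> A \<Longrightarrow> chart_inverse \<kappa> \<in> borel_measurable borel"
  unfolding chart_inverse_def[abs_def]
  by (subst measurable_If_restrict_space_iff) (use measurable_cinv open_cimg in auto)

lemma measurable_vol_density:
  "riemannian_metric A g \<Longrightarrow> \<kappa> \<in> A \<Longrightarrow> (\<lambda>x. indicator (cimg \<kappa>) x * vol_density g \<kappa> x) \<in> borel_measurable borel"
  by (rule measurable_indicator_continuous[OF open_cimg smooth_on_imp_continuous_on[OF smooth_vol_density]])
    (use open_cimg in auto)

lemma emeasure_chart_measure:
  assumes g: "riemannian_metric A g" and \<kappa>: "\<kappa> \<in> A" and B: "B \<in> sets borel"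
  shows "emeasure (chart_measure g \<kappa>) B = chart_volume g \<kappa> (B \<inter> cdom \<kappa>)"
proof -
  let ?w = "\<lambda>x. ennreal (indicator (cimg \<kappa>) x * vol_density g \<kappa> x)"
  have m: "chart_inverse \<kappa> \<in> measurable (density lborel ?w) borel" using measurable_chart_inverse[OF \<kappa>] by simp
  have s: "chart_inverse \<kappa> -` B \<in> sets borel" using measurable_sets[OF measurable_chart_inverse[OF \<kappa>] B] by simp
  have "emeasure (chart_measure g \<kappa>) B = emeasure (density lborel ?w) (chart_inverse \<kappa> -` B)"
    unfolding chart_measure_def using emeasure_distr[OF m B] by simp
  also have "\<dots> = (\<integral>\<^sup>+x. ?w x * indicator (chart_inverse \<kappa> -` B) x \<partial>lborel)"
    by (rule emeasure_density) (use measurable_vol_density[OF g \<kappa>] s in auto)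
  also have "\<dots> = chart_volume g \<kappa> (B \<inter> cdom \<kappa>)"
    unfolding chart_volume_def
  proof (rule nn_integral_cong)
    fix x
    have "x \<in> cmap \<kappa> ` (B \<inter> cdom \<kappa>) \<longleftrightarrow> x \<in> cimg \<kappa> \<and> chart_inverse \<kappa> x \<in> B"
      unfolding chart_image_eq[OF \<kappa> Int_lower2] by (auto simp: chart_inverse_def cinv_in_cdom)
    then show "?w x * indicator (chart_inverse \<kappa> -` B) x = ennreal (vol_density g \<kappa> x) * indicator (cmap \<kappa> ` (B \<inter> cdom \<kappa>)) x"
      by (auto split: split_indicator)
  qed
  finally show ?thesis .
qed

end

context closed_manifold
begin

text \<open>The property in the definite description of the Riemannian measure.\<close>

definition is_riemannian_measure :: "('a \<Rightarrow> real^'n^'n) \<Rightarrow> 'a measure \<Rightarrow> bool" where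
  "is_riemannian_measure g \<mu> \<longleftrightarrow> sets \<mu> = sets borel \<and>
    (\<forall>\<kappa>\<in>A. \<forall>B\<in>sets borel. B \<subseteq> cdom \<kappa> \<longrightarrow> emeasure \<mu> B = chart_volume g \<kappa> B)"

text \<open>Finitely many chart domains cover the manifold; subtract from each one its predecessors.\<close>

lemma finite_borel_partition:
  obtains N :: nat and c :: "nat \<Rightarrow> ('a, 'n) chart" and E :: "nat \<Rightarrow> 'a set" where
    "\<And>i. c i \<in> A" "\<And>i. E i \<subseteq> cdom (c i)" "\<And>i. E i \<in> sets borel" "disjoint_family E" "(\<Union>i<N. E i) = UNIV"
proof -
  obtain P where P: "finite P" "UNIV \<subseteq> (\<Union>s\<in>P. cdom (chart_at A s))"
    using compactE_image[OF compact_manifold, of UNIV "\<lambda>s. cdom (chart_at A s)"] open_cdom[OF chart_at(1)] chart_at(2)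
    by (metis UNIV_I UN_I subsetI)
  obtain f :: "nat \<Rightarrow> 'a" and N where f: "P = f ` {i. i < N}"
    using P(1) unfolding finite_conv_nat_seg_image by (elim exE)
  define c where "c i = chart_at A (f i)" for i
  define E where "E = disjointed (\<lambda>i. cdom (c i))"
  show ?thesis
  proof (rule that[of c E N])
    show "c i \<in> A" for i by (simp add: c_def chart_at)
    show "E i \<subseteq> cdom (c i)" for i unfolding E_def by (rule disjointed_subset)
    show "E i \<in> sets borel" for i
      unfolding E_def disjointed_def by (intro sets.Diff sets.finite_UN borel_open open_cdom) (auto simp: c_def chart_at)
    show "disjoint_family E" unfolding E_def by (rule disjoint_family_disjointed)
    have "(\<Union>i<N. E i) = (\<Union>i<N. cdom (c i))"
      using finite_UN_disjointed_eq[of "\<lambda>i. cdom (c i)" N] by (simp add: E_def atLeast0LessThan)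
    also have "\<dots> = (\<Union>s\<in>P. cdom (chart_at A s))" unfolding f c_def by (simp add: lessThan_def)
    finally show "(\<Union>i<N. E i) = UNIV" using P(2) by (simp add: top.extremum_unique)
  qed
qed

text \<open>Glue the chart measures along a finite partition into Borel sets, each inside one chart
  domain. The result has the right density in every chart by \<open>chart_volume_change\<close>, and any other
  candidate agrees with it on each piece.\<close>

lemma riemannian_measure_unique_existence:
  assumes g: "riemannian_metric A g"
  shows "\<exists>!\<mu>. is_riemannian_measure g \<mu>"
proof -
  obtain N and c :: "nat \<Rightarrow> ('a, 'n) chart" and E where c: "\<And>i::nat. c i \<in> A" and E: "\<And>i. E i \<subseteq> cdom (c i)" "\<And>i. E i \<in> sets borel"
    "disjoint_family E" "(\<Union>i<N. E i) = UNIV"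
    by (rule finite_borel_partition) (rule that, assumption+)
  define F where "F B = (\<Sum>i<N. emeasure (chart_measure g (c i)) (B \<inter> E i))" for B
  define \<mu> where "\<mu> = measure_of UNIV (sets borel) F"
  have setsN: "sets (chart_measure g \<kappa>) = sets borel" for \<kappa> by (simp add: chart_measure_def)
  have sa: "sigma_algebra UNIV (sets (borel :: 'a measure))" using sets.sigma_algebra_axioms[of borel] by simp
  have pos: "positive (sets borel) F" by (simp add: positive_def F_def)
  have ca: "countably_additive (sets borel) F"
  proof (rule countably_additiveI)
    fix B :: "nat \<Rightarrow> 'a set" assume B: "range B \<subseteq> sets borel" "disjoint_family B" "(\<Union>i. B i) \<in> sets borel"
    have "(\<Sum>n. F (B n)) = (\<Sum>i<N. \<Sum>n. emeasure (chart_measure g (c i)) (B n \<inter> E i))"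
      unfolding F_def by (rule suminf_sum) simp
    also have "\<dots> = (\<Sum>i<N. emeasure (chart_measure g (c i)) (\<Union>n. B n \<inter> E i))"
    proof (intro sum.cong refl suminf_emeasure)
      show "range (\<lambda>n. B n \<inter> E i) \<subseteq> sets (chart_measure g (c i))" for i using B(1) E(2) by (auto simp: setsN)
      show "disjoint_family (\<lambda>n. B n \<inter> E i)" for i using B(2) by (auto simp: disjoint_family_on_def)
    qed
    also have "\<dots> = F (\<Union>i. B i)" by (simp add: F_def)
    finally show "(\<Sum>n. F (B n)) = F (\<Union>i. B i)" .
  qed
  have em: "emeasure \<mu> B = F B" if "B \<in> sets borel" for B
    unfolding \<mu>_def by (rule emeasure_measure_of_sigma[OF sa pos ca that])
  have sets\<mu>: "sets \<mu> = sets borel" unfolding \<mu>_def using sigma_algebra.sets_measure_of_eq[OF sa] by simp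
  have split: "(\<Sum>i<N. m (B \<inter> E i)) = m B"
    if "m = emeasure \<nu>" "sets \<nu> = sets borel" "B \<in> sets borel" for B \<nu> and m :: "'a set \<Rightarrow> ennreal"
  proof -
    have "(\<Sum>i<N. emeasure \<nu> (B \<inter> E i)) = emeasure \<nu> (\<Union>i<N. B \<inter> E i)"
    proof (rule sum_emeasure)
      show "(\<lambda>i. B \<inter> E i) ` {..<N} \<subseteq> sets \<nu>" using that(2,3) E(2) by auto
      show "disjoint_family_on (\<lambda>i. B \<inter> E i) {..<N}"
        using E(3) unfolding disjoint_family_on_def by blast
    qed simp
    also have "(\<Union>i<N. B \<inter> E i) = B" using E(4) by blast
    finally show ?thesis using that by simp
  qed
  have ex: "is_riemannian_measure g \<mu>"
    unfolding is_riemannian_measure_def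
  proof (intro conjI ballI impI)
    fix \<kappa> and B :: "'a set" assume \<kappa>: "\<kappa> \<in> A" and B: "B \<in> sets borel" "B \<subseteq> cdom \<kappa>"
    have "emeasure (chart_measure g (c i)) (B \<inter> E i) = emeasure (chart_measure g \<kappa>) (B \<inter> E i)" for i
    proof -
      have BE: "B \<inter> E i \<in> sets borel" "B \<inter> E i \<subseteq> cdom (c i)" "B \<inter> E i \<subseteq> cdom \<kappa>" using B E by auto
      show ?thesis
        unfolding emeasure_chart_measure[OF g c BE(1)] emeasure_chart_measure[OF g \<kappa> BE(1)] Int_absorb2[OF BE(2)] Int_absorb2[OF BE(3)]
        by (rule chart_volume_change[OF g c \<kappa> BE])
    qed
    then have "emeasure \<mu> B = emeasure (chart_measure g \<kappa>) B"
      using split[OF refl setsN[of \<kappa>] B(1)] by (simp add: em[OF B(1)] F_def)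
    then show "emeasure \<mu> B = chart_volume g \<kappa> B"
      using emeasure_chart_measure[OF g \<kappa> B(1)] Int_absorb2[OF B(2)] by simp
  qed (fact sets\<mu>)
  show ?thesis
  proof (rule ex1I[where P = "is_riemannian_measure g", OF ex])
    fix \<nu> assume \<nu>: "is_riemannian_measure g \<nu>"
    show "\<nu> = \<mu>"
    proof (rule measure_eqI)
      show "sets \<nu> = sets \<mu>" using \<nu> sets\<mu> by (simp add: is_riemannian_measure_def)
      fix B assume "B \<in> sets \<nu>"
      then have B: "B \<in> sets borel" using \<nu> by (simp add: is_riemannian_measure_def)
      have "emeasure \<nu> (B \<inter> E i) = emeasure \<mu> (B \<inter> E i)" for i
      proof -
        have "B \<inter> E i \<in> sets borel" "B \<inter> E i \<subseteq> cdom (c i)" using B E by auto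
        then show ?thesis using \<nu> ex c[of i] by (simp add: is_riemannian_measure_def)
      qed
      then show "emeasure \<nu> B = emeasure \<mu> B"
        using split[OF refl _ B, of \<nu>] split[OF refl sets\<mu> B] \<nu> by (simp add: is_riemannian_measure_def)
    qed
  qed
qed

lemma riemannian_measure_properties:
  assumes g: "riemannian_metric A g"
  shows "sets (riemannian_measure A g) = sets borel"
    "\<And>\<kappa> B. \<kappa> \<in> A \<Longrightarrow> B \<in> sets borel \<Longrightarrow> B \<subseteq> cdom \<kappa> \<Longrightarrow> emeasure (riemannian_measure A g) B = chart_volume g \<kappa> B"
proof -
  have "riemannian_measure A g = (THE \<mu>. is_riemannian_measure g \<mu>)"
    unfolding riemannian_measure_def is_riemannian_measure_def chart_volume_def vol_density_def ..
  then have "is_riemannian_measure g (riemannian_measure A g)"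
    using theI'[OF riemannian_measure_unique_existence[OF g]] by simp
  then show "sets (riemannian_measure A g) = sets borel"
    "\<And>\<kappa> B. \<kappa> \<in> A \<Longrightarrow> B \<in> sets borel \<Longrightarrow> B \<subseteq> cdom \<kappa> \<Longrightarrow> emeasure (riemannian_measure A g) B = chart_volume g \<kappa> B"
    by (simp_all add: is_riemannian_measure_def)
qed

text \<open>The supports of a partition of unity are finitely many sets that cover the manifold; each lies in
  a compact part of a chart domain, where the density is bounded.\<close>

lemma finite_riemannian_measure:
  assumes g: "riemannian_metric A g"
  shows "emeasure (riemannian_measure A g) UNIV < \<infinity>"
proof -
  let ?\<mu> = "riemannian_measure A g"
  note \<mu> = riemannian_measure_properties[OF g]
  obtain P \<rho> K where P: "finite P" "\<And>s. smooth_fun A (\<rho> s)" "\<And>s. compact (K s)" "\<And>s. K s \<subseteq> cimg (chart_at A s)"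
    "\<And>s p. p \<notin> cinv (chart_at A s) ` K s \<Longrightarrow> \<rho> s p = 0" "\<And>p. (\<Sum>s\<in>P. \<rho> s p) = 1"
    by (rule partition_of_unity) (rule that, assumption+)
  define B where "B s = cinv (chart_at A s) ` K s" for s
  have Bb: "B s \<in> sets borel" for s
    unfolding B_def by (intro borel_closed compact_imp_closed compact_cinv_image chart_at P)
  have fin: "emeasure ?\<mu> (B s) < \<infinity>" for s
  proof -
    let ?\<kappa> = "chart_at A s"
    have Bd: "B s \<subseteq> cdom ?\<kappa>" unfolding B_def using cinv_in_cdom[OF subsetD[OF P(4)]] by (rule image_subsetI)
    have im: "cmap ?\<kappa> ` B s = K s"
      unfolding B_def image_image using cmap_cinv[OF subsetD[OF P(4)]] by simp
    have "compact (vol_density g ?\<kappa> ` K s)"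
      by (intro compact_continuous_image P continuous_on_subset[OF smooth_on_imp_continuous_on[OF smooth_vol_density[OF g chart_at(1)]]])
    from compact_imp_bounded[OF this] obtain C where C: "\<forall>z\<in>vol_density g ?\<kappa> ` K s. norm z \<le> C"
      unfolding bounded_iff by blast
    have "emeasure ?\<mu> (B s) = (\<integral>\<^sup>+x\<in>K s. ennreal (vol_density g ?\<kappa> x) \<partial>lborel)"
      using \<mu>(2)[OF chart_at(1) Bb Bd] by (simp add: chart_volume_def im)
    also have "\<dots> \<le> (\<integral>\<^sup>+x. ennreal C * indicator (K s) x \<partial>lborel)"
    proof (rule nn_integral_mono)
      fix x
      have "vol_density g ?\<kappa> x \<le> C" if "x \<in> K s" using C that by (auto simp: abs_le_iff)
      then show "ennreal (vol_density g ?\<kappa> x) * indicator (K s) x \<le> ennreal C * indicator (K s) x"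
        by (cases "x \<in> K s") (simp_all add: ennreal_leI)
    qed
    also have "\<dots> = ennreal C * emeasure lborel (K s)"
      using P(3)[of s] by (intro nn_integral_cmult_indicator) (simp add: borel_compact)
    also have "\<dots> < \<infinity>"
      using emeasure_compact_finite[OF P(3)[of s]] by (simp add: ennreal_mult_less_top)
    finally show ?thesis .
  qed
  have cover: "UNIV = (\<Union>s\<in>P. B s)"
  proof -
    have "\<exists>s\<in>P. p \<in> B s" for p
    proof (rule ccontr)
      assume "\<not> (\<exists>s\<in>P. p \<in> B s)"
      then have "(\<Sum>s\<in>P. \<rho> s p) = 0" by (intro sum.neutral ballI P(5)) (auto simp: B_def)
      then show False using P(6)[of p] by simp
    qed
    then show ?thesis by blast
  qed
  have "emeasure ?\<mu> UNIV \<le> (\<Sum>s\<in>P. emeasure ?\<mu> (B s))"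
    unfolding cover by (rule emeasure_subadditive_finite[OF P(1)]) (use Bb \<mu>(1) in auto)
  also have "\<dots> < \<infinity>" using fin by (simp add: ennreal_sum_less_top P(1))
  finally show ?thesis .
qed

lemma integrable_smooth_fun:
  assumes g: "riemannian_metric A g" and f: "smooth_fun A f"
  shows "integrable (riemannian_measure A g) f"
proof -
  let ?\<mu> = "riemannian_measure A g"
  have c: "continuous_on UNIV f" by (rule smooth_fun_continuous[OF f])
  have "f \<in> borel_measurable borel" using c by (rule borel_measurable_continuous_onI)
  then have m: "f \<in> borel_measurable ?\<mu>"
    using measurable_cong_sets[OF riemannian_measure_properties(1)[OF g] refl] by blast
  obtain C where C: "\<And>p. norm (f p) \<le> C"
    using compact_imp_bounded[OF compact_continuous_image[OF c compact_manifold]] by (auto simp: bounded_iff)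
  have fin: "finite_measure ?\<mu>"
    using finite_riemannian_measure[OF g] sets_eq_imp_space_eq[OF riemannian_measure_properties(1)[OF g]]
    by (intro finite_measureI) (simp add: less_top)
  show ?thesis
    by (rule finite_measure.integrable_const_bound[OF fin _ m, of C]) (rule AE_I2, rule C)
qed

lemma integral_in_chart:
  assumes g: "riemannian_metric A g" and \<kappa>: "\<kappa> \<in> A" and f: "f \<in> borel_measurable borel"
    and supp: "\<And>p. p \<notin> cdom \<kappa> \<Longrightarrow> f p = (0::real)"
  shows "(\<integral>p. f p \<partial>riemannian_measure A g) = (\<integral>x. (indicator (cimg \<kappa>) x * vol_density g \<kappa> x) * f (chart_inverse \<kappa> x) \<partial>lborel)"
proof -
  let ?\<mu> = "riemannian_measure A g" let ?w = "\<lambda>x. indicator (cimg \<kappa>) x * vol_density g \<kappa> x"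
  note \<mu> = riemannian_measure_properties[OF g]
  have dom: "cdom \<kappa> \<in> sets ?\<mu>" using open_cdom[OF \<kappa>] by (simp add: \<mu>(1))
  have fm: "f \<in> borel_measurable ?\<mu>" using f measurable_cong_sets[OF \<mu>(1) refl] by blast
  have eq: "density ?\<mu> (\<lambda>p. ennreal (indicator (cdom \<kappa>) p)) = chart_measure g \<kappa>"
  proof (rule measure_eqI)
    show "sets (density ?\<mu> (\<lambda>p. ennreal (indicator (cdom \<kappa>) p))) = sets (chart_measure g \<kappa>)"
      by (simp add: \<mu>(1) chart_measure_def)
    fix B assume "B \<in> sets (density ?\<mu> (\<lambda>p. ennreal (indicator (cdom \<kappa>) p)))"
    then have B: "B \<in> sets borel" by (simp add: \<mu>(1))
    have BI: "B \<inter> cdom \<kappa> \<in> sets borel" using B open_cdom[OF \<kappa>] by auto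
    have "emeasure (density ?\<mu> (\<lambda>p. ennreal (indicator (cdom \<kappa>) p))) B = (\<integral>\<^sup>+p. ennreal (indicator (cdom \<kappa>) p) * indicator B p \<partial>?\<mu>)"
    proof (rule emeasure_density)
      show "(\<lambda>p. ennreal (indicator (cdom \<kappa>) p)) \<in> borel_measurable ?\<mu>" using dom by simp
      show "B \<in> sets ?\<mu>" using B by (simp add: \<mu>(1))
    qed
    also have "\<dots> = (\<integral>\<^sup>+p. indicator (B \<inter> cdom \<kappa>) p \<partial>?\<mu>)"
      by (intro nn_integral_cong) (simp split: split_indicator)
    also have "\<dots> = emeasure ?\<mu> (B \<inter> cdom \<kappa>)" by (rule nn_integral_indicator) (use BI in \<open>simp add: \<mu>(1)\<close>)
    also have "\<dots> = emeasure (chart_measure g \<kappa>) B"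
      unfolding emeasure_chart_measure[OF g \<kappa> B] by (rule \<mu>(2)[OF \<kappa> BI]) simp
    finally show "emeasure (density ?\<mu> (\<lambda>p. ennreal (indicator (cdom \<kappa>) p))) B = emeasure (chart_measure g \<kappa>) B" .
  qed
  have "(\<integral>p. f p \<partial>?\<mu>) = (\<integral>p. indicator (cdom \<kappa>) p *\<^sub>R f p \<partial>?\<mu>)"
    by (intro Bochner_Integration.integral_cong refl) (use supp in \<open>simp split: split_indicator\<close>)
  also have "\<dots> = (\<integral>p. f p \<partial>chart_measure g \<kappa>)"
    unfolding eq[symmetric] by (rule integral_density[symmetric]) (use fm dom in auto)
  also have "\<dots> = (\<integral>x. f (chart_inverse \<kappa> x) \<partial>density lborel (\<lambda>x. ennreal (?w x)))"
    unfolding chart_measure_def by (rule integral_distr) (use measurable_chart_inverse[OF \<kappa>] f in auto)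
  also have "\<dots> = (\<integral>x. ?w x *\<^sub>R f (chart_inverse \<kappa> x) \<partial>lborel)"
  proof (rule integral_density)
    show "(\<lambda>x. f (chart_inverse \<kappa> x)) \<in> borel_measurable lborel"
      using measurable_compose[OF measurable_chart_inverse[OF \<kappa>] f] by simp
    show "?w \<in> borel_measurable lborel" using measurable_vol_density[OF g \<kappa>] by simp
    show "AE x in lborel. 0 \<le> ?w x"
      using vol_density_pos[OF g \<kappa>] by (intro AE_I2) (simp add: less_imp_le split: split_indicator)
  qed
  finally show ?thesis by simp
qed

subsection \<open>The divergence theorem\<close>

text \<open>In the chart the integrand is \<open>\<Sum>\<^sub>a \<partial>\<^sub>a W\<^sub>a\<close> with \<open>W\<^sub>a = sqrt (det g) Y\<^sup>a\<close>, which extends by zero to a smooth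
  function with compact support.\<close>

lemma divergence_theorem_local:
  assumes g: "riemannian_metric A g" and X: "vector_field A X" and \<kappa>: "\<kappa> \<in> A" and K: "compact K" "K \<subseteq> cimg \<kappa>"
    and supp: "\<And>p. p \<notin> cinv \<kappa> ` K \<Longrightarrow> X p = 0"
  shows "(\<integral>p. divergence A g X p \<partial>riemannian_measure A g) = 0"
proof -
  let ?U = "cimg \<kappa>" let ?G = "coords_ten A \<kappa> g" let ?Y = "coords_vec A \<kappa> X"
  note gs = metricD(1)[OF g]
  have U: "open ?U" by (rule open_cimg[OF \<kappa>])
  have cK: "open (- K)" using K by (simp add: compact_imp_closed open_Compl)
  have Y0: "?Y x = 0" if "x \<in> ?U" "x \<notin> K" for x
    by (rule coords_vec_outside_support[OF K(2) supp that])
  define W where "W a x = (if x \<in> ?U then vol_density g \<kappa> x * ?Y x $ a else 0)" for a x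
  have W0: "W a x = 0" if "x \<notin> K" for a x using Y0[of x] that by (simp add: W_def)
  have sY: "smooth_on ?U ?Y" by (rule smooth_coords_vec[OF X \<kappa>])
  have W: "smooth_on UNIV (W a)" for a
    unfolding W_def[abs_def]
    by (rule smooth_on_extend_by_zero[OF U smooth_on_mult[OF U smooth_vol_density[OF g \<kappa>] smooth_on_nth[OF U sY, of a]] K])
      (simp add: Y0)
  have div0: "divergence A g X p = 0" if p: "p \<notin> cdom \<kappa>" for p
  proof -
    have "lie_ten A X g p = 0"
      by (rule lie_ten_zero[OF X gs open_compl_cinv_image[OF \<kappa> K]])
        (use supp outside_chart_outside_support[OF K(2) p] in auto)
    then show ?thesis by (simp add: divergence_lie_ten[OF g X] trace_def)
  qed
  have integrand: "(indicator ?U x * vol_density g \<kappa> x) * divergence A g X (chart_inverse \<kappa> x) = (\<Sum>a\<in>UNIV. pd a (W a) x)" for x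
  proof (cases "x \<in> ?U")
    case True
    define p where "p = cinv \<kappa> x"
    have p: "p \<in> cdom \<kappa>" "cmap \<kappa> p = x" by (simp_all add: p_def cinv_in_cdom[OF True] cmap_cinv[OF True])
    have dG: "?G differentiable (at x)" by (rule differentiable_coords_ten[OF gs \<kappa> True])
    have dY: "?Y differentiable (at x)" by (rule differentiable_coords_vec[OF X \<kappa> True])
    have sym: "transpose (?G y) = ?G y" for y by (rule coords_ten_sym) (rule metricD(2)[OF g])
    have det: "det (?G x) > 0" by (rule coords_metric_det_pos[OF g \<kappa> True])
    have "divergence A g X p = (\<Sum>a\<in>UNIV. cov_deriv ?G ?Y x a a)"
      using divergence_eq_trace[OF g X \<kappa> p(1)] sum_cov_deriv[OF U True sym dG, of ?Y] det by (simp add: p(2))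
    then have "vol_density g \<kappa> x * divergence A g X p = (\<Sum>a\<in>UNIV. pd a (\<lambda>y. sqrt (det (?G y)) * ?Y y $ a) x)"
      unfolding vol_density_def using sqrt_det_divergence[OF U True sym dG det dY] by simp
    also have "\<dots> = (\<Sum>a\<in>UNIV. pd a (W a) x)"
    proof (rule sum.cong[OF refl])
      fix a
      have "pd a (W a) x = pd a (\<lambda>y. sqrt (det (?G y)) * ?Y y $ a) x"
        by (rule pd_cong[OF U True smooth_on_differentiable[OF W]]) (simp_all add: W_def vol_density_def)
      then show "pd a (\<lambda>y. sqrt (det (?G y)) * ?Y y $ a) x = pd a (W a) x" by simp
    qed
    finally show ?thesis using True by (simp add: chart_inverse_def p_def)
  next
    case False
    then have x: "x \<in> - K" using K(2) by blast
    have "pd a (W a) x = 0" for a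
    proof -
      have "pd a (W a) x = pd a (\<lambda>y. 0) x"
        by (rule pd_cong[OF cK x smooth_on_differentiable[OF W]]) (simp_all add: W0)
      then show ?thesis by (simp add: pd_def)
    qed
    then show ?thesis using False by simp
  qed
  have "(\<integral>p. divergence A g X p \<partial>riemannian_measure A g) = (\<integral>x. (\<Sum>a\<in>UNIV. pd a (W a) x) \<partial>lborel)"
    unfolding integrand[symmetric]
    by (rule integral_in_chart[OF g \<kappa> borel_measurable_continuous_onI[OF smooth_fun_continuous[OF smooth_divergence[OF g X]]] div0])
  also have "\<dots> = (\<Sum>a\<in>UNIV. \<integral>x. pd a (W a) x \<partial>lborel)"
    by (rule Bochner_Integration.integral_sum) (rule integral_pd_compact_support(1)[OF W K(1) W0])
  also have "\<dots> = 0" by (simp add: integral_pd_compact_support(2)[OF W K(1) W0])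
  finally show ?thesis .
qed

theorem divergence_theorem:
  assumes g: "riemannian_metric A g" and X: "vector_field A X"
  shows "(\<integral>p. divergence A g X p \<partial>riemannian_measure A g) = 0"
proof -
  obtain P \<rho> K where P: "finite P" "\<And>s. smooth_fun A (\<rho> s)" "\<And>s. compact (K s)" "\<And>s. K s \<subseteq> cimg (chart_at A s)"
    "\<And>s p. p \<notin> cinv (chart_at A s) ` K s \<Longrightarrow> \<rho> s p = 0" "\<And>p. (\<Sum>s\<in>P. \<rho> s p) = 1"
    by (rule partition_of_unity) (rule that, assumption+)
  define Z where "Z s p = \<rho> s p *\<^sub>R X p" for s p
  have Z: "vector_field A (Z s)" for s unfolding Z_def[abs_def] by (rule vector_field_scaled[OF P(2) X])
  have XZ: "(\<lambda>p. \<Sum>s\<in>P. Z s p) = X"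
    by (simp add: Z_def fun_eq_iff scaleR_sum_left[symmetric] P(6))
  have "divergence A g X p = (\<Sum>s\<in>P. divergence A g (Z s) p)" for p
    using divergence_sum[where X = Z, OF g Z P(1)] X by (simp add: XZ)
  then have "(\<integral>p. divergence A g X p \<partial>riemannian_measure A g) = (\<integral>p. (\<Sum>s\<in>P. divergence A g (Z s) p) \<partial>riemannian_measure A g)"
    by simp
  also have "\<dots> = (\<Sum>s\<in>P. \<integral>p. divergence A g (Z s) p \<partial>riemannian_measure A g)"
    by (rule Bochner_Integration.integral_sum) (rule integrable_smooth_fun[OF g smooth_divergence[OF g Z]])
  also have "\<dots> = 0"
  proof (rule sum.neutral, rule ballI)
    fix s
    show "(\<integral>p. divergence A g (Z s) p \<partial>riemannian_measure A g) = 0"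
      by (rule divergence_theorem_local[OF g Z chart_at(1) P(3)[of s] P(4)[of s]]) (simp add: Z_def P(5))
  qed
  finally show ?thesis .
qed

text \<open>The divergence theorem for the field \<open>f X\<close>.\<close>

lemma integral_by_parts:
  assumes g: "riemannian_metric A g" and X: "vector_field A X" and f: "smooth_fun A f"
  shows "(\<integral>p. divergence A g X p * f p \<partial>riemannian_measure A g) = - (\<integral>p. lie_fun A X f p \<partial>riemannian_measure A g)"
proof -
  let ?\<mu> = "riemannian_measure A g" let ?Z = "\<lambda>p. f p *\<^sub>R X p"
  have Z: "vector_field A ?Z" by (rule vector_field_scaled[OF f X])
  have d: "divergence A g ?Z p = divergence A g X p * f p + lie_fun A X f p" for p
    using divergence_scaled[OF f X, of g p] by (simp add: mult.commute)
  have i1: "integrable ?\<mu> (\<lambda>p. divergence A g X p * f p)"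
    by (rule integrable_smooth_fun[OF g smooth_fun_mult[OF smooth_divergence[OF g X] f]])
  have "integrable ?\<mu> (\<lambda>p. divergence A g ?Z p - divergence A g X p * f p)"
    by (rule Bochner_Integration.integrable_diff[OF integrable_smooth_fun[OF g smooth_divergence[OF g Z]] i1])
  then have i2: "integrable ?\<mu> (lie_fun A X f)" by (simp add: d)
  have "0 = (\<integral>p. divergence A g X p * f p + lie_fun A X f p \<partial>?\<mu>)"
    using divergence_theorem[OF g Z] by (simp add: d)
  also have "\<dots> = (\<integral>p. divergence A g X p * f p \<partial>?\<mu>) + (\<integral>p. lie_fun A X f p \<partial>?\<mu>)"
    by (rule Bochner_Integration.integral_add[OF i1 i2])
  finally show ?thesis by simp
qed

end

context smooth_manifold
begin

text \<open>In a chart the invariant is a polynomial in partial derivatives of the components of the metric and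
  of its inverse.\<close>

lemma smooth_natural_scalar_invariant:
  assumes V: "natural_scalar_invariant A V" and g: "riemannian_metric A g"
  shows "smooth_fun A (V g)"
proof (rule smooth_funI)
  fix \<kappa> assume \<kappa>: "\<kappa> \<in> A"
  obtain e where e: "\<And>\<kappa> p. \<kappa> \<in> A \<Longrightarrow> p \<in> cdom \<kappa> \<Longrightarrow> V g p = jet_eval (jet_value (coords_ten A \<kappa> g) (cmap \<kappa> p)) e"
    using V g unfolding natural_scalar_invariant_def by blast
  let ?G = "coords_ten A \<kappa> g"
  have U: "open (cimg \<kappa>)" by (rule open_cimg[OF \<kappa>])
  have G: "smooth_on (cimg \<kappa>) ?G" by (rule sym_tensorD(1)[OF metricD(1)[OF g] \<kappa>])
  have I: "smooth_on (cimg \<kappa>) (\<lambda>y. matrix_inv (?G y))"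
    by (rule smooth_on_matrix_inv[OF U G]) (use coords_metric_det_pos[OF g \<kappa>] in force)
  have "smooth_on (cimg \<kappa>) (\<lambda>x. jet_value ?G x v)" for v
    by (cases v) (simp_all add: smooth_on_entry[OF U smooth_on_pds[OF G]] smooth_on_entry[OF U smooth_on_pds[OF I]])
  then have "smooth_on (cimg \<kappa>) (\<lambda>x. jet_eval (jet_value ?G x) e)"
    by (rule smooth_on_jet_eval[OF U])
  then show "smooth_on (cimg \<kappa>) (\<lambda>x. V g (cinv \<kappa> x))"
    by (rule smooth_on_cong[OF U]) (simp add: e[OF \<kappa> cinv_in_cdom] cmap_cinv)
qed

end

theorem theorem2p7:
  fixes A Or :: "('a::t2_space, 'n::finite) chart set"
    and C :: "('a \<Rightarrow> real^'n^'n) set"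
    and V :: "('a \<Rightarrow> real^'n^'n) \<Rightarrow> 'a \<Rightarrow> real"
    and g :: "'a \<Rightarrow> real^'n^'n"
    and X :: "'a \<Rightarrow> real^'n"
  assumes "smooth_structure A"
    and "oriented_atlas A Or"
    and "compact (UNIV :: 'a set)"
    and "connected (UNIV :: 'a set)"
    and "CARD('n) \<ge> 2"
    and "conformal_class A C"
    and "natural_scalar_invariant A V"
    and "naturally_conformally_variational A C V"
    and "g \<in> C"
    and "conformal_vector_field A g X"
  shows "0 = (\<integral>p. divergence A g X p * V g p \<partial>riemannian_measure A g) \<and>
    (\<integral>p. divergence A g X p * V g p \<partial>riemannian_measure A g) =
      - (\<integral>p. lie_fun A X (V g) p \<partial>riemannian_measure A g)"
proof -
  interpret closed_manifold A
    by standard (fact assms(1), fact assms(3))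
  have g: "riemannian_metric A g" by (rule conformal_class_metric[OF assms(6,9)])
  have X: "vector_field A X" using assms(10) by (simp add: conformal_vector_field_def)
  show ?thesis
    using integral_divergence_times_invariant[OF assms(6,9,8,10)]
      integral_by_parts[OF g X smooth_natural_scalar_invariant[OF assms(7) g]] by simp
qed

end
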